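(* For every tree $\Upsilon$ the space $C_0(\Upsilon)$ admits $C^\infty$ partitions of unity: for every open cover $\mathcal{U}$ of $C_0(\Upsilon)$ there is a locally finite partition of unity consisting of infinitely Fréchet differentiable functions, subordinate to $\mathcal{U}$.
   Context: A tree is a partially ordered set $(\Upsilon,\preceq)$ such that for each $t\in\Upsilon$ the set $\{s: s\preceq t\}$ is well-ordered by $\preceq$; write $(0,t]=\{s:s\preceq t\}$, $(0,t)=\{s:s\prec t\}$, and let $r(t)$ be the order type of $(0,t)$. Trees are assumed Hausdorff: if $r(t)$ is a limit ordinal and $(0,t)=(0,t')$ then $t=t'$. $\Upsilon$ carries the coarsest topology in which every $(0,t]$ is open and closed. $C_0(\Upsilon)$ is the Banach space of continuous $f:\Upsilon\to\mathbb{R}$ such that $\{t:|f(t)|\ge\epsilon\}$ is compact for all $\epsilon>0$, with the supremum norm. *)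

theory Defs
  imports "HOL-Analysis.Analysis"
begin

definition tree_below :: "'a set \<Rightarrow> ('a \<Rightarrow> 'a \<Rightarrow> bool) \<Rightarrow> 'a \<Rightarrow> 'a set" where
  "tree_below T le t = {s \<in> T. le s t \<and> s \<noteq> t}"

definition tree_downset :: "'a set \<Rightarrow> ('a \<Rightarrow> 'a \<Rightarrow> bool) \<Rightarrow> 'a \<Rightarrow> 'a set" where
  "tree_downset T le t = {s \<in> T. le s t}"

text \<open>The order type of the well-ordered set (0,t) is a limit ordinal iff (0,t) is
  nonempty and has no largest element.\<close>
definition tree_limit_node :: "'a set \<Rightarrow> ('a \<Rightarrow> 'a \<Rightarrow> bool) \<Rightarrow> 'a \<Rightarrow> bool" where
  "tree_limit_node T le t \<longleftrightarrow> tree_below T le t \<noteq> {} \<and>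
     \<not> (\<exists>m\<in>tree_below T le t. \<forall>s\<in>tree_below T le t. le s m)"

definition is_tree :: "'a set \<Rightarrow> ('a \<Rightarrow> 'a \<Rightarrow> bool) \<Rightarrow> bool" where
  "is_tree T le \<longleftrightarrow>
     (\<forall>x\<in>T. le x x) \<and>
     (\<forall>x\<in>T. \<forall>y\<in>T. le x y \<and> le y x \<longrightarrow> x = y) \<and>
     (\<forall>x\<in>T. \<forall>y\<in>T. \<forall>z\<in>T. le x y \<and> le y z \<longrightarrow> le x z) \<and>
     (\<forall>t\<in>T. (\<forall>x\<in>tree_downset T le t. \<forall>y\<in>tree_downset T le t. le x y \<or> le y x) \<and>
             (\<forall>B. B \<subseteq> tree_downset T le t \<and> B \<noteq> {} \<longrightarrow> (\<exists>m\<in>B. \<forall>b\<in>B. le m b))) \<and>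
     (\<forall>t\<in>T. \<forall>t'\<in>T. tree_limit_node T le t \<and> tree_below T le t = tree_below T le t'
        \<longrightarrow> t = t')"

definition tree_topology :: "'a set \<Rightarrow> ('a \<Rightarrow> 'a \<Rightarrow> bool) \<Rightarrow> 'a topology" where
  "tree_topology T le = topology_generated_by
     (insert T ((\<lambda>t. tree_downset T le t) ` T \<union> (\<lambda>t. T - tree_downset T le t) ` T))"

definition C0 :: "'a set \<Rightarrow> ('a \<Rightarrow> 'a \<Rightarrow> bool) \<Rightarrow> ('a \<Rightarrow> real) set" where
  "C0 T le = {f. continuous_map (tree_topology T le) euclideanreal f \<and>
                 (\<forall>\<epsilon>>0. compactin (tree_topology T le) {t \<in> T. \<bar>f t\<bar> \<ge> \<epsilon>}) \<and>
                 (\<forall>t. t \<notin> T \<longrightarrow> f t = 0)}"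

definition sup_norm :: "'a set \<Rightarrow> ('a \<Rightarrow> real) \<Rightarrow> real" where
  "sup_norm T f = Sup (insert 0 ((\<lambda>t. \<bar>f t\<bar>) ` T))"

definition nopen :: "('a \<Rightarrow> real) set \<Rightarrow> (('a \<Rightarrow> real) \<Rightarrow> real) \<Rightarrow> ('a \<Rightarrow> real) set \<Rightarrow> bool" where
  "nopen V N U \<longleftrightarrow> U \<subseteq> V \<and>
     (\<forall>x\<in>U. \<exists>r>0. \<forall>y\<in>V. N (\<lambda>t. y t - x t) < r \<longrightarrow> y \<in> U)"

definition nclosure :: "('a \<Rightarrow> real) set \<Rightarrow> (('a \<Rightarrow> real) \<Rightarrow> real) \<Rightarrow> ('a \<Rightarrow> real) set \<Rightarrow> ('a \<Rightarrow> real) set" where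
  "nclosure V N S = {x \<in> V. \<forall>r>0. \<exists>y\<in>S. N (\<lambda>t. y t - x t) < r}"

definition bounded_multilinear_form ::
  "('a \<Rightarrow> real) set \<Rightarrow> (('a \<Rightarrow> real) \<Rightarrow> real) \<Rightarrow> nat \<Rightarrow> (('a \<Rightarrow> real) list \<Rightarrow> real) \<Rightarrow> bool" where
  "bounded_multilinear_form V N k D \<longleftrightarrow>
     (\<forall>xs ys u v a b. length xs + Suc (length ys) = k \<and> set xs \<subseteq> V \<and> set ys \<subseteq> V \<and>
        u \<in> V \<and> v \<in> V \<longrightarrow>
        D (xs @ (\<lambda>t. a * u t + b * v t) # ys) = a * D (xs @ u # ys) + b * D (xs @ v # ys)) \<and>
     (\<exists>C. \<forall>hs. length hs = k \<and> set hs \<subseteq> V \<longrightarrow> \<bar>D hs\<bar> \<le> C * prod_list (map N hs))"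

definition multilinear_norm ::
  "('a \<Rightarrow> real) set \<Rightarrow> (('a \<Rightarrow> real) \<Rightarrow> real) \<Rightarrow> nat \<Rightarrow> (('a \<Rightarrow> real) list \<Rightarrow> real) \<Rightarrow> real" where
  "multilinear_norm V N k D =
     Sup {\<bar>D hs\<bar> | hs. length hs = k \<and> set hs \<subseteq> V \<and> (\<forall>h\<in>set hs. N h \<le> 1)}"

text \<open>F is infinitely Frechet differentiable on V: there are D k x (the k-th derivative at x,
  a bounded k-linear form) with D 0 x = F x and D (Suc k) x the Frechet derivative of
  x \<mapsto> D k x, with respect to the operator norm of k-linear forms.\<close>
definition smooth_on :: "('a \<Rightarrow> real) set \<Rightarrow> (('a \<Rightarrow> real) \<Rightarrow> real) \<Rightarrow> (('a \<Rightarrow> real) \<Rightarrow> real) \<Rightarrow> bool" where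
  "smooth_on V N F \<longleftrightarrow>
     (\<exists>D :: nat \<Rightarrow> ('a \<Rightarrow> real) \<Rightarrow> ('a \<Rightarrow> real) list \<Rightarrow> real.
        (\<forall>x\<in>V. D 0 x [] = F x) \<and>
        (\<forall>k. \<forall>x\<in>V. bounded_multilinear_form V N k (D k x)) \<and>
        (\<forall>k. \<forall>x\<in>V. \<forall>\<epsilon>>0. \<exists>\<delta>>0. \<forall>h\<in>V. N h < \<delta> \<longrightarrow>
           multilinear_norm V N k
             (\<lambda>hs. D k (\<lambda>t. x t + h t) hs - D k x hs - D (Suc k) x (h # hs)) \<le> \<epsilon> * N h))"

definition open_cover :: "('a \<Rightarrow> real) set \<Rightarrow> (('a \<Rightarrow> real) \<Rightarrow> real) \<Rightarrow> ('a \<Rightarrow> real) set set \<Rightarrow> bool" where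
  "open_cover V N \<U> \<longleftrightarrow> (\<forall>U\<in>\<U>. nopen V N U) \<and> V \<subseteq> \<Union>\<U>"

definition smooth_lf_pou_subordinate ::
  "('a \<Rightarrow> real) set \<Rightarrow> (('a \<Rightarrow> real) \<Rightarrow> real) \<Rightarrow> ('a \<Rightarrow> real) set set \<Rightarrow> (('a \<Rightarrow> real) \<Rightarrow> real) set \<Rightarrow> bool" where
  "smooth_lf_pou_subordinate V N \<U> \<Phi> \<longleftrightarrow>
     (\<forall>\<phi>\<in>\<Phi>. smooth_on V N \<phi> \<and> (\<forall>x\<in>V. 0 \<le> \<phi> x \<and> \<phi> x \<le> 1)) \<and>
     (\<forall>x\<in>V. \<exists>r>0. finite {\<phi>\<in>\<Phi>. \<exists>y\<in>V. N (\<lambda>t. y t - x t) < r \<and> \<phi> y \<noteq> 0}) \<and>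
     (\<forall>x\<in>V. (\<Sum>\<phi>\<in>{\<phi>\<in>\<Phi>. \<phi> x \<noteq> 0}. \<phi> x) = 1) \<and>
     (\<forall>\<phi>\<in>\<Phi>. \<exists>U\<in>\<U>. nclosure V N {x\<in>V. \<phi> x \<noteq> 0} \<subseteq> U)"

end

theory Submission
  imports Defs
begin

text \<open>
  A node \<open>t\<close> is detected by \<open>f\<close> when \<open>\<bar>f\<bar>\<close> lies above a given gap of values at \<open>t\<close> and below
  it at all immediate successors of \<open>t\<close>. For a fixed gap only finitely many
  nodes are detected, uniformly near \<open>f\<close>, and the detection is a smooth function of \<open>f\<close>, because
  \<open>f\<close> restricted to the successors of \<open>t\<close> lies in \<open>c\<^sub>0\<close>. Every maximal node of
  \<open>{\<bar>f\<bar> \<ge> \<epsilon>}\<close> is detected for some gap just below \<open>\<epsilon>\<close>. This has two consequences.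

  First, multiplying \<open>1 - \<close>detection over all nodes and over a sequence of gaps which shrink and
  increase to \<open>1/2\<close> gives a smooth bump function: if the norm of \<open>f\<close> is at least \<open>1/2\<close>, some factor
  vanishes near \<open>f\<close>, and otherwise only finitely many gaps are active near \<open>f\<close>.

  Secondly, the detected nodes together with the jumps of \<open>f\<close> on the branches below them
  determine \<open>f\<close> up to \<open>\<epsilon>\<close> by a rational step function. For each finite set \<open>F\<close> of such nodes and
  each rational step function \<open>g\<close> built on \<open>F\<close>, the product of the detection functions of \<open>F\<close> with a
  rescaled bump centred at \<open>g\<close> is smooth with small support, and the family is \<open>\<sigma>\<close>-locally finite
  since finite subsets of a finite set are finite in number. It can therefore be normalised to a
  partition of unity.
\<close>

section \<open>Smooth functions of one real variable\<close>

text \<open>Smoothness comes from local dependence on finitely many evaluations: near a given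
  \<open>f\<close>, each function built on the tree is a smooth function of finitely many values
  \<open>f t\<close>. The obstacle is finiteness. The set where |f| is large is compact, hence
  covered by finitely many sets \<open>(0, t]\<close>, but such a branch may be infinite and a node
  may have infinitely many successors. What is finite is the set of drops: left continuity and
  well-ordering allow only finitely many jumps of a given size along a branch, and a detected node
  that is not one of finitely many maximal nodes is the start of such a jump. A gap is split into
  three equal parts: the outer two carry the smooth transitions, and the middle one guarantees a
  jump that survives a small perturbation of \<open>f\<close>. The bump uses a sequence of shrinking
  gaps because the distance between the value at a maximal node and the values at its successors has
  no lower bound independent of \<open>f\<close>. Rational gaps and rational step values keep the
  number of locally finite levels countable, although there may be uncountably many nodes.\<close>

definition psi_fun :: "real poly \<Rightarrow> real \<Rightarrow> real" where
  "psi_fun p x = (if x \<le> 0 then 0 else poly p (1 / x) * exp (- (1 / x)))"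

text \<open>The factor \<open>y ^ k\<close> absorbs the power split off by \<open>pCons\<close> in
  the induction; its instance \<open>k = 1\<close> is the difference quotient of
  \<open>psi_fun\<close> at 0 after the substitution \<open>y = 1 / x\<close>.\<close>

lemma poly_times_exp_tendsto_0:
  fixes p :: "real poly"
  shows "((\<lambda>y. y ^ k * poly p y * exp (- y)) \<longlongrightarrow> 0) at_top"
proof (induction p arbitrary: k)
  case 0
  then show ?case by simp
next
  case (pCons a p)
  have "((\<lambda>y::real. y ^ k * exp (- y)) \<longlongrightarrow> 0) at_top"
    using tendsto_power_div_exp_0[of k] by (simp add: exp_minus field_simps)
  then have "((\<lambda>y. a * (y ^ k * exp (- y)) + y ^ Suc k * poly p y * exp (- y)) \<longlongrightarrow> a * 0 + 0) at_top"
    by (intro tendsto_intros pCons.IH)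
  then show ?case by (simp add: algebra_simps)
qed

text \<open>For \<open>x > 0\<close> the derivative is
  \<open>(p(1/x) - p'(1/x)) exp(-1/x) / x^2\<close>, and \<open>1/x^2\<close> is the value at
  \<open>1/x\<close> of the polynomial \<open>[:0, 0, 1:]\<close>. Arbitrary polynomial factors thus
  make the class closed under differentiation, which gives derivatives of all orders at
  once.\<close>

lemma psi_fun_has_derivative:
  "(psi_fun p has_real_derivative psi_fun ([:0, 0, 1:] * (p - pderiv p)) x) (at x)"
proof -
  consider "x < 0" | "x = 0" | "x > 0" by linarith
  then show ?thesis
  proof cases
    case 1
    have "((\<lambda>_. 0) has_real_derivative 0) (at x)" by simp
    then have "(psi_fun p has_real_derivative 0) (at x)"
      by (rule DERIV_cong_ev[THEN iffD1, rotated -1])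
        (use 1 in \<open>auto simp: psi_fun_def eventually_nhds intro!: exI[of _ "{..<0}"]\<close>)
    with 1 show ?thesis by (simp add: psi_fun_def)
  next
    case 2
    have "((\<lambda>h. psi_fun p h / h) \<longlongrightarrow> 0) (at 0)"
      unfolding filterlim_split_at
    proof (intro filterlim_split_at)
      show "((\<lambda>h. psi_fun p h / h) \<longlongrightarrow> 0) (at_left 0)"
        by (rule tendsto_eventually) (auto simp: psi_fun_def eventually_at_left_field intro!: exI[of _ "-1"])
      have "((\<lambda>h. inverse h ^ 1 * poly p (inverse h) * exp (- inverse h)) \<longlongrightarrow> 0) (at_right 0)"
        by (rule filterlim_compose[OF poly_times_exp_tendsto_0 filterlim_inverse_at_top_right])
      then show "((\<lambda>h. psi_fun p h / h) \<longlongrightarrow> 0) (at_right 0)"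
        by (rule Lim_transform_eventually)
          (auto simp: psi_fun_def eventually_at_right_field divide_simps intro!: exI[of _ 1])
    qed
    then show ?thesis
      using 2 by (simp add: DERIV_def psi_fun_def)
  next
    case 3
    have "((\<lambda>x. poly p (1 / x) * exp (- (1 / x))) has_real_derivative
      psi_fun ([:0, 0, 1:] * (p - pderiv p)) x) (at x)"
      using 3 by (auto intro!: derivative_eq_intros simp: psi_fun_def field_simps power2_eq_square)
    then show ?thesis
      by (rule DERIV_cong_ev[THEN iffD1, rotated -1])
        (use 3 in \<open>auto simp: psi_fun_def eventually_nhds intro!: exI[of _ "{0<..}"]\<close>)
  qed
qed

text \<open>\<open>d\<close> is a tower of successive derivatives. They are two-sided at each point
  of \<open>A\<close>, so \<open>A\<close> need not be open and can be any set containing the range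
  of the inner function.\<close>

definition real_smooth_on :: "real set \<Rightarrow> (real \<Rightarrow> real) \<Rightarrow> bool" where
  "real_smooth_on A h \<longleftrightarrow> (\<exists>d. d 0 = h \<and> (\<forall>k. \<forall>u\<in>A. (d k has_real_derivative d (Suc k) u) (at u)))"

lemma real_smooth_on_derivative:
  assumes "real_smooth_on A h"
  shows "\<exists>h'. real_smooth_on A h' \<and> (\<forall>u\<in>A. (h has_real_derivative h' u) (at u))"
proof -
  obtain d where d: "d 0 = h" "\<forall>k. \<forall>u\<in>A. (d k has_real_derivative d (Suc k) u) (at u)"
    using assms unfolding real_smooth_on_def by blast
  have "real_smooth_on A (d 1)"
    unfolding real_smooth_on_def using d(2) by (intro exI[of _ "\<lambda>k. d (Suc k)"]) auto
  moreover have "(h has_real_derivative d 1 u) (at u)" if "u \<in> A" for u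
    using d(2)[rule_format, of u 0] that by (simp add: d(1))
  ultimately show ?thesis by blast
qed

lemma real_smooth_on_psi: "real_smooth_on A (psi_fun p)"
  unfolding real_smooth_on_def
  using psi_fun_has_derivative
  by (intro exI[of _ "\<lambda>k. psi_fun (((\<lambda>p. [:0, 0, 1:] * (p - pderiv p)) ^^ k) p)"]) auto

lemma real_smooth_on_affine: "real_smooth_on A (\<lambda>u. a + b * u)"
  unfolding real_smooth_on_def
  by (intro exI[of _ "\<lambda>k u. if k = 0 then a + b * u else if k = 1 then b else 0"])
     (auto intro!: derivative_eq_intros)

lemma real_smooth_on_square: "real_smooth_on A (\<lambda>u. u\<^sup>2)"
  unfolding real_smooth_on_def
  by (intro exI[of _ "\<lambda>k u. if k = 0 then u\<^sup>2 else if k = 1 then 2 * u else if k = 2 then 2 else 0"])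
     (auto intro!: derivative_eq_intros)

lemma real_smooth_on_inverse:
  assumes "0 \<notin> A"
  shows "real_smooth_on A inverse"
  unfolding real_smooth_on_def
proof (intro exI conjI allI ballI)
  define d where "d = (\<lambda>k u::real. (-1) ^ k * fact k * inverse u ^ Suc k)"
  show "d 0 = inverse" by (auto simp: d_def)
  show "(d k has_real_derivative d (Suc k) u) (at u)" if "u \<in> A" for k u
  proof -
    have "u \<noteq> 0" using assms that by auto
    have "(d k has_real_derivative (-1) ^ k * fact k *
        ((1 + real k) * (- (inverse u ^ Suc (Suc 0)) * inverse u ^ k))) (at u)"
      unfolding d_def by (intro DERIV_cmult DERIV_power_Suc DERIV_inverse \<open>u \<noteq> 0\<close>)
    then show ?thesis by (simp add: d_def algebra_simps)
  qed
qed

section \<open>Smooth steps and thresholds\<close>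

definition smooth_step :: "real \<Rightarrow> real" where
  "smooth_step x = psi_fun 1 x * inverse (psi_fun 1 x + psi_fun 1 (1 - x))"

lemma psi_fun_1: "psi_fun 1 x \<ge> 0" "psi_fun 1 x > 0 \<longleftrightarrow> x > 0" "psi_fun 1 x = 0 \<longleftrightarrow> x \<le> 0"
  by (auto simp: psi_fun_def)

lemma smooth_step_denominator_pos: "psi_fun 1 x + psi_fun 1 (1 - x) > 0"
  using psi_fun_1[of x] psi_fun_1[of "1 - x"] by (cases "x > 0") auto

lemma smooth_step_eq_0_iff: "smooth_step x = 0 \<longleftrightarrow> x \<le> 0"
  using smooth_step_denominator_pos[of x] psi_fun_1[of x] by (auto simp: smooth_step_def)

lemma smooth_step_eq_1_iff: "smooth_step x = 1 \<longleftrightarrow> x \<ge> 1"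
  using smooth_step_denominator_pos[of x] psi_fun_1(3)[of "1 - x"]
  by (auto simp: smooth_step_def field_simps)

lemma smooth_step_nonneg: "0 \<le> smooth_step x"
  and smooth_step_le_1: "smooth_step x \<le> 1"
  using smooth_step_denominator_pos[of x] psi_fun_1[of x] psi_fun_1[of "1 - x"]
  by (auto simp: smooth_step_def field_simps)

text \<open>The squares replace |u|, which is not differentiable at 0.\<close>

definition threshold :: "real \<Rightarrow> real \<Rightarrow> real \<Rightarrow> real" where
  "threshold a b u = smooth_step ((u\<^sup>2 - a\<^sup>2) / (b\<^sup>2 - a\<^sup>2))"

lemma threshold_nonneg: "0 \<le> threshold a b u"
  and threshold_le_1: "threshold a b u \<le> 1"
  by (simp_all add: threshold_def smooth_step_nonneg smooth_step_le_1)

lemma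
  assumes "0 < a" "a < b"
  shows threshold_eq_0_iff: "threshold a b u = 0 \<longleftrightarrow> \<bar>u\<bar> \<le> a"
    and threshold_eq_1_iff: "threshold a b u = 1 \<longleftrightarrow> b \<le> \<bar>u\<bar>"
proof -
  have "a\<^sup>2 < b\<^sup>2" using assms by (intro power_strict_mono) auto
  moreover have "u\<^sup>2 \<le> a\<^sup>2 \<longleftrightarrow> \<bar>u\<bar> \<le> a" "b\<^sup>2 \<le> u\<^sup>2 \<longleftrightarrow> b \<le> \<bar>u\<bar>"
    using assms abs_le_square_iff[of u a] abs_le_square_iff[of b u] by auto
  ultimately show "threshold a b u = 0 \<longleftrightarrow> \<bar>u\<bar> \<le> a" "threshold a b u = 1 \<longleftrightarrow> b \<le> \<bar>u\<bar>"
    by (auto simp: threshold_def smooth_step_eq_0_iff smooth_step_eq_1_iff divide_le_0_iff le_divide_eq)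
qed

section \<open>Smooth functions on a normed function space\<close>

locale function_norm =
  fixes V :: "('a \<Rightarrow> real) set" and N :: "('a \<Rightarrow> real) \<Rightarrow> real"
  assumes zero_mem: "(\<lambda>t. 0) \<in> V"
    and lin_mem: "\<And>a b u v. u \<in> V \<Longrightarrow> v \<in> V \<Longrightarrow> (\<lambda>t. a * u t + b * v t) \<in> V"
    and norm_nonneg: "\<And>u. u \<in> V \<Longrightarrow> 0 \<le> N u"
    and norm_triangle: "\<And>u v. u \<in> V \<Longrightarrow> v \<in> V \<Longrightarrow> N (\<lambda>t. u t + v t) \<le> N u + N v"
    and norm_scale: "\<And>a u. u \<in> V \<Longrightarrow> N (\<lambda>t. a * u t) = \<bar>a\<bar> * N u"
begin

lemma scale_mem: "u \<in> V \<Longrightarrow> (\<lambda>t. a * u t) \<in> V"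
  using lin_mem[of u u a 0] by simp

lemma add_mem: "u \<in> V \<Longrightarrow> v \<in> V \<Longrightarrow> (\<lambda>t. u t + v t) \<in> V"
  using lin_mem[of u v 1 1] by simp

lemma diff_mem: "u \<in> V \<Longrightarrow> v \<in> V \<Longrightarrow> (\<lambda>t. u t - v t) \<in> V"
  using lin_mem[of u v 1 "-1"] by simp

lemma add_scale_mem: "u \<in> V \<Longrightarrow> v \<in> V \<Longrightarrow> (\<lambda>t. u t + a * v t) \<in> V"
  using lin_mem[of u v 1 a] by simp

lemma norm_zero: "N (\<lambda>t. 0) = 0"
  using norm_scale[OF zero_mem, of 0] by simp

lemma norm_diff_commute: "u \<in> V \<Longrightarrow> v \<in> V \<Longrightarrow> N (\<lambda>t. u t - v t) = N (\<lambda>t. v t - u t)"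
  using norm_scale[OF diff_mem, of u v "-1"] by simp

lemma norm_diff_triangle:
  assumes "u \<in> V" "v \<in> V" "w \<in> V"
  shows "N (\<lambda>t. u t - w t) \<le> N (\<lambda>t. u t - v t) + N (\<lambda>t. v t - w t)"
  using norm_triangle[OF diff_mem[OF assms(1,2)] diff_mem[OF assms(2,3)]] by simp

definition nball :: "('a \<Rightarrow> real) \<Rightarrow> real \<Rightarrow> ('a \<Rightarrow> real) set" where
  "nball x r = {y \<in> V. N (\<lambda>t. y t - x t) < r}"

lemma centre_mem_nball: "x \<in> V \<Longrightarrow> 0 < r \<Longrightarrow> x \<in> nball x r"
  by (simp add: nball_def norm_zero)

lemma nball_mono: "r \<le> s \<Longrightarrow> nball x r \<subseteq> nball x s"
  by (auto simp: nball_def)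

lemma nball_subset: "nball x r \<subseteq> V"
  by (auto simp: nball_def)

lemma nball_sub_nball:
  assumes "x \<in> V" "y \<in> nball x r"
  obtains s where "s > 0" "nball y s \<subseteq> nball x r"
proof
  show "r - N (\<lambda>t. y t - x t) > 0" using assms by (simp add: nball_def)
  show "nball y (r - N (\<lambda>t. y t - x t)) \<subseteq> nball x r"
  proof
    fix z assume "z \<in> nball y (r - N (\<lambda>t. y t - x t))"
    then show "z \<in> nball x r"
      using assms norm_diff_triangle[of z y x] by (auto simp: nball_def)
  qed
qed

lemma nopen_nball: "x \<in> V \<Longrightarrow> nopen V N (nball x r)"
  unfolding nopen_def
proof (intro conjI ballI)
  fix y assume x: "x \<in> V" and y: "y \<in> nball x r"
  show "\<exists>s>0. \<forall>z\<in>V. N (\<lambda>t. z t - y t) < s \<longrightarrow> z \<in> nball x r"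
    by (rule nball_sub_nball[OF x y]) (auto simp: nball_def)
qed (rule nball_subset)

section \<open>Bounded functionals and expressions built from them\<close>

definition functional :: "(('a \<Rightarrow> real) \<Rightarrow> real) \<Rightarrow> bool" where
  "functional l \<longleftrightarrow>
     (\<forall>u\<in>V. \<forall>v\<in>V. \<forall>a b. l (\<lambda>t. a * u t + b * v t) = a * l u + b * l v) \<and>
     (\<exists>C. \<forall>u\<in>V. \<bar>l u\<bar> \<le> C * N u)"

lemma functionalD:
  assumes "functional l" "u \<in> V" "v \<in> V"
  shows "l (\<lambda>t. a * u t + b * v t) = a * l u + b * l v"
  using assms by (auto simp: functional_def)

lemma functional_scale: "functional l \<Longrightarrow> u \<in> V \<Longrightarrow> l (\<lambda>t. a * u t) = a * l u"
  using functionalD[of l u u a 0] by simp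

lemma functional_bound:
  assumes "functional l"
  obtains C where "C \<ge> 0" "\<And>u. u \<in> V \<Longrightarrow> \<bar>l u\<bar> \<le> C * N u"
proof -
  obtain C where C: "\<And>u. u \<in> V \<Longrightarrow> \<bar>l u\<bar> \<le> C * N u"
    using assms unfolding functional_def by blast
  have "\<bar>l u\<bar> \<le> max C 0 * N u" if "u \<in> V" for u
    using C[OF that] norm_nonneg[OF that] mult_right_mono[of C "max C 0" "N u"] by linarith
  then show ?thesis by (intro that[of "max C 0"]) auto
qed

lemma functional_zero: "functional (\<lambda>_. 0)"
  by (auto simp: functional_def intro!: exI[of _ 0])

text \<open>Closed under directional derivatives, as all outer functions are smooth in one variable;
  products arise by polarisation.\<close>
inductive smooth_expr :: "('a \<Rightarrow> real) set \<Rightarrow> (('a \<Rightarrow> real) \<Rightarrow> real) \<Rightarrow> bool"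
  for B :: "('a \<Rightarrow> real) set" where
  lin: "functional l \<Longrightarrow> smooth_expr B l"
| add: "smooth_expr B F \<Longrightarrow> smooth_expr B G \<Longrightarrow> smooth_expr B (\<lambda>x. F x + G x)"
| comp: "smooth_expr B G \<Longrightarrow> real_smooth_on A h \<Longrightarrow> G ` B \<subseteq> A \<Longrightarrow> smooth_expr B (\<lambda>x. h (G x))"
| eq_on: "smooth_expr B G \<Longrightarrow> (\<And>x. x \<in> B \<Longrightarrow> F x = G x) \<Longrightarrow> smooth_expr B F"

lemma smooth_expr_mono: "smooth_expr B F \<Longrightarrow> B' \<subseteq> B \<Longrightarrow> smooth_expr B' F"
proof (induction rule: smooth_expr.induct)
  case (lin l)
  then show ?case by (intro smooth_expr.lin)
next
  case (add F G)
  then show ?case by (intro smooth_expr.add)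
next
  case (comp G A h)
  show ?case by (rule smooth_expr.comp[OF comp(4)[OF comp(5)] comp(2)]) (use comp(3,5) in auto)
next
  case (eq_on G F)
  show ?case by (rule smooth_expr.eq_on[OF eq_on(3)[OF eq_on(4)]]) (use eq_on(2,4) in auto)
qed

lemma smooth_expr_affine:
  assumes "smooth_expr B F"
  shows "smooth_expr B (\<lambda>x. a + b * F x)"
  using smooth_expr.comp[OF assms real_smooth_on_affine[of UNIV a b]] by simp

lemma smooth_expr_const: "smooth_expr B (\<lambda>_. c)"
  using smooth_expr_affine[OF smooth_expr.lin[OF functional_zero], of B c] by simp

lemma smooth_expr_mult:
  assumes "smooth_expr B F" "smooth_expr B G"
  shows "smooth_expr B (\<lambda>x. F x * G x)"
proof -
  have sq: "smooth_expr B (\<lambda>x. (H x)\<^sup>2)" if "smooth_expr B H" for H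
    using smooth_expr.comp[OF that real_smooth_on_square[of UNIV]] by simp
  have "smooth_expr B (\<lambda>x. (0 + 1/4 * (F x + G x)\<^sup>2) + (0 + (-1/4) * (F x + (0 + (-1) * G x))\<^sup>2))"
    by (intro smooth_expr.add smooth_expr_affine sq assms)
  then show ?thesis
    by (rule smooth_expr.eq_on) (simp add: power2_eq_square algebra_simps)
qed

section \<open>First derivatives\<close>

definition frechet :: "(('a \<Rightarrow> real) \<Rightarrow> real) \<Rightarrow> ('a \<Rightarrow> real) \<Rightarrow> (('a \<Rightarrow> real) \<Rightarrow> real) \<Rightarrow> bool" where
  "frechet F x L \<longleftrightarrow> (\<forall>\<epsilon>>0. \<exists>\<delta>>0. \<forall>h\<in>V. N h < \<delta> \<longrightarrow>
     \<bar>F (\<lambda>t. x t + h t) - F x - L h\<bar> \<le> \<epsilon> * N h)"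

lemma frechet_functional:
  assumes "functional l" "x \<in> V"
  shows "frechet l x l"
  unfolding frechet_def
proof (intro allI impI exI[of _ 1] conjI ballI)
  fix \<epsilon> :: real and h assume "\<epsilon> > 0" "h \<in> V"
  then show "\<bar>l (\<lambda>t. x t + h t) - l x - l h\<bar> \<le> \<epsilon> * N h"
    using functionalD[OF assms \<open>h \<in> V\<close>, of 1 1] norm_nonneg[OF \<open>h \<in> V\<close>] by simp
qed simp

lemma frechet_add:
  assumes "frechet F x L" "frechet G x M"
  shows "frechet (\<lambda>x. F x + G x) x (\<lambda>h. L h + M h)"
  unfolding frechet_def
proof (intro allI impI)
  fix \<epsilon> :: real assume "\<epsilon> > 0"
  then have "\<epsilon> / 2 > 0" by simp
  obtain d1 where "d1 > 0"
    and d1: "\<And>h. h \<in> V \<Longrightarrow> N h < d1 \<Longrightarrow> \<bar>F (\<lambda>t. x t + h t) - F x - L h\<bar> \<le> \<epsilon> / 2 * N h"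
    using assms(1) \<open>\<epsilon> / 2 > 0\<close> unfolding frechet_def by meson
  obtain d2 where "d2 > 0"
    and d2: "\<And>h. h \<in> V \<Longrightarrow> N h < d2 \<Longrightarrow> \<bar>G (\<lambda>t. x t + h t) - G x - M h\<bar> \<le> \<epsilon> / 2 * N h"
    using assms(2) \<open>\<epsilon> / 2 > 0\<close> unfolding frechet_def by meson
  have "\<bar>F (\<lambda>t. x t + h t) + G (\<lambda>t. x t + h t) - (F x + G x) - (L h + M h)\<bar> \<le> \<epsilon> * N h"
    if "h \<in> V" "N h < min d1 d2" for h
    using d1[of h] d2[of h] that by (simp add: abs_if split: if_splits)
  then show "\<exists>\<delta>>0. \<forall>h\<in>V. N h < \<delta> \<longrightarrow>
      \<bar>F (\<lambda>t. x t + h t) + G (\<lambda>t. x t + h t) - (F x + G x) - (L h + M h)\<bar> \<le> \<epsilon> * N h"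
    using \<open>d1 > 0\<close> \<open>d2 > 0\<close> by (intro exI[of _ "min d1 d2"]) auto
qed

lemma frechet_comp:
  assumes F: "frechet F x L" and "C \<ge> 0" and L: "\<And>h. h \<in> V \<Longrightarrow> \<bar>L h\<bar> \<le> C * N h"
    and g: "(g has_real_derivative g') (at (F x))"
  shows "frechet (\<lambda>x. g (F x)) x (\<lambda>h. g' * L h)"
  unfolding frechet_def
proof (intro allI impI)
  fix \<epsilon> :: real assume \<epsilon>: "\<epsilon> > 0"
  \<comment> \<open>The error splits into the outer one, at most \<open>e1\<close> times |k - F x|
    <= (C + 1) N h, and the inner one, at most |g'| \<open>e2\<close> N h. Each is made at most half
    of the target, and \<open>e2 <= 1\<close> yields the factor \<open>C + 1\<close>.\<close>
  define e1 where "e1 = \<epsilon> / (2 * (C + 1))"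
  define e2 where "e2 = min 1 (\<epsilon> / (2 * (\<bar>g'\<bar> + 1)))"
  have e: "e1 > 0" "e2 > 0" using \<epsilon> \<open>C \<ge> 0\<close> by (auto simp: e1_def e2_def)
  obtain d1 where "d1 > 0" and d1: "\<And>k. \<bar>k - F x\<bar> < d1 \<Longrightarrow> \<bar>g k - g (F x) - g' * (k - F x)\<bar> \<le> e1 * \<bar>k - F x\<bar>"
    using g e(1) unfolding has_field_derivative_def has_derivative_at_alt by (auto simp: mult.commute)
  obtain d2 where "d2 > 0" and d2: "\<And>h. h \<in> V \<Longrightarrow> N h < d2 \<Longrightarrow> \<bar>F (\<lambda>t. x t + h t) - F x - L h\<bar> \<le> e2 * N h"
    using F e(2) unfolding frechet_def by meson
  show "\<exists>\<delta>>0. \<forall>h\<in>V. N h < \<delta> \<longrightarrow>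
      \<bar>g (F (\<lambda>t. x t + h t)) - g (F x) - g' * L h\<bar> \<le> \<epsilon> * N h"
  proof (intro exI[of _ "min d2 (d1 / (C + 1))"] conjI ballI impI)
    show "0 < min d2 (d1 / (C + 1))" using \<open>d1 > 0\<close> \<open>d2 > 0\<close> \<open>C \<ge> 0\<close> by simp
    fix h assume h: "h \<in> V" and Nh: "N h < min d2 (d1 / (C + 1))"
    define k where "k = F (\<lambda>t. x t + h t)"
    have n: "N h \<ge> 0" using norm_nonneg[OF h] .
    have A: "\<bar>k - F x - L h\<bar> \<le> e2 * N h" using d2[OF h] Nh by (simp add: k_def)
    moreover have "e2 * N h \<le> 1 * N h" using n by (intro mult_right_mono) (auto simp: e2_def)
    ultimately have B: "\<bar>k - F x\<bar> \<le> (C + 1) * N h" using L[OF h] by (simp add: algebra_simps)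
    also have "\<dots> < d1" using Nh \<open>C \<ge> 0\<close> by (simp add: field_simps)
    finally have D: "\<bar>g k - g (F x) - g' * (k - F x)\<bar> \<le> e1 * \<bar>k - F x\<bar>" by (rule d1)
    have "e1 * \<bar>k - F x\<bar> \<le> e1 * ((C + 1) * N h)" using B e by (intro mult_left_mono) auto
    also have "\<dots> = \<epsilon> / 2 * N h" using \<open>C \<ge> 0\<close> by (simp add: e1_def field_simps)
    finally have E: "\<bar>g k - g (F x) - g' * (k - F x)\<bar> \<le> \<epsilon> / 2 * N h" using D by simp
    have "\<bar>g' * (k - F x - L h)\<bar> \<le> \<bar>g'\<bar> * (e2 * N h)"
      unfolding abs_mult using A by (intro mult_left_mono) auto
    also have "\<dots> \<le> (\<bar>g'\<bar> + 1) * (\<epsilon> / (2 * (\<bar>g'\<bar> + 1)) * N h)"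
      using n e by (intro mult_mono mult_right_mono) (auto simp: e2_def)
    also have "\<dots> = \<epsilon> / 2 * N h" by (simp add: field_simps add_nonneg_eq_0_iff)
    finally show "\<bar>g (F (\<lambda>t. x t + h t)) - g (F x) - g' * L h\<bar> \<le> \<epsilon> * N h"
      using E unfolding k_def[symmetric] by (simp add: algebra_simps abs_if split: if_splits)
  qed
qed

lemma frechet_cong:
  assumes "frechet G x L" "nopen V N B" "x \<in> B" "\<And>y. y \<in> B \<Longrightarrow> F y = G y"
  shows "frechet F x L"
  unfolding frechet_def
proof (intro allI impI)
  fix \<epsilon> :: real assume "\<epsilon> > 0"
  then obtain d where "d > 0" and d: "\<And>h. h \<in> V \<Longrightarrow> N h < d \<Longrightarrow> \<bar>G (\<lambda>t. x t + h t) - G x - L h\<bar> \<le> \<epsilon> * N h"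
    using assms(1) unfolding frechet_def by meson
  obtain r where "r > 0" and r: "\<And>y. y \<in> V \<Longrightarrow> N (\<lambda>t. y t - x t) < r \<Longrightarrow> y \<in> B"
    using assms(2,3) unfolding nopen_def by meson
  have "x \<in> V" using assms(2,3) by (auto simp: nopen_def)
  have "\<bar>F (\<lambda>t. x t + h t) - F x - L h\<bar> \<le> \<epsilon> * N h" if "h \<in> V" "N h < min d r" for h
  proof -
    have "(\<lambda>t. x t + h t) \<in> B" using that by (intro r add_mem \<open>x \<in> V\<close>) auto
    then show ?thesis using d[of h] that assms(3,4) by simp
  qed
  then show "\<exists>\<delta>>0. \<forall>h\<in>V. N h < \<delta> \<longrightarrow> \<bar>F (\<lambda>t. x t + h t) - F x - L h\<bar> \<le> \<epsilon> * N h"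
    using \<open>d > 0\<close> \<open>r > 0\<close> by (intro exI[of _ "min d r"]) auto
qed

lemma frechet_directional:
  assumes F: "frechet F x L" and L: "\<And>a h. h \<in> V \<Longrightarrow> L (\<lambda>t. a * h t) = a * L h" and h: "h \<in> V"
  shows "((\<lambda>s. F (\<lambda>t. x t + s * h t)) has_real_derivative L h) (at 0)"
  unfolding has_field_derivative_def has_derivative_at_alt
proof (intro conjI allI impI)
  show "bounded_linear ((*) (L h))" by (rule bounded_linear_mult_right)
  fix e :: real assume "e > 0"
  have n: "N h \<ge> 0" using norm_nonneg[OF h] .
  \<comment> \<open>The summand 1 avoids division by \<open>N h\<close>, which may be 0.\<close>
  then have "e / (N h + 1) > 0" using \<open>e > 0\<close> by simp
  then obtain d where "d > 0" and d: "\<And>h'. h' \<in> V \<Longrightarrow> N h' < d \<Longrightarrow>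
      \<bar>F (\<lambda>t. x t + h' t) - F x - L h'\<bar> \<le> e / (N h + 1) * N h'"
    using F unfolding frechet_def by meson
  show "\<exists>d>0. \<forall>y. norm (y - 0) < d \<longrightarrow>
      norm (F (\<lambda>t. x t + y * h t) - F (\<lambda>t. x t + 0 * h t) - L h * (y - 0)) \<le> e * norm (y - 0)"
  proof (intro exI[of _ "d / (N h + 1)"] conjI allI impI)
    show "0 < d / (N h + 1)" using n \<open>d > 0\<close> by simp
    fix s :: real assume "norm (s - 0) < d / (N h + 1)"
    then have "\<bar>s\<bar> * (N h + 1) < d" using n by (simp add: field_simps)
    moreover have "\<bar>s\<bar> * N h \<le> \<bar>s\<bar> * (N h + 1)" by (intro mult_left_mono) auto
    ultimately have "N (\<lambda>t. s * h t) < d" by (simp add: norm_scale[OF h])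
    from d[OF scale_mem[OF h] this]
    have "\<bar>F (\<lambda>t. x t + s * h t) - F x - s * L h\<bar> \<le> e / (N h + 1) * (\<bar>s\<bar> * N h)"
      by (simp add: L[OF h] norm_scale[OF h])
    also have "\<dots> = e * \<bar>s\<bar> * (N h / (N h + 1))" by simp
    also have "\<dots> \<le> e * \<bar>s\<bar> * 1" using n \<open>e > 0\<close> by (intro mult_left_mono) auto
    finally show "norm (F (\<lambda>t. x t + s * h t) - F (\<lambda>t. x t + 0 * h t) - L h * (s - 0)) \<le> e * norm (s - 0)"
      by (simp add: mult.commute)
  qed
qed

definition gradient :: "((('a \<Rightarrow> real) \<Rightarrow> real) \<times> (('a \<Rightarrow> real) \<Rightarrow> real)) list \<Rightarrow> ('a \<Rightarrow> real) \<Rightarrow> ('a \<Rightarrow> real) \<Rightarrow> real" where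
  "gradient L x h = (\<Sum>(g, l)\<leftarrow>L. g x * l h)"

lemma gradient_scale:
  assumes "\<forall>(g, l)\<in>set L. smooth_expr B g \<and> functional l" "h \<in> V"
  shows "gradient L x (\<lambda>t. a * h t) = a * gradient L x h"
  using assms by (induction L) (auto simp: gradient_def functional_scale algebra_simps)

lemma gradient_bound:
  assumes "\<forall>(g, l)\<in>set L. smooth_expr B g \<and> functional l"
  obtains C where "C \<ge> 0" "\<And>h. h \<in> V \<Longrightarrow> \<bar>gradient L x h\<bar> \<le> C * N h"
  using assms
proof (induction L arbitrary: thesis)
  case Nil
  then show ?case by (simp add: gradient_def) (metis order_refl mult_zero_left)
next
  case (Cons gl L)
  obtain g l where gl: "gl = (g, l)" by force
  obtain C where C: "C \<ge> 0" "\<And>h. h \<in> V \<Longrightarrow> \<bar>gradient L x h\<bar> \<le> C * N h"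
    using Cons.IH Cons.prems(2) by auto
  obtain D where D: "D \<ge> 0" "\<And>h. h \<in> V \<Longrightarrow> \<bar>l h\<bar> \<le> D * N h"
    using functional_bound[of l] Cons.prems(2) gl by auto
  show ?case
  proof (rule Cons.prems(1))
    show "\<bar>g x\<bar> * D + C \<ge> 0" using C D by simp
    fix h assume h: "h \<in> V"
    have "\<bar>g x * l h\<bar> \<le> \<bar>g x\<bar> * (D * N h)" unfolding abs_mult using D(2)[OF h] by (intro mult_left_mono) auto
    then show "\<bar>gradient (gl # L) x h\<bar> \<le> (\<bar>g x\<bar> * D + C) * N h"
      using C(2)[OF h] by (simp add: gradient_def gl algebra_simps)
  qed
qed

text \<open>The derivative is a finite combination of functionals that do not depend on the point;
  only the coefficients do, and these are expressions again, so the result can be iterated. The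
  chain rule multiplies coefficients by \<open>h' (G x)\<close>, which is where closure under
  products enters.\<close>

lemma smooth_expr_gradient:
  assumes "nopen V N B" "smooth_expr B G"
  shows "\<exists>L. (\<forall>(g, l)\<in>set L. smooth_expr B g \<and> functional l) \<and> (\<forall>x\<in>B. frechet G x (gradient L x))"
  using assms(2)
proof (induction rule: smooth_expr.induct)
  case (lin l)
  have "gradient [(\<lambda>_. 1, l)] x = l" for x by (auto simp: gradient_def)
  then show ?case using lin assms(1)
    by (intro exI[of _ "[(\<lambda>_. 1, l)]"]) (auto simp: nopen_def intro!: smooth_expr_const frechet_functional)
next
  case (add F G)
  then obtain L M where L: "\<forall>(g, l)\<in>set L. smooth_expr B g \<and> functional l" "\<forall>x\<in>B. frechet F x (gradient L x)"
    and M: "\<forall>(g, l)\<in>set M. smooth_expr B g \<and> functional l" "\<forall>x\<in>B. frechet G x (gradient M x)" by blast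
  have "gradient (L @ M) x = (\<lambda>h. gradient L x h + gradient M x h)" for x by (auto simp: gradient_def)
  then show ?case using L M by (intro exI[of _ "L @ M"]) (auto intro!: frechet_add)
next
  case (comp G A h)
  then obtain L where L: "\<forall>(g, l)\<in>set L. smooth_expr B g \<and> functional l" "\<forall>x\<in>B. frechet G x (gradient L x)"
    by blast
  obtain h' where h': "real_smooth_on A h'" "\<forall>u\<in>A. (h has_real_derivative h' u) (at u)"
    using real_smooth_on_derivative[OF comp(2)] by blast
  let ?M = "map (\<lambda>(g, l). (\<lambda>x. h' (G x) * g x, l)) L"
  have M: "gradient ?M x = (\<lambda>v. h' (G x) * gradient L x v)" for x
    by (rule ext, induction L) (auto simp: gradient_def algebra_simps)
  have "frechet (\<lambda>x. h (G x)) x (gradient ?M x)" if "x \<in> B" for x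
  proof -
    obtain C where "C \<ge> 0" "\<And>h. h \<in> V \<Longrightarrow> \<bar>gradient L x h\<bar> \<le> C * N h"
      using gradient_bound[OF L(1)] by blast
    then show ?thesis unfolding M using L(2) h'(2) comp(3) that by (intro frechet_comp[where C = C]) auto
  qed
  moreover have "\<forall>(g, l)\<in>set ?M. smooth_expr B g \<and> functional l"
    using L(1) smooth_expr_mult[OF smooth_expr.comp[OF comp(1) h'(1) comp(3)]] by auto
  ultimately show ?case by blast
next
  case (eq_on G F)
  then show ?case using frechet_cong[OF _ assms(1)] by blast
qed

text \<open>Defined without reference to an expression, so that local representations by different
  expressions on overlapping balls yield the same derivatives.\<close>
fun dir_deriv :: "(('a \<Rightarrow> real) \<Rightarrow> real) \<Rightarrow> ('a \<Rightarrow> real) list \<Rightarrow> ('a \<Rightarrow> real) \<Rightarrow> real" where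
  "dir_deriv F [] x = F x"
| "dir_deriv F (h # hs) x = deriv (\<lambda>s. dir_deriv F hs (\<lambda>t. x t + s * h t)) 0"

section \<open>Higher derivatives as finite sums of elementary tensors\<close>

definition tensor :: "(('a \<Rightarrow> real) \<Rightarrow> real) list \<Rightarrow> ('a \<Rightarrow> real) list \<Rightarrow> real" where
  "tensor ls hs = prod_list (map2 (\<lambda>l h. l h) ls hs)"

definition form_value :: "((('a \<Rightarrow> real) \<Rightarrow> real) \<times> (('a \<Rightarrow> real) \<Rightarrow> real) list) list
    \<Rightarrow> ('a \<Rightarrow> real) \<Rightarrow> ('a \<Rightarrow> real) list \<Rightarrow> real" where
  "form_value R x hs = (\<Sum>(g, ls)\<leftarrow>R. g x * tensor ls hs)"

text \<open>With the k-th derivative in this form, multilinearity and boundedness are properties of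
  the fixed tensors, and differentiability in operator norm becomes differentiability of finitely
  many real coefficients.\<close>

definition represents where
  "represents B k F R \<longleftrightarrow>
     (\<forall>(g, ls)\<in>set R. smooth_expr B g \<and> length ls = k \<and> (\<forall>l\<in>set ls. functional l)) \<and>
     (\<forall>x\<in>B. \<forall>hs. length hs = k \<longrightarrow> set hs \<subseteq> V \<longrightarrow> dir_deriv F hs x = form_value R x hs)"

lemma tensor_bound:
  assumes "\<forall>l\<in>set ls. functional l"
  obtains C where "C \<ge> 0" "\<And>hs. length hs = length ls \<Longrightarrow> set hs \<subseteq> V \<Longrightarrow> \<bar>tensor ls hs\<bar> \<le> C * prod_list (map N hs)"
  using assms
proof (induction ls arbitrary: thesis)
  case Nil
  then show ?case by (auto simp: tensor_def intro: Nil(1)[of 1])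
next
  case (Cons l ls)
  obtain C where C: "C \<ge> 0" "\<And>hs. length hs = length ls \<Longrightarrow> set hs \<subseteq> V \<Longrightarrow> \<bar>tensor ls hs\<bar> \<le> C * prod_list (map N hs)"
    using Cons.IH Cons.prems(2) by auto
  obtain D where D: "D \<ge> 0" "\<And>h. h \<in> V \<Longrightarrow> \<bar>l h\<bar> \<le> D * N h"
    using functional_bound[of l] Cons.prems(2) by auto
  show ?case
  proof (rule Cons.prems(1))
    show "D * C \<ge> 0" using C D by simp
    fix hs assume hs: "length hs = length (l # ls)" "set hs \<subseteq> V"
    then obtain h hs' where [simp]: "hs = h # hs'" by (cases hs) auto
    have "\<bar>l h * tensor ls hs'\<bar> \<le> (D * N h) * (C * prod_list (map N hs'))"
      unfolding abs_mult using hs C D norm_nonneg by (intro mult_mono) auto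
    then show "\<bar>tensor (l # ls) hs\<bar> \<le> D * C * prod_list (map N hs)"
      by (simp add: tensor_def algebra_simps)
  qed
qed

lemma tensor_linear:
  assumes "\<forall>l\<in>set ls. functional l" "length xs + Suc (length ys) = length ls" "u \<in> V" "v \<in> V"
  shows "tensor ls (xs @ (\<lambda>t. a * u t + b * v t) # ys) =
    a * tensor ls (xs @ u # ys) + b * tensor ls (xs @ v # ys)"
  using assms(1,2)
proof (induction ls arbitrary: xs)
  case Nil
  then show ?case by simp
next
  case (Cons l ls)
  show ?case
  proof (cases xs)
    case Nil
    then show ?thesis using Cons.prems assms(3,4)
      by (simp add: tensor_def functionalD algebra_simps)
  next
    case (Cons x xs')
    then show ?thesis using Cons.IH[of xs'] Cons.prems
      by (simp add: tensor_def algebra_simps)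
  qed
qed

lemma form_value_bounded_multilinear:
  assumes "\<forall>(g, ls)\<in>set R. length ls = k \<and> (\<forall>l\<in>set ls. functional l)"
  shows "bounded_multilinear_form V N k (form_value R x)"
  unfolding bounded_multilinear_form_def
proof (intro conjI allI impI)
  fix xs ys u v and a b :: real
  assume *: "length xs + Suc (length ys) = k \<and> set xs \<subseteq> V \<and> set ys \<subseteq> V \<and> u \<in> V \<and> v \<in> V"
  show "form_value R x (xs @ (\<lambda>t. a * u t + b * v t) # ys) =
    a * form_value R x (xs @ u # ys) + b * form_value R x (xs @ v # ys)"
    using assms
  proof (induction R)
    case (Cons r R)
    then show ?case using *
      by (cases r) (auto simp: form_value_def tensor_linear algebra_simps)
  qed (simp add: form_value_def)
next
  show "\<exists>C. \<forall>hs. length hs = k \<and> set hs \<subseteq> V \<longrightarrow> \<bar>form_value R x hs\<bar> \<le> C * prod_list (map N hs)"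
    using assms
  proof (induction R)
    case Nil
    then show ?case by (auto simp: form_value_def intro!: exI[of _ 0])
  next
    case (Cons r R)
    obtain g ls where r: "r = (g, ls)" by force
    obtain C where C: "\<And>hs. length hs = k \<Longrightarrow> set hs \<subseteq> V \<Longrightarrow> \<bar>form_value R x hs\<bar> \<le> C * prod_list (map N hs)"
      using Cons by auto
    obtain D where D: "D \<ge> 0" "\<And>hs. length hs = k \<Longrightarrow> set hs \<subseteq> V \<Longrightarrow> \<bar>tensor ls hs\<bar> \<le> D * prod_list (map N hs)"
      using tensor_bound[of ls] Cons.prems r by auto
    show ?case
    proof (intro exI[of _ "\<bar>g x\<bar> * D + C"] allI impI)
      fix hs assume hs: "length hs = k \<and> set hs \<subseteq> V"
      then have "\<bar>g x * tensor ls hs\<bar> \<le> \<bar>g x\<bar> * (D * prod_list (map N hs))"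
        unfolding abs_mult using D(2) by (intro mult_left_mono) auto
      then show "\<bar>form_value (r # R) x hs\<bar> \<le> (\<bar>g x\<bar> * D + C) * prod_list (map N hs)"
        using C[of hs] hs by (simp add: form_value_def r algebra_simps)
    qed
  qed
qed

text \<open>As \<open>B\<close> is open, the representation also holds at the points
  \<open>x + s h\<close> for small \<open>s\<close>. The derivative along the line can then be taken
  term by term, with the tensors as constants.\<close>

lemma dir_deriv_Suc:
  assumes "nopen V N B" and R: "represents B k F R"
    and L: "\<forall>(g, ls)\<in>set R. (\<forall>(g', l)\<in>set (L g). smooth_expr B g' \<and> functional l) \<and> (\<forall>x\<in>B. frechet g x (gradient (L g) x))"
    and x: "x \<in> B" and h: "h \<in> V" and hs: "length hs = k" "set hs \<subseteq> V"
  shows "dir_deriv F (h # hs) x = (\<Sum>(g, ls)\<leftarrow>R. gradient (L g) x h * tensor ls hs)"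
proof -
  obtain r where "r > 0" and r: "\<And>y. y \<in> V \<Longrightarrow> N (\<lambda>t. y t - x t) < r \<Longrightarrow> y \<in> B"
    using assms(1) x unfolding nopen_def by meson
  have xV: "x \<in> V" using x assms(1) by (auto simp: nopen_def)
  have n: "N h \<ge> 0" using norm_nonneg[OF h] .
  have eq: "dir_deriv F hs (\<lambda>t. x t + s * h t) = form_value R (\<lambda>t. x t + s * h t) hs"
    if "\<bar>s\<bar> < r / (N h + 1)" for s
  proof -
    have "\<bar>s\<bar> * N h \<le> \<bar>s\<bar> * (N h + 1)" by (intro mult_left_mono) auto
    also have "\<dots> < r" using that n by (simp add: field_simps)
    finally have "(\<lambda>t. x t + s * h t) \<in> B" using xV h by (intro r add_scale_mem) (auto simp: norm_scale)
    then show ?thesis using R hs by (auto simp: represents_def)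
  qed
  \<comment> \<open>Stated for sublists of \<open>R\<close>, so that the induction keeps the
    assumptions on all members of \<open>R\<close>.\<close>
  have "((\<lambda>s. form_value R' (\<lambda>t. x t + s * h t) hs) has_real_derivative
      (\<Sum>(g, ls)\<leftarrow>R'. gradient (L g) x h * tensor ls hs)) (at 0)" if "set R' \<subseteq> set R" for R'
    using that
  proof (induction R')
    case Nil
    then show ?case by (simp add: form_value_def)
  next
    case (Cons r R')
    obtain g ls where r: "r = (g, ls)" by force
    have Lg: "\<forall>(g', l)\<in>set (L g). smooth_expr B g' \<and> functional l" "frechet g x (gradient (L g) x)"
      using L Cons.prems r x by auto
    have "((\<lambda>s. g (\<lambda>t. x t + s * h t)) has_real_derivative gradient (L g) x h) (at 0)"
      by (rule frechet_directional[OF Lg(2) gradient_scale[OF Lg(1)] h])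
    from DERIV_add[OF DERIV_cmult_right[OF this, of "tensor ls hs"] Cons.IH] Cons.prems
    show ?case by (simp add: form_value_def r)
  qed
  from this[OF subset_refl]
  have "((\<lambda>s. dir_deriv F hs (\<lambda>t. x t + s * h t)) has_real_derivative
      (\<Sum>(g, ls)\<leftarrow>R. gradient (L g) x h * tensor ls hs)) (at 0)"
    by (rule has_field_derivative_transform_within[where d = "r / (N h + 1)"])
      (use eq n \<open>r > 0\<close> in \<open>auto simp: dist_real_def\<close>)
  then show ?thesis by (simp add: DERIV_imp_deriv)
qed

lemma smooth_expr_gradients:
  assumes "nopen V N B"
  shows "\<exists>L. \<forall>g. smooth_expr B g \<longrightarrow> (\<forall>(g', l)\<in>set (L g). smooth_expr B g' \<and> functional l) \<and>
    (\<forall>x\<in>B. frechet g x (gradient (L g) x))"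
  using smooth_expr_gradient[OF assms] by (intro choice) blast

lemma smooth_expr_represents:
  assumes B: "nopen V N B" and F: "smooth_expr B F"
  shows "\<exists>R. represents B k F R"
proof (induction k)
  case 0
  show ?case using F by (intro exI[of _ "[(F, [])]"]) (auto simp: represents_def form_value_def tensor_def)
next
  case (Suc k)
  then obtain R where R: "represents B k F R" by blast
  obtain L where L: "\<forall>g. smooth_expr B g \<longrightarrow> (\<forall>(g', l)\<in>set (L g). smooth_expr B g' \<and> functional l) \<and>
    (\<forall>x\<in>B. frechet g x (gradient (L g) x))" using smooth_expr_gradients[OF B] by blast
  have L': "\<forall>(g, ls)\<in>set R. (\<forall>(g', l)\<in>set (L g). smooth_expr B g' \<and> functional l) \<and> (\<forall>x\<in>B. frechet g x (gradient (L g) x))"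
    using L R by (auto simp: represents_def)
  \<comment> \<open>The new functional goes to the front, because \<open>dir_deriv\<close> treats
    the head of the list as the last direction of differentiation.\<close>
  let ?R = "concat (map (\<lambda>(g, ls). map (\<lambda>(g', l). (g', l # ls)) (L g)) R)"
  have val: "form_value ?R x (h # hs) = (\<Sum>(g, ls)\<leftarrow>R. gradient (L g) x h * tensor ls hs)" for x h hs
  proof (induction R)
    case (Cons r R)
    obtain g ls where r: "r = (g, ls)" by force
    have "form_value (map (\<lambda>(g', l). (g', l # ls)) M) x (h # hs) = gradient M x h * tensor ls hs" for M
      by (induction M) (auto simp: form_value_def gradient_def tensor_def algebra_simps)
    then show ?case using Cons by (simp add: form_value_def r)
  qed (simp add: form_value_def)
  have "represents B (Suc k) F ?R"
    unfolding represents_def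
  proof (intro conjI ballI allI impI)
    show "case gl of (g, ls) \<Rightarrow> smooth_expr B g \<and> length ls = Suc k \<and> (\<forall>l\<in>set ls. functional l)"
      if "gl \<in> set ?R" for gl
      using that L' R unfolding represents_def by fastforce
    fix x hs assume x: "x \<in> B" and hs: "length hs = Suc k" "set hs \<subseteq> V"
    then obtain h hs' where "hs = h # hs'" by (cases hs) auto
    then show "dir_deriv F hs x = form_value ?R x hs"
      using dir_deriv_Suc[OF B R L' x, of h hs'] hs val[of x h hs'] by simp
  qed
  then show ?case by blast
qed

lemma multilinear_norm_le:
  assumes "\<And>hs. length hs = k \<Longrightarrow> set hs \<subseteq> V \<Longrightarrow> \<forall>h\<in>set hs. N h \<le> 1 \<Longrightarrow> \<bar>D hs\<bar> \<le> c"
  shows "multilinear_norm V N k D \<le> c"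
  unfolding multilinear_norm_def
proof (rule cSup_least)
  \<comment> \<open>A list of zero directions shows that the supremum is not taken over the empty
    set.\<close>
  have "length (replicate k (\<lambda>t::'a. 0::real)) = k \<and> set (replicate k (\<lambda>t::'a. 0)) \<subseteq> V \<and>
      (\<forall>h\<in>set (replicate k (\<lambda>t::'a. 0)). N h \<le> 1)"
    using zero_mem norm_zero by (auto simp: set_replicate_conv_if)
  then show "{\<bar>D hs\<bar> |hs. length hs = k \<and> set hs \<subseteq> V \<and> (\<forall>h\<in>set hs. N h \<le> 1)} \<noteq> {}" by blast
qed (use assms in auto)

text \<open>Each coefficient is Frechet differentiable and each tensor is bounded on lists of
  vectors of norm at most 1. The finitely many coefficient errors therefore add up to an error that
  is uniform in \<open>hs\<close>, as the operator norm demands.\<close>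

lemma dir_deriv_frechet:
  assumes B: "nopen V N B" and F: "smooth_expr B F" and x: "x \<in> B" and "\<epsilon> > 0"
  shows "\<exists>\<delta>>0. \<forall>h\<in>V. N h < \<delta> \<longrightarrow> multilinear_norm V N k
    (\<lambda>hs. dir_deriv F hs (\<lambda>t. x t + h t) - dir_deriv F hs x - dir_deriv F (h # hs) x) \<le> \<epsilon> * N h"
proof -
  obtain R where R: "represents B k F R" using smooth_expr_represents[OF B F] by blast
  obtain L where L: "\<forall>g. smooth_expr B g \<longrightarrow> (\<forall>(g', l)\<in>set (L g). smooth_expr B g' \<and> functional l) \<and>
    (\<forall>x\<in>B. frechet g x (gradient (L g) x))" using smooth_expr_gradients[OF B] by blast
  have L': "\<forall>(g, ls)\<in>set R. (\<forall>(g', l)\<in>set (L g). smooth_expr B g' \<and> functional l) \<and> (\<forall>x\<in>B. frechet g x (gradient (L g) x))"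
    using L R by (auto simp: represents_def)
  obtain r where "r > 0" and r: "\<And>y. y \<in> V \<Longrightarrow> N (\<lambda>t. y t - x t) < r \<Longrightarrow> y \<in> B"
    using B x unfolding nopen_def by meson
  have xV: "x \<in> V" using x B by (auto simp: nopen_def)
  let ?E = "\<lambda>R h hs. (\<Sum>(g, ls)\<leftarrow>R. (g (\<lambda>t. x t + h t) - g x - gradient (L g) x h) * tensor ls hs)"
  have "\<exists>\<delta>>0. \<forall>h\<in>V. N h < \<delta> \<longrightarrow> (\<forall>hs. length hs = k \<and> set hs \<subseteq> V \<and> (\<forall>h\<in>set hs. N h \<le> 1) \<longrightarrow>
      \<bar>?E R' h hs\<bar> \<le> \<epsilon> * N h)" if "set R' \<subseteq> set R" "\<epsilon> > 0" for R' \<epsilon>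
    using that
  proof (induction R' arbitrary: \<epsilon>)
    case Nil
    then show ?case using norm_nonneg by (auto intro!: exI[of _ 1])
  next
    case (Cons r R')
    obtain g ls where r: "r = (g, ls)" by force
    have ls: "length ls = k" "\<forall>l\<in>set ls. functional l" using R Cons.prems r by (auto simp: represents_def)
    obtain C where C: "C \<ge> 0" "\<And>hs. length hs = k \<Longrightarrow> set hs \<subseteq> V \<Longrightarrow> \<bar>tensor ls hs\<bar> \<le> C * prod_list (map N hs)"
      using tensor_bound[OF ls(2)] ls(1) by blast
    have C1: "\<bar>tensor ls hs\<bar> \<le> C + 1" if "length hs = k" "set hs \<subseteq> V" "\<forall>h\<in>set hs. N h \<le> 1" for hs
    proof -
      have "prod_list (map N hs) \<le> 1"
        using that(2,3)
      proof (induction hs)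
        case (Cons h hs)
        then have "N h * prod_list (map N hs) \<le> 1 * 1"
          using norm_nonneg by (intro mult_mono prod_list_nonneg) auto
        then show ?case by simp
      qed simp
      then have "C * prod_list (map N hs) \<le> C * 1" using C(1) by (intro mult_left_mono) auto
      then show ?thesis using C(2)[OF that(1,2)] by simp
    qed
    have "\<epsilon> / 2 > 0" using Cons.prems by simp
    then obtain d where "d > 0" and d: "\<And>h hs. h \<in> V \<Longrightarrow> N h < d \<Longrightarrow> length hs = k \<Longrightarrow> set hs \<subseteq> V \<Longrightarrow> (\<forall>h\<in>set hs. N h \<le> 1) \<Longrightarrow>
      \<bar>?E R' h hs\<bar> \<le> \<epsilon> / 2 * N h" using Cons.IH[of "\<epsilon> / 2"] Cons.prems by (smt (verit) set_subset_Cons subset_trans)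
    have "\<epsilon> / (2 * (C + 1)) > 0" using Cons.prems C by simp
    moreover have "frechet g x (gradient (L g) x)" using L' Cons.prems x r by auto
    ultimately obtain d' where "d' > 0" and d': "\<And>h. h \<in> V \<Longrightarrow> N h < d' \<Longrightarrow>
        \<bar>g (\<lambda>t. x t + h t) - g x - gradient (L g) x h\<bar> \<le> \<epsilon> / (2 * (C + 1)) * N h"
      unfolding frechet_def by meson
    show ?case
    proof (intro exI[of _ "min d d'"] conjI ballI impI allI)
      show "0 < min d d'" using \<open>d > 0\<close> \<open>d' > 0\<close> by simp
      fix h hs assume h: "h \<in> V" "N h < min d d'" and hs: "length hs = k \<and> set hs \<subseteq> V \<and> (\<forall>h\<in>set hs. N h \<le> 1)"
      have "\<bar>(g (\<lambda>t. x t + h t) - g x - gradient (L g) x h) * tensor ls hs\<bar>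
        \<le> (\<epsilon> / (2 * (C + 1)) * N h) * (C + 1)"
        unfolding abs_mult using d'[of h] C1[of hs] h hs norm_nonneg[OF h(1)] Cons.prems C
        by (intro mult_mono) auto
      also have "\<dots> = \<epsilon> / 2 * N h" using C by (simp add: field_simps)
      finally show "\<bar>?E (r # R') h hs\<bar> \<le> \<epsilon> * N h"
        using d[of h hs] h hs by (simp add: r)
    qed
  qed
  from this[of R \<epsilon>] obtain d where "d > 0" and d: "\<And>h hs. h \<in> V \<Longrightarrow> N h < d \<Longrightarrow> length hs = k \<Longrightarrow> set hs \<subseteq> V \<Longrightarrow>
      (\<forall>h\<in>set hs. N h \<le> 1) \<Longrightarrow> \<bar>?E R h hs\<bar> \<le> \<epsilon> * N h" using \<open>\<epsilon> > 0\<close> by auto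
  show ?thesis
  proof (intro exI[of _ "min d r"] conjI ballI impI)
    show "0 < min d r" using \<open>d > 0\<close> \<open>r > 0\<close> by simp
    fix h assume h: "h \<in> V" "N h < min d r"
    have xh: "(\<lambda>t. x t + h t) \<in> B" using h by (intro r add_mem xV) auto
    show "multilinear_norm V N k
      (\<lambda>hs. dir_deriv F hs (\<lambda>t. x t + h t) - dir_deriv F hs x - dir_deriv F (h # hs) x) \<le> \<epsilon> * N h"
    proof (rule multilinear_norm_le)
      fix hs assume hs: "length hs = k" "set hs \<subseteq> V" "\<forall>h\<in>set hs. N h \<le> 1"
      have E: "form_value R' (\<lambda>t. x t + h t) hs - form_value R' x hs -
        (\<Sum>(g, ls)\<leftarrow>R'. gradient (L g) x h * tensor ls hs) = ?E R' h hs" for R'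
        by (induction R') (auto simp: form_value_def algebra_simps)
      have "dir_deriv F hs (\<lambda>t. x t + h t) - dir_deriv F hs x - dir_deriv F (h # hs) x = ?E R h hs"
        unfolding dir_deriv_Suc[OF B R L' x h(1) hs(1,2)] E[symmetric]
        using R hs xh x by (auto simp: represents_def)
      then show "\<bar>dir_deriv F hs (\<lambda>t. x t + h t) - dir_deriv F hs x - dir_deriv F (h # hs) x\<bar> \<le> \<epsilon> * N h"
        using d[of h hs] h hs by simp
    qed
  qed
qed

section \<open>Locally smooth functions and their closure properties\<close>

definition locally_smooth :: "(('a \<Rightarrow> real) \<Rightarrow> real) \<Rightarrow> bool" where
  "locally_smooth F \<longleftrightarrow> (\<forall>x\<in>V. \<exists>r>0. smooth_expr (nball x r) F)"

lemma locally_smooth_imp_smooth_on: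
  assumes "locally_smooth F"
  shows "smooth_on V N F"
  unfolding smooth_on_def
proof (intro exI[of _ "\<lambda>k x hs. dir_deriv F hs x"] conjI allI ballI impI)
  fix x k assume x: "x \<in> V"
  then obtain r where "r > 0" and r: "smooth_expr (nball x r) F"
    using assms by (auto simp: locally_smooth_def)
  note B = nopen_nball[OF x, of r] centre_mem_nball[OF x \<open>r > 0\<close>]
  obtain R where R: "represents (nball x r) k F R"
    using smooth_expr_represents[OF B(1) r] by blast
  have "bounded_multilinear_form V N k (form_value R x)"
    using R by (intro form_value_bounded_multilinear) (auto simp: represents_def)
  moreover have "dir_deriv F hs x = form_value R x hs" if "length hs = k" "set hs \<subseteq> V" for hs
    using R B(2) that by (auto simp: represents_def)
  ultimately show "bounded_multilinear_form V N k (\<lambda>hs. dir_deriv F hs x)"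
    unfolding bounded_multilinear_form_def using lin_mem by simp
  show "\<exists>\<delta>>0. \<forall>h\<in>V. N h < \<delta> \<longrightarrow> multilinear_norm V N k
    (\<lambda>hs. dir_deriv F hs (\<lambda>t. x t + h t) - dir_deriv F hs x - dir_deriv F (h # hs) x) \<le> \<epsilon> * N h"
    if "\<epsilon> > 0" for \<epsilon>
    using dir_deriv_frechet[OF B(1) r B(2) that] .
qed simp

lemma locally_smooth_local:
  assumes "\<And>x. x \<in> V \<Longrightarrow> \<exists>r>0. \<exists>G. locally_smooth G \<and> (\<forall>y\<in>nball x r. F y = G y)"
  shows "locally_smooth F"
  unfolding locally_smooth_def
proof
  fix x assume x: "x \<in> V"
  then obtain r G where "r > 0" and G: "locally_smooth G" and eq: "\<forall>y\<in>nball x r. F y = G y"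
    using assms by blast
  obtain s where "s > 0" "smooth_expr (nball x s) G" using G x by (auto simp: locally_smooth_def)
  then have "smooth_expr (nball x (min r s)) G" by (elim smooth_expr_mono) (simp add: nball_mono)
  then have "smooth_expr (nball x (min r s)) F"
    by (rule smooth_expr.eq_on) (use eq nball_mono[of "min r s" r x] in auto)
  then show "\<exists>r>0. smooth_expr (nball x r) F" using \<open>r > 0\<close> \<open>s > 0\<close> by (intro exI[of _ "min r s"]) auto
qed

lemma locally_smooth_functional: "functional l \<Longrightarrow> locally_smooth l"
  by (auto simp: locally_smooth_def intro: smooth_expr.lin zero_less_one)

lemma locally_smooth_const: "locally_smooth (\<lambda>_. c)"
  by (auto simp: locally_smooth_def intro: smooth_expr_const zero_less_one)

lemma locally_smooth_binary:
  assumes "\<And>B. smooth_expr B F \<Longrightarrow> smooth_expr B G \<Longrightarrow> smooth_expr B H"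
    and "locally_smooth F" "locally_smooth G"
  shows "locally_smooth H"
  unfolding locally_smooth_def
proof
  fix x assume x: "x \<in> V"
  then obtain r s where "r > 0" "s > 0" "smooth_expr (nball x r) F" "smooth_expr (nball x s) G"
    using assms(2,3) by (metis locally_smooth_def)
  then have "smooth_expr (nball x (min r s)) H"
    using smooth_expr_mono nball_mono[of "min r s" r x] nball_mono[of "min r s" s x]
    by (intro assms(1)) (metis min.cobounded1, metis min.cobounded2)
  then show "\<exists>r>0. smooth_expr (nball x r) H" using \<open>r > 0\<close> \<open>s > 0\<close> by (intro exI[of _ "min r s"]) auto
qed

lemma locally_smooth_add:
  "locally_smooth F \<Longrightarrow> locally_smooth G \<Longrightarrow> locally_smooth (\<lambda>x. F x + G x)"
  by (rule locally_smooth_binary[of F G]) (rule smooth_expr.add)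

lemma locally_smooth_mult:
  "locally_smooth F \<Longrightarrow> locally_smooth G \<Longrightarrow> locally_smooth (\<lambda>x. F x * G x)"
  by (rule locally_smooth_binary[of F G]) (rule smooth_expr_mult)

lemma locally_smooth_affine: "locally_smooth F \<Longrightarrow> locally_smooth (\<lambda>x. a + b * F x)"
  by (rule locally_smooth_binary[of F F]) (rule smooth_expr_affine)

lemma locally_smooth_diff:
  assumes "locally_smooth F" "locally_smooth G"
  shows "locally_smooth (\<lambda>x. F x - G x)"
  using locally_smooth_add[OF assms(1) locally_smooth_affine[OF assms(2), of 0 "-1"]] by simp

lemma locally_smooth_comp:
  assumes "locally_smooth F" "real_smooth_on A h" "\<And>x. x \<in> V \<Longrightarrow> F x \<in> A"
  shows "locally_smooth (\<lambda>x. h (F x))"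
  unfolding locally_smooth_def
proof
  fix x assume "x \<in> V"
  then obtain r where r: "r > 0" "smooth_expr (nball x r) F" using assms(1) by (auto simp: locally_smooth_def)
  then have "smooth_expr (nball x r) (\<lambda>x. h (F x))"
    using assms(2,3) nball_subset by (elim smooth_expr.comp) auto
  with r(1) show "\<exists>r>0. smooth_expr (nball x r) (\<lambda>x. h (F x))" by blast
qed

lemma locally_smooth_inverse:
  assumes "locally_smooth F" "\<And>x. x \<in> V \<Longrightarrow> F x \<noteq> 0"
  shows "locally_smooth (\<lambda>x. inverse (F x))"
  using assms by (elim locally_smooth_comp[where A = "- {0}"]) (auto simp: real_smooth_on_inverse)

lemma locally_smooth_step:
  assumes "locally_smooth F"
  shows "locally_smooth (\<lambda>x. smooth_step (F x))"
  unfolding smooth_step_def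
proof (rule locally_smooth_mult)
  have psi: "locally_smooth (\<lambda>x. psi_fun 1 (G x))" if "locally_smooth G" for G
    using that by (rule locally_smooth_comp[OF _ real_smooth_on_psi]) auto
  show "locally_smooth (\<lambda>x. psi_fun 1 (F x))" by (rule psi[OF assms])
  have "locally_smooth (\<lambda>x. psi_fun 1 (1 - F x))"
    by (rule psi[OF locally_smooth_diff[OF locally_smooth_const assms]])
  then show "locally_smooth (\<lambda>x. inverse (psi_fun 1 (F x) + psi_fun 1 (1 - F x)))"
    using locally_smooth_add[OF psi[OF assms]] smooth_step_denominator_pos
    by (intro locally_smooth_inverse) (auto simp: less_imp_neq[symmetric])
qed

lemma locally_smooth_threshold:
  assumes "locally_smooth F"
  shows "locally_smooth (\<lambda>x. threshold a b (F x))"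
proof -
  have "locally_smooth (\<lambda>x. smooth_step (- a\<^sup>2 / (b\<^sup>2 - a\<^sup>2) + (1 / (b\<^sup>2 - a\<^sup>2)) * (F x * F x)))"
    by (intro locally_smooth_step locally_smooth_affine locally_smooth_mult assms)
  then show ?thesis by (simp add: threshold_def power2_eq_square diff_divide_distrib add.commute)
qed

lemma locally_smooth_sum:
  assumes "\<And>i. i \<in> I \<Longrightarrow> locally_smooth (F i)"
  shows "locally_smooth (\<lambda>x. \<Sum>i\<in>I. F i x)"
  using assms by (induction I rule: infinite_finite_induct)
    (auto intro: locally_smooth_const locally_smooth_add)

lemma locally_smooth_prod:
  assumes "\<And>i. i \<in> I \<Longrightarrow> locally_smooth (F i)"
  shows "locally_smooth (\<lambda>x. \<Prod>i\<in>I. F i x)"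
  using assms by (induction I rule: infinite_finite_induct)
    (auto intro: locally_smooth_const locally_smooth_mult)

lemma locally_finite_sum_eq:
  fixes F :: "'i \<Rightarrow> ('a \<Rightarrow> real) \<Rightarrow> real"
  assumes "finite {i \<in> I. \<exists>y\<in>B. F i y \<noteq> 0}" "y \<in> B"
  shows "(\<Sum>i\<in>{i \<in> I. F i y \<noteq> 0}. F i y) = (\<Sum>i\<in>{i \<in> I. \<exists>y\<in>B. F i y \<noteq> 0}. F i y)"
  using assms by (intro sum.mono_neutral_left) auto

text \<open>The set of nonzero summands varies with \<open>x\<close>, but on a small ball it may be
  enlarged to one fixed finite set, as the extra summands are 0.\<close>

lemma locally_smooth_locally_finite_sum:
  assumes "\<And>i. i \<in> I \<Longrightarrow> locally_smooth (F i)"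
    and "\<And>x. x \<in> V \<Longrightarrow> \<exists>r>0. finite {i \<in> I. \<exists>y\<in>nball x r. F i y \<noteq> 0}"
  shows "locally_smooth (\<lambda>x. \<Sum>i\<in>{i \<in> I. F i x \<noteq> 0}. F i x)"
proof (rule locally_smooth_local)
  fix x assume "x \<in> V"
  then obtain r where "r > 0" "finite {i \<in> I. \<exists>y\<in>nball x r. F i y \<noteq> 0}" using assms(2) by blast
  then show "\<exists>r>0. \<exists>G. locally_smooth G \<and> (\<forall>y\<in>nball x r. (\<Sum>i\<in>{i \<in> I. F i y \<noteq> 0}. F i y) = G y)"
    using assms(1) by (intro exI[of _ r] conjI exI[of _ "\<lambda>z. \<Sum>i\<in>{i \<in> I. \<exists>y\<in>nball x r. F i y \<noteq> 0}. F i z"]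
      locally_smooth_sum ballI locally_finite_sum_eq) auto
qed

text \<open>An affine change of variable turns a functional \<open>l\<close> into the affine
  function \<open>c l f - c l g\<close>; the other constructors commute with it.\<close>

lemma smooth_expr_rescale:
  assumes "smooth_expr B F" "g \<in> V" "B' \<subseteq> V" "\<And>f. f \<in> B' \<Longrightarrow> (\<lambda>t. c * (f t - g t)) \<in> B"
  shows "smooth_expr B' (\<lambda>f. F (\<lambda>t. c * (f t - g t)))"
  using assms(1)
proof (induction rule: smooth_expr.induct)
  case (lin l)
  have "smooth_expr B' (\<lambda>f. - c * l g + c * l f)"
    by (intro smooth_expr_affine smooth_expr.lin lin)
  then show ?case
  proof (rule smooth_expr.eq_on)
    fix f assume "f \<in> B'"
    then have "l (\<lambda>t. c * f t + (- c) * g t) = c * l f + (- c) * l g"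
      using functionalD[OF lin _ assms(2)] assms(3) by blast
    then show "l (\<lambda>t. c * (f t - g t)) = - c * l g + c * l f" by (simp add: algebra_simps)
  qed
next
  case (add F G)
  show ?case by (rule smooth_expr.add[OF add(3,4)])
next
  case (comp G A h)
  show ?case by (rule smooth_expr.comp[OF comp(4) comp(2)]) (use comp(3) assms(4) in auto)
next
  case (eq_on G F)
  show ?case by (rule smooth_expr.eq_on[OF eq_on(3)]) (use eq_on(2) assms(4) in auto)
qed

lemma locally_smooth_rescale:
  assumes F: "locally_smooth F" and g: "g \<in> V"
  shows "locally_smooth (\<lambda>f. F (\<lambda>t. c * (f t - g t)))"
  unfolding locally_smooth_def
proof
  fix x assume x: "x \<in> V"
  let ?y = "\<lambda>t. c * (x t - g t)"
  have y: "?y \<in> V" by (intro scale_mem diff_mem x g)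
  then obtain r where r: "r > 0" "smooth_expr (nball ?y r) F" using F by (auto simp: locally_smooth_def)
  have "smooth_expr (nball x (r / (\<bar>c\<bar> + 1))) (\<lambda>f. F (\<lambda>t. c * (f t - g t)))"
  proof (rule smooth_expr_rescale[OF r(2) g nball_subset])
    fix f assume "f \<in> nball x (r / (\<bar>c\<bar> + 1))"
    then have f: "f \<in> V" and lt: "N (\<lambda>t. f t - x t) * (\<bar>c\<bar> + 1) < r" by (auto simp: nball_def field_simps)
    have d: "(\<lambda>t. f t - x t) \<in> V" using f x by (rule diff_mem)
    have "(\<lambda>t. c * (f t - g t) - ?y t) = (\<lambda>t. c * (f t - x t))" by (auto simp: algebra_simps)
    then have "N (\<lambda>t. c * (f t - g t) - ?y t) = \<bar>c\<bar> * N (\<lambda>t. f t - x t)" by (simp add: norm_scale[OF d])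
    also have "\<dots> \<le> N (\<lambda>t. f t - x t) * (\<bar>c\<bar> + 1)" using norm_nonneg[OF d] by (simp add: algebra_simps)
    finally show "(\<lambda>t. c * (f t - g t)) \<in> nball ?y r"
      using lt f g by (auto simp: nball_def intro!: scale_mem diff_mem)
  qed
  then show "\<exists>r>0. smooth_expr (nball x r) (\<lambda>f. F (\<lambda>t. c * (f t - g t)))"
    using r(1) by (intro exI[of _ "r / (\<bar>c\<bar> + 1)"]) (auto simp: add_nonneg_pos)
qed

subsection \<open>Partitions of unity\<close>

lemma locally_smooth_continuous:
  assumes "locally_smooth F" "x \<in> V" "e > 0"
  obtains r where "r > 0" "\<And>y. y \<in> nball x r \<Longrightarrow> \<bar>F y - F x\<bar> < e"
proof -
  obtain r where "r > 0" "smooth_expr (nball x r) F" using assms by (auto simp: locally_smooth_def)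
  then obtain L where L: "\<forall>(g, l)\<in>set L. smooth_expr (nball x r) g \<and> functional l" "frechet F x (gradient L x)"
    using smooth_expr_gradient[OF nopen_nball[OF assms(2)]] centre_mem_nball[OF assms(2)] by blast
  obtain C where C: "C \<ge> 0" "\<And>h. h \<in> V \<Longrightarrow> \<bar>gradient L x h\<bar> \<le> C * N h"
    using gradient_bound[OF L(1)] by blast
  obtain d where "d > 0" and d: "\<And>h. h \<in> V \<Longrightarrow> N h < d \<Longrightarrow>
      \<bar>F (\<lambda>t. x t + h t) - F x - gradient L x h\<bar> \<le> 1 * N h"
    using L(2) unfolding frechet_def by (meson zero_less_one)
  show ?thesis
  proof (rule that)
    show "min d (e / (C + 1)) > 0" using \<open>d > 0\<close> C(1) assms(3) by simp
    fix y assume "y \<in> nball x (min d (e / (C + 1)))"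
    then have y: "y \<in> V" and Ny: "N (\<lambda>t. y t - x t) < d" "(C + 1) * N (\<lambda>t. y t - x t) < e"
      using C(1) by (auto simp: nball_def field_simps)
    have "(\<lambda>t. y t - x t) \<in> V" using y assms(2) by (rule diff_mem)
    from d[OF this Ny(1)] C(2)[OF this] have "\<bar>F y - F x\<bar> \<le> (C + 1) * N (\<lambda>t. y t - x t)"
      by (simp add: algebra_simps)
    with Ny(2) show "\<bar>F y - F x\<bar> < e" by simp
  qed
qed

definition locally_finite_family :: "(('a \<Rightarrow> real) \<Rightarrow> real) set \<Rightarrow> bool" where
  "locally_finite_family H \<longleftrightarrow> (\<forall>x\<in>V. \<exists>r>0. finite {h \<in> H. \<exists>y\<in>nball x r. h y \<noteq> 0})"

lemma locally_finite_family_pointwise: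
  assumes "locally_finite_family H" "x \<in> V"
  shows "finite {h \<in> H. h x \<noteq> 0}"
proof -
  obtain r where "r > 0" "finite {h \<in> H. \<exists>y\<in>nball x r. h y \<noteq> 0}"
    using assms by (auto simp: locally_finite_family_def)
  then show ?thesis using centre_mem_nball[OF assms(2)] by (elim rev_finite_subset) auto
qed

lemma locally_smooth_family_sum:
  assumes "locally_finite_family H" "\<And>h. h \<in> H \<Longrightarrow> locally_smooth h"
  shows "locally_smooth (\<lambda>x. \<Sum>h\<in>{h \<in> H. h x \<noteq> 0}. h x)"
  using locally_smooth_locally_finite_sum[of H "\<lambda>h. h"] assms
  by (auto simp: locally_finite_family_def)

lemma smooth_pou_of_locally_finite_family:
  assumes lf: "locally_finite_family H"
    and smooth: "\<And>h. h \<in> H \<Longrightarrow> locally_smooth h"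
    and nonneg: "\<And>h x. h \<in> H \<Longrightarrow> x \<in> V \<Longrightarrow> 0 \<le> h x"
    and outside: "\<And>h x. h \<in> H \<Longrightarrow> x \<notin> V \<Longrightarrow> h x = 0"
    and pos: "\<And>x. x \<in> V \<Longrightarrow> \<exists>h\<in>H. h x \<noteq> 0"
    and sub: "\<And>h. h \<in> H \<Longrightarrow> \<exists>U\<in>\<U>. nclosure V N {x\<in>V. h x \<noteq> 0} \<subseteq> U"
  shows "\<exists>\<Phi>. smooth_lf_pou_subordinate V N \<U> \<Phi>"
proof -
  define S where "S x = (\<Sum>h\<in>{h \<in> H. h x \<noteq> 0}. h x)" for x
  have fin: "finite {h \<in> H. h x \<noteq> 0}" if "x \<in> V" for x
    using locally_finite_family_pointwise[OF lf that] .
  have le_S: "h x \<le> S x" if "h \<in> H" "x \<in> V" for h x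
    unfolding S_def using fin[OF that(2)] nonneg that
    by (cases "h x = 0") (auto intro!: member_le_sum[of h _ "\<lambda>h. h x"] sum_nonneg)
  have S_pos: "S x > 0" if x: "x \<in> V" for x
  proof -
    obtain h where "h \<in> H" "h x \<noteq> 0" using pos[OF x] by blast
    then show ?thesis using nonneg[of h x] le_S[of h x] x by linarith
  qed
  have S_smooth: "locally_smooth S"
    unfolding S_def using locally_smooth_family_sum[OF lf smooth] .
  txt \<open>The functions in \<open>H\<close> vanish outside \<open>V\<close>; this makes normalisation injective, so no two
    members of the resulting set collapse.\<close>
  define n where "n h x = h x * inverse (S x)" for h :: "('a \<Rightarrow> real) \<Rightarrow> real" and x
  have n0: "n h x = 0 \<longleftrightarrow> h x = 0" if "x \<in> V" for h x
    using S_pos[OF that] by (simp add: n_def)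
  have inj: "inj_on n H"
  proof (rule inj_onI)
    fix h h' assume *: "h \<in> H" "h' \<in> H" "n h = n h'"
    show "h = h'"
    proof
      fix x
      show "h x = h' x"
        using fun_cong[OF *(3), of x] S_pos[of x] outside[OF *(1), of x] outside[OF *(2), of x]
        by (cases "x \<in> V") (auto simp: n_def)
    qed
  qed
  have "smooth_lf_pou_subordinate V N \<U> (n ` H)"
    unfolding smooth_lf_pou_subordinate_def
  proof (intro conjI ballI)
    fix \<phi> assume "\<phi> \<in> n ` H"
    then obtain h where h: "h \<in> H" "\<phi> = n h" by blast
    have "locally_smooth (n h)"
      unfolding n_def using S_pos
      by (intro locally_smooth_mult smooth h locally_smooth_inverse S_smooth) (auto simp: less_imp_neq[symmetric])
    then show "smooth_on V N \<phi>" using h locally_smooth_imp_smooth_on by simp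
    fix x assume x: "x \<in> V"
    show "0 \<le> \<phi> x" using h nonneg[of h x] S_pos[of x] x by (simp add: n_def)
    show "\<phi> x \<le> 1" using h le_S[of h x] S_pos[of x] x by (simp add: n_def divide_simps flip: divide_inverse)
  next
    fix x assume x: "x \<in> V"
    then obtain r where r: "r > 0" "finite {h \<in> H. \<exists>y\<in>nball x r. h y \<noteq> 0}"
      using lf by (auto simp: locally_finite_family_def)
    have "{\<phi> \<in> n ` H. \<exists>y\<in>V. N (\<lambda>t. y t - x t) < r \<and> \<phi> y \<noteq> 0} \<subseteq> n ` {h \<in> H. \<exists>y\<in>nball x r. h y \<noteq> 0}"
      using n0 by (auto simp: nball_def)
    then show "\<exists>r>0. finite {\<phi> \<in> n ` H. \<exists>y\<in>V. N (\<lambda>t. y t - x t) < r \<and> \<phi> y \<noteq> 0}"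
      using r finite_surj by blast
    have "{\<phi> \<in> n ` H. \<phi> x \<noteq> 0} = n ` {h \<in> H. h x \<noteq> 0}" using n0[OF x] by auto
    then have "(\<Sum>\<phi>\<in>{\<phi> \<in> n ` H. \<phi> x \<noteq> 0}. \<phi> x) = (\<Sum>h\<in>{h \<in> H. h x \<noteq> 0}. n h x)"
      using inj by (simp add: sum.reindex inj_on_subset)
    also have "\<dots> = S x * inverse (S x)" by (simp add: n_def S_def sum_distrib_right)
    also have "\<dots> = 1" using S_pos[OF x] by simp
    finally show "(\<Sum>\<phi>\<in>{\<phi> \<in> n ` H. \<phi> x \<noteq> 0}. \<phi> x) = 1" .
  next
    fix \<phi> assume "\<phi> \<in> n ` H"
    then obtain h where h: "h \<in> H" "\<phi> = n h" by blast
    have "{x\<in>V. \<phi> x \<noteq> 0} = {x\<in>V. h x \<noteq> 0}" using n0 h by auto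
    then show "\<exists>U\<in>\<U>. nclosure V N {x \<in> V. \<phi> x \<noteq> 0} \<subseteq> U" using sub[OF h(1)] by simp
  qed
  then show ?thesis by blast
qed

lemma nclosure_mono: "A \<subseteq> B \<Longrightarrow> nclosure V N A \<subseteq> nclosure V N B"
  unfolding nclosure_def by blast

text \<open>Level \<open>i\<close> is damped by \<open>g i\<close>, which vanishes wherever some
  earlier sum \<open>s j\<close> is at least \<open>1/i\<close>. Around a point where a member of
  level \<open>i0\<close> is bounded below by \<open>c\<close>, all levels beyond \<open>i0\<close>
  and \<open>1/c\<close> are thus switched off, and the union of the levels becomes locally finite.
  No point is lost: at the first level with a member nonzero at \<open>x\<close>, all earlier sums
  are 0 and the damping factor is 1.\<close>

lemma smooth_pou_of_sigma_locally_finite: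
  fixes \<Phi> :: "nat \<Rightarrow> (('a \<Rightarrow> real) \<Rightarrow> real) set"
  assumes lf: "\<And>i. locally_finite_family (\<Phi> i)"
    and smooth: "\<And>i \<phi>. \<phi> \<in> \<Phi> i \<Longrightarrow> locally_smooth \<phi>"
    and nonneg: "\<And>i \<phi> x. \<phi> \<in> \<Phi> i \<Longrightarrow> x \<in> V \<Longrightarrow> 0 \<le> \<phi> x"
    and pos: "\<And>x. x \<in> V \<Longrightarrow> \<exists>i. \<exists>\<phi>\<in>\<Phi> i. \<phi> x \<noteq> 0"
    and sub: "\<And>i \<phi>. \<phi> \<in> \<Phi> i \<Longrightarrow> \<exists>U\<in>\<U>. nclosure V N {x\<in>V. \<phi> x \<noteq> 0} \<subseteq> U"
  shows "\<exists>\<Phi>. smooth_lf_pou_subordinate V N \<U> \<Phi>"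
proof -
  define s where "s i x = (\<Sum>h\<in>{h \<in> \<Phi> i. h x \<noteq> 0}. h x)" for i x
  \<comment> \<open>The summand 0 puts the argument into the form of
    \<open>locally_smooth_affine\<close>.\<close>
  define g where "g i x = (\<Prod>j<i. 1 - smooth_step (0 + real i * s j x))" for i x
  define m where "m i \<phi> x = (if x \<in> V then \<phi> x * g i x else 0)"
    for i and \<phi> :: "('a \<Rightarrow> real) \<Rightarrow> real" and x
  define H where "H = (\<Union>i. m i ` \<Phi> i)"
  have s_smooth: "locally_smooth (s i)" for i
    unfolding s_def using locally_smooth_family_sum[OF lf smooth] .
  have s_ge: "\<phi> x \<le> s i x" if "\<phi> \<in> \<Phi> i" "x \<in> V" for i \<phi> x
    unfolding s_def using locally_finite_family_pointwise[OF lf that(2)] nonneg that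
    by (cases "\<phi> x = 0") (auto intro!: member_le_sum[of \<phi> _ "\<lambda>h. h x"] sum_nonneg)
  have g_smooth: "locally_smooth (g i)" for i
    unfolding g_def
    by (intro locally_smooth_prod locally_smooth_diff locally_smooth_const locally_smooth_step
        locally_smooth_affine s_smooth)
  have g_nonneg: "0 \<le> g i x" for i x
    unfolding g_def using smooth_step_le_1 by (intro prod_nonneg) auto
  show ?thesis
  proof (rule smooth_pou_of_locally_finite_family[of H])
    show "locally_finite_family H"
      unfolding locally_finite_family_def
    proof
      fix x assume x: "x \<in> V"
      then obtain i0 \<phi>0 where \<phi>0: "\<phi>0 \<in> \<Phi> i0" "\<phi>0 x \<noteq> 0" using pos by blast
      define c where "c = \<phi>0 x / 2"
      have c: "c > 0" using \<phi>0 nonneg[OF \<phi>0(1) x] by (simp add: c_def)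
      obtain r0 where r0: "r0 > 0" "\<And>y. y \<in> nball x r0 \<Longrightarrow> \<bar>\<phi>0 y - \<phi>0 x\<bar> < c"
        using locally_smooth_continuous[OF smooth[OF \<phi>0(1)] x c] by blast
      obtain k where k: "real k > 1 / c" using reals_Archimedean2 by blast
      \<comment> \<open>The bound \<open>k\<close> makes \<open>i * c\<close> at least 1, so the
        step has the value 1; \<open>Suc i0\<close> ensures that \<open>i0\<close> is among the
        factors of \<open>g i\<close>.\<close>
      define I where "I = max k (Suc i0)"
      have zero: "g i y = 0" if "i \<ge> I" "y \<in> nball x r0" for i y
      proof -
        have y: "y \<in> V" using that nball_subset by auto
        have "c \<le> \<phi>0 y" using r0(2)[OF that(2)] by (simp add: c_def abs_if split: if_splits)
        also have "\<dots> \<le> s i0 y" using s_ge[OF \<phi>0(1) y] .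
        finally have "1 / c * c \<le> real i * s i0 y"
          using k that(1) c by (intro mult_mono) (auto simp: I_def)
        then have "smooth_step (0 + real i * s i0 y) = 1" using c by (simp add: smooth_step_eq_1_iff)
        moreover have "i0 < i" using that(1) by (simp add: I_def)
        ultimately show ?thesis unfolding g_def by (intro prod_zero) (auto intro: bexI[of _ i0])
      qed
      have "\<forall>i. \<exists>r>0. finite {h \<in> \<Phi> i. \<exists>y\<in>nball x r. h y \<noteq> 0}"
        using lf x by (auto simp: locally_finite_family_def)
      from choice[OF this] obtain r
        where r: "\<And>i. r i > 0" "\<And>i. finite {h \<in> \<Phi> i. \<exists>y\<in>nball x (r i). h y \<noteq> 0}" by blast
      define R where "R = Min (insert r0 (r ` {..<I}))"
      have "R > 0" unfolding R_def using r0(1) r(1) by (subst Min_gr_iff) auto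
      moreover have "R \<le> r0" unfolding R_def by (rule Min_le) auto
      moreover have "R \<le> r i" if "i < I" for i unfolding R_def using that by (intro Min_le) auto
      ultimately have R: "R > 0" "R \<le> r0" "\<And>i. i < I \<Longrightarrow> R \<le> r i" by auto
      have "{h \<in> H. \<exists>y\<in>nball x R. h y \<noteq> 0} \<subseteq> (\<Union>i<I. m i ` {h \<in> \<Phi> i. \<exists>y\<in>nball x (r i). h y \<noteq> 0})"
      proof
        fix h assume "h \<in> {h \<in> H. \<exists>y\<in>nball x R. h y \<noteq> 0}"
        then obtain i \<phi> y where *: "h = m i \<phi>" "\<phi> \<in> \<Phi> i" "y \<in> nball x R" "m i \<phi> y \<noteq> 0" by (auto simp: H_def)
        then have "\<phi> y \<noteq> 0" "g i y \<noteq> 0" by (auto simp: m_def split: if_splits)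
        then have "i < I" using zero[of i y] *(3) nball_mono[OF R(2)] by force
        moreover have "y \<in> nball x (r i)" using *(3) nball_mono[OF R(3)[OF \<open>i < I\<close>]] by blast
        ultimately show "h \<in> (\<Union>i<I. m i ` {h \<in> \<Phi> i. \<exists>y\<in>nball x (r i). h y \<noteq> 0})"
          using * \<open>\<phi> y \<noteq> 0\<close> by blast
      qed
      moreover have "finite (\<Union>i<I. m i ` {h \<in> \<Phi> i. \<exists>y\<in>nball x (r i). h y \<noteq> 0})" using r(2) by auto
      ultimately show "\<exists>r>0. finite {h \<in> H. \<exists>y\<in>nball x r. h y \<noteq> 0}" using R(1) finite_subset by blast
    qed
  next
    fix h assume "h \<in> H"
    then obtain i \<phi> where h: "h = m i \<phi>" "\<phi> \<in> \<Phi> i" by (auto simp: H_def)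
    have "locally_smooth (\<lambda>x. \<phi> x * g i x)" by (intro locally_smooth_mult smooth[OF h(2)] g_smooth)
    then show "locally_smooth h"
      by (intro locally_smooth_local exI[of _ 1] exI[of _ "\<lambda>x. \<phi> x * g i x"]) (auto simp: h m_def nball_def)
    show "0 \<le> h x" if "x \<in> V" for x using that nonneg[OF h(2)] g_nonneg by (simp add: h m_def)
    show "h x = 0" if "x \<notin> V" for x using that by (simp add: h m_def)
    have "{x\<in>V. h x \<noteq> 0} \<subseteq> {x\<in>V. \<phi> x \<noteq> 0}" by (auto simp: h m_def)
    then show "\<exists>U\<in>\<U>. nclosure V N {x \<in> V. h x \<noteq> 0} \<subseteq> U"
      using sub[OF h(2)] nclosure_mono by blast
  next
    fix x assume x: "x \<in> V"
    define i where "i = (LEAST i. \<exists>\<phi>\<in>\<Phi> i. \<phi> x \<noteq> 0)"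
    obtain \<phi> where \<phi>: "\<phi> \<in> \<Phi> i" "\<phi> x \<noteq> 0" unfolding i_def using LeastI_ex[OF pos[OF x]] by blast
    have "s j x = 0" if "j < i" for j
      using not_less_Least[of j "\<lambda>i. \<exists>\<phi>\<in>\<Phi> i. \<phi> x \<noteq> 0"] that unfolding i_def s_def
      by (intro sum.neutral) auto
    then have "g i x = 1" unfolding g_def by (intro prod.neutral) (auto simp: smooth_step_eq_0_iff)
    then have "m i \<phi> x \<noteq> 0" using \<phi> x by (simp add: m_def)
    moreover have "m i \<phi> \<in> H" using \<phi> by (auto simp: H_def)
    ultimately show "\<exists>h\<in>H. h x \<noteq> 0" by blast
  qed
qed

lemma smooth_pou_of_sigma_locally_finite_base:
  fixes \<Psi> :: "nat \<Rightarrow> (('a \<Rightarrow> real) \<Rightarrow> real) set"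
  assumes lf: "\<And>i. locally_finite_family (\<Psi> i)"
    and smooth: "\<And>i \<phi>. \<phi> \<in> \<Psi> i \<Longrightarrow> locally_smooth \<phi>"
    and nonneg: "\<And>i \<phi> x. \<phi> \<in> \<Psi> i \<Longrightarrow> x \<in> V \<Longrightarrow> 0 \<le> \<phi> x"
    and base: "\<And>x \<epsilon>. x \<in> V \<Longrightarrow> \<epsilon> > 0 \<Longrightarrow>
      \<exists>i. \<exists>\<phi>\<in>\<Psi> i. \<phi> x \<noteq> 0 \<and> (\<forall>y\<in>V. \<phi> y \<noteq> 0 \<longrightarrow> N (\<lambda>t. y t - x t) < \<epsilon>)"
    and cover: "open_cover V N \<U>"
  shows "\<exists>\<Phi>. smooth_lf_pou_subordinate V N \<U> \<Phi>"
proof -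
  \<comment> \<open>Discarding the functions whose closed support fits into no member of the cover
    keeps local finiteness. Enough remain: a support within \<open>r / 2\<close> of \<open>x\<close>
    has its closure within \<open>r\<close>.\<close>
  define \<Phi> where "\<Phi> i = {\<phi> \<in> \<Psi> i. \<exists>U\<in>\<U>. nclosure V N {x\<in>V. \<phi> x \<noteq> 0} \<subseteq> U}" for i
  show ?thesis
  proof (rule smooth_pou_of_sigma_locally_finite[of \<Phi>])
    show "locally_finite_family (\<Phi> i)" for i
      unfolding locally_finite_family_def
    proof
      fix x assume "x \<in> V"
      then obtain r where "r > 0" "finite {h \<in> \<Psi> i. \<exists>y\<in>nball x r. h y \<noteq> 0}"
        using lf[of i] by (auto simp: locally_finite_family_def)
      then show "\<exists>r>0. finite {h \<in> \<Phi> i. \<exists>y\<in>nball x r. h y \<noteq> 0}"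
        by (intro exI[of _ r] conjI) (auto simp: \<Phi>_def elim: rev_finite_subset)
    qed
    fix x assume x: "x \<in> V"
    then obtain U where U: "U \<in> \<U>" "x \<in> U" using cover by (auto simp: open_cover_def)
    then obtain r where "r > 0" and r: "\<And>y. y \<in> V \<Longrightarrow> N (\<lambda>t. y t - x t) < r \<Longrightarrow> y \<in> U"
      using cover unfolding open_cover_def nopen_def by meson
    then obtain i \<phi> where \<phi>: "\<phi> \<in> \<Psi> i" "\<phi> x \<noteq> 0" "\<And>y. y \<in> V \<Longrightarrow> \<phi> y \<noteq> 0 \<Longrightarrow> N (\<lambda>t. y t - x t) < r / 2"
      using base[OF x, of "r / 2"] by (metis half_gt_zero)
    have "nclosure V N {x\<in>V. \<phi> x \<noteq> 0} \<subseteq> U"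
    proof
      fix z assume "z \<in> nclosure V N {x\<in>V. \<phi> x \<noteq> 0}"
      then obtain y where z: "z \<in> V" and y: "y \<in> V" "\<phi> y \<noteq> 0" "N (\<lambda>t. y t - z t) < r / 2"
        using \<open>r > 0\<close> unfolding nclosure_def by (auto dest!: spec[of _ "r / 2"])
      have "N (\<lambda>t. z t - x t) \<le> N (\<lambda>t. z t - y t) + N (\<lambda>t. y t - x t)"
        using norm_diff_triangle[OF z y(1) x] .
      then show "z \<in> U" using y \<phi>(3)[OF y(1,2)] norm_diff_commute[OF z y(1)] by (intro r z) simp
    qed
    then show "\<exists>i. \<exists>\<phi>\<in>\<Phi> i. \<phi> x \<noteq> 0" using \<phi> U by (auto simp: \<Phi>_def)
  qed (use smooth nonneg in \<open>auto simp: \<Phi>_def\<close>)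
qed

end

section \<open>Trees\<close>

locale tree =
  fixes T :: "'a set" and le :: "'a \<Rightarrow> 'a \<Rightarrow> bool"
  assumes is_tree: "is_tree T le"
begin

abbreviation "down \<equiv> tree_downset T le"
abbreviation "below \<equiv> tree_below T le"
abbreviation "X \<equiv> tree_topology T le"

lemma mem_down: "s \<in> down t \<longleftrightarrow> s \<in> T \<and> le s t"
  by (auto simp: tree_downset_def)

lemma mem_below: "s \<in> below t \<longleftrightarrow> s \<in> T \<and> le s t \<and> s \<noteq> t"
  by (auto simp: tree_below_def)

lemmas tree_conds = is_tree[unfolded is_tree_def]

lemma le_refl: "x \<in> T \<Longrightarrow> le x x"
  using tree_conds[THEN conjunct1] by blast

lemma le_antisym: "x \<in> T \<Longrightarrow> y \<in> T \<Longrightarrow> le x y \<Longrightarrow> le y x \<Longrightarrow> x = y"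
  using tree_conds[THEN conjunct2, THEN conjunct1] by blast

lemma le_trans: "x \<in> T \<Longrightarrow> y \<in> T \<Longrightarrow> z \<in> T \<Longrightarrow> le x y \<Longrightarrow> le y z \<Longrightarrow> le x z"
  using tree_conds[THEN conjunct2, THEN conjunct2, THEN conjunct1] by blast

lemma down_linear: "t \<in> T \<Longrightarrow> x \<in> down t \<Longrightarrow> y \<in> down t \<Longrightarrow> le x y \<or> le y x"
  using tree_conds[THEN conjunct2, THEN conjunct2, THEN conjunct2, THEN conjunct1,
      THEN bspec, THEN conjunct1, of t] by blast

lemma down_least:
  assumes "t \<in> T" "B \<subseteq> down t" "B \<noteq> {}"
  shows "\<exists>m\<in>B. \<forall>b\<in>B. le m b"
  using tree_conds[THEN conjunct2, THEN conjunct2, THEN conjunct2, THEN conjunct1,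
      THEN bspec, THEN conjunct2, THEN spec, OF assms(1), of B] assms(2,3) by simp

lemma hausdorff:
  assumes "t \<in> T" "t' \<in> T" "tree_limit_node T le t" "below t = below t'"
  shows "t = t'"
  using tree_conds[THEN conjunct2, THEN conjunct2, THEN conjunct2, THEN conjunct2,
      THEN bspec, THEN bspec, OF assms(1,2)] assms(3,4) by simp

lemma below_down_trans: "u \<in> T \<Longrightarrow> v \<in> below w \<Longrightarrow> w \<in> down u \<Longrightarrow> v \<in> below u"
  unfolding mem_below mem_down by (metis le_antisym le_trans)

lemma down_below_trans: "u \<in> T \<Longrightarrow> v \<in> down w \<Longrightarrow> w \<in> below u \<Longrightarrow> v \<in> below u"
  unfolding mem_below mem_down by (metis le_antisym le_trans)

lemma below_imp_down: "v \<in> below u \<Longrightarrow> v \<in> down u"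
  by (simp add: mem_below mem_down)

lemma down_trans: "u \<in> T \<Longrightarrow> v \<in> down w \<Longrightarrow> w \<in> down u \<Longrightarrow> v \<in> down u"
  unfolding mem_down by (metis le_trans)

lemma not_le_below: "t \<in> T \<Longrightarrow> x \<in> down t \<Longrightarrow> y \<in> down t \<Longrightarrow> \<not> le x y \<Longrightarrow> y \<in> below x"
  using down_linear[of t x y] le_refl by (auto simp: mem_below mem_down)

lemma below_irrefl: "x \<in> T \<Longrightarrow> x \<in> below y \<Longrightarrow> y \<in> T \<Longrightarrow> \<not> le y x"
  using le_antisym by (auto simp: mem_below)

lemma tree_induct [consumes 1, case_names less]:
  assumes "t \<in> T" and step: "\<And>u. u \<in> T \<Longrightarrow> (\<And>v. v \<in> below u \<Longrightarrow> P v) \<Longrightarrow> P u"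
  shows "P t"
proof (rule ccontr)
  assume "\<not> P t"
  then have "{u \<in> down t. \<not> P u} \<noteq> {}" using assms(1) le_refl by (auto simp: mem_down)
  then obtain m where m: "m \<in> {u \<in> down t. \<not> P u}" "\<And>b. b \<in> {u \<in> down t. \<not> P u} \<Longrightarrow> le m b"
    using down_least[OF assms(1), of "{u \<in> down t. \<not> P u}"] by blast
  have mT: "m \<in> T" using m(1) by (simp add: mem_down)
  have "P v" if v: "v \<in> below m" for v
  proof (rule ccontr)
    assume "\<not> P v"
    moreover have "v \<in> down t" using below_down_trans[OF assms(1) v] m(1) below_imp_down by blast
    ultimately have "le m v" using m(2) by blast
    then show False using below_irrefl[OF _ v mT] v by (simp add: mem_below)
  qed
  then show False using step[OF mT] m(1) by blast
qed

section \<open>Immediate successors along a branch\<close>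

definition next_node :: "'a \<Rightarrow> 'a \<Rightarrow> 'a" where
  "next_node s t = (SOME u. u \<in> down t \<and> s \<in> below u \<and> (\<forall>w\<in>down t. s \<in> below w \<longrightarrow> le u w))"

definition successors :: "'a \<Rightarrow> 'a set" where
  "successors t = {s \<in> T. t \<in> below s \<and> (\<forall>u\<in>below s. le u t)}"

lemma next_node:
  assumes "t \<in> T" "s \<in> below t"
  shows "next_node s t \<in> down t" "s \<in> below (next_node s t)"
    "\<And>w. w \<in> down t \<Longrightarrow> s \<in> below w \<Longrightarrow> le (next_node s t) w"
proof -
  have "t \<in> {u \<in> down t. s \<in> below u}" using assms le_refl by (auto simp: mem_down)
  then obtain m where "m \<in> {u \<in> down t. s \<in> below u}" "\<And>b. b \<in> {u \<in> down t. s \<in> below u} \<Longrightarrow> le m b"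
    using down_least[OF assms(1), of "{u \<in> down t. s \<in> below u}"] by blast
  then have "\<exists>u. u \<in> down t \<and> s \<in> below u \<and> (\<forall>w\<in>down t. s \<in> below w \<longrightarrow> le u w)" by blast
  from someI_ex[OF this] show "next_node s t \<in> down t" "s \<in> below (next_node s t)"
    "\<And>w. w \<in> down t \<Longrightarrow> s \<in> below w \<Longrightarrow> le (next_node s t) w"
    unfolding next_node_def[symmetric] by blast+
qed

lemma next_node_eqI:
  assumes "t \<in> T" "u \<in> down t" "s \<in> below u" "\<And>w. w \<in> down t \<Longrightarrow> s \<in> below w \<Longrightarrow> le u w"
  shows "next_node s t = u"
proof -
  have s: "s \<in> below t" using below_down_trans[OF assms(1,3,2)] .
  note n = next_node[OF assms(1) s]
  show ?thesis using n(3)[OF assms(2,3)] assms(4)[OF n(1,2)] n(1) assms(2)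
    by (intro le_antisym) (auto simp: mem_down)
qed

text \<open>\<open>down u\<close> is an initial segment of \<open>down t\<close>, so the first node
  after \<open>s\<close> looks the same from both ends. This transfers jumps between a branch and
  its initial segments in all later inductions.\<close>

lemma next_node_down:
  assumes "t \<in> T" "u \<in> down t" "s \<in> below u"
  shows "next_node s u = next_node s t"
proof -
  have u: "u \<in> T" using assms(2) by (simp add: mem_down)
  note n = next_node[OF u assms(3)]
  show ?thesis
  proof (rule next_node_eqI[OF assms(1), symmetric])
    show "next_node s u \<in> down t" using down_trans[OF assms(1) n(1) assms(2)] .
    show "s \<in> below (next_node s u)" by (rule n(2))
    fix w assume w: "w \<in> down t" "s \<in> below w"
    show "le (next_node s u) w"
    proof (cases "le w u")
      case True
      then show ?thesis using n(3) w by (simp add: mem_down)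
    next
      case False
      then have "u \<in> below w" using not_le_below[OF assms(1) w(1) assms(2)] by blast
      then show ?thesis using n(1) w u by (auto simp: mem_down mem_below intro: le_trans[of _ u])
    qed
  qed
qed

lemma next_node_successor:
  assumes "t \<in> T" "s \<in> below t"
  shows "next_node s t \<in> successors s"
proof -
  note n = next_node[OF assms]
  have nT: "next_node s t \<in> T" using n(1) by (simp add: mem_down)
  have "le u s" if u: "u \<in> below (next_node s t)" for u
  proof (rule ccontr)
    assume "\<not> le u s"
    moreover have ut: "u \<in> down t" using below_down_trans[OF assms(1) u n(1)] by (rule below_imp_down)
    ultimately have "s \<in> below u" using not_le_below[OF assms(1) ut below_imp_down[OF assms(2)]] by blast
    then show False using n(3)[OF ut] below_irrefl[OF _ u nT] u by (simp add: mem_below)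
  qed
  then show ?thesis using n nT by (auto simp: successors_def)
qed

lemma successor_eq_next_node:
  assumes "m \<in> T" "s \<in> successors t" "s \<in> down m"
  shows "next_node t m = s"
proof (rule next_node_eqI[OF assms(1,3)])
  show "t \<in> below s" using assms(2) by (simp add: successors_def)
  fix w assume w: "w \<in> down m" "t \<in> below w"
  show "le s w"
  proof (rule ccontr)
    assume "\<not> le s w"
    then have "w \<in> below s" using not_le_below[OF assms(1,3) w(1)] by blast
    then have "le w t" using assms(2) by (simp add: successors_def)
    then show False using below_irrefl[OF _ w(2)] w by (auto simp: mem_down mem_below)
  qed
qed

section \<open>The topology of the tree\<close>

lemma topspace_tree: "topspace X = T"
  unfolding tree_topology_def topology_generated_by_topspace by (auto simp: tree_downset_def)

lemma openin_down: "t \<in> T \<Longrightarrow> openin X (down t)"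
  unfolding tree_topology_def by (intro topology_generated_by_Basis) auto

lemma openin_not_down: "t \<in> T \<Longrightarrow> openin X (T - down t)"
  unfolding tree_topology_def by (intro topology_generated_by_Basis) auto

text \<open>Here the Hausdorff condition enters. If every node below a limit node \<open>t\<close>
  were below \<open>s\<close>, the first node of the branch to \<open>s\<close> outside
  \<open>below t\<close> would have the same predecessors as \<open>t\<close>, hence be
  \<open>t\<close>, contradicting that \<open>t\<close> is not below \<open>s\<close>. At a
  non-limit node the interval after the immediate predecessor is just \<open>t\<close>.\<close>

lemma not_down_neighbourhood:
  assumes t: "t \<in> T" and s: "s \<in> T" and nle: "\<not> le t s" and ne: "below t \<noteq> {}"
  shows "\<exists>v\<in>below t. \<forall>u\<in>down t. v \<in> below u \<longrightarrow> \<not> le u s"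
proof (cases "tree_limit_node T le t")
  case False
  then obtain m where m: "m \<in> below t" "\<And>s. s \<in> below t \<Longrightarrow> le s m"
    using ne unfolding tree_limit_node_def by blast
  have "u = t" if "u \<in> down t" "m \<in> below u" for u
  proof (rule ccontr)
    assume "u \<noteq> t"
    then have "le u m" using m(2) that by (simp add: mem_down mem_below)
    then show False using below_irrefl[OF _ that(2)] that m(1) by (auto simp: mem_down mem_below)
  qed
  then show ?thesis using m(1) nle by (intro bexI[of _ m]) auto
next
  case True
  have "\<exists>v\<in>below t. \<not> le v s"
  proof (rule ccontr)
    assume "\<not> (\<exists>v\<in>below t. \<not> le v s)"
    then have all: "\<And>v. v \<in> below t \<Longrightarrow> le v s" by blast
    \<comment> \<open>Otherwise \<open>s\<close> would be the largest element of
      \<open>below t\<close>, which a limit node excludes.\<close>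
    have "s \<notin> below t" using True all unfolding tree_limit_node_def by blast
    then have "{u \<in> down s. u \<notin> below t} \<noteq> {}" using s le_refl by (auto simp: mem_down)
    then obtain w where w: "w \<in> down s" "w \<notin> below t" "\<And>u. u \<in> down s \<Longrightarrow> u \<notin> below t \<Longrightarrow> le w u"
      using down_least[OF s, of "{u \<in> down s. u \<notin> below t}"] by blast
    have wT: "w \<in> T" using w(1) by (simp add: mem_down)
    have "below t = below w"
    proof (intro equalityI subsetI)
      fix u assume u: "u \<in> below t"
      then have us: "u \<in> down s" using all by (simp add: mem_down mem_below)
      have "\<not> le w u"
        using u w(2) wT t down_below_trans[of t w u] by (auto simp: mem_down)
      then show "u \<in> below w" using not_le_below[OF s w(1) us] by blast
    next
      fix u assume u: "u \<in> below w"
      then have us: "u \<in> down s" using below_down_trans[OF s u w(1)] below_imp_down by blast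
      show "u \<in> below t"
      proof (rule ccontr)
        assume "u \<notin> below t"
        then have "le w u" using w(3) us by blast
        then show False using below_irrefl[OF _ u wT] u by (simp add: mem_below)
      qed
    qed
    then have "t = w" using hausdorff[OF t wT True] by blast
    then show False using w(1) nle by (simp add: mem_down)
  qed
  then obtain v where v: "v \<in> below t" "\<not> le v s" by blast
  have "\<not> le u s" if "u \<in> down t" "v \<in> below u" for u
  proof
    assume "le u s"
    then have "le v s" using that s le_trans[of v u s] by (auto simp: mem_down mem_below)
    then show False using v(2) by blast
  qed
  then show ?thesis using v(1) by blast
qed

text \<open>Each subbasic set containing \<open>t\<close> contains an interval
  \<open>(v, t]\<close>, and of two such intervals the one with the later \<open>v\<close> lies in
  both. So convergence to \<open>t\<close> is convergence from below along its branch, as for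
  ordinals.\<close>

lemma open_neighbourhood:
  assumes "openin X U" "t \<in> U" "below t \<noteq> {}"
  shows "\<exists>v\<in>below t. \<forall>u\<in>down t. v \<in> below u \<longrightarrow> u \<in> U"
proof -
  have tT: "t \<in> T" using openin_subset[OF assms(1)] assms(2) by (auto simp: topspace_tree)
  have "generate_topology_on (insert T (down ` T \<union> (\<lambda>t. T - down t) ` T)) U"
    using assms(1) unfolding tree_topology_def openin_topology_generated_by_iff .
  then show ?thesis
    using assms(2)
  proof (induction rule: generate_topology_on.induct)
    case (Int A B)
    then obtain v w where v: "v \<in> below t" "\<forall>u\<in>down t. v \<in> below u \<longrightarrow> u \<in> A"
      and w: "w \<in> below t" "\<forall>u\<in>down t. w \<in> below u \<longrightarrow> u \<in> B" by auto
    show ?case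
    proof (cases "le v w")
      case True
      have "v \<in> below u" if "u \<in> down t" "w \<in> below u" for u
        using that True v(1) down_below_trans[of u v w] by (auto simp: mem_down mem_below)
      then show ?thesis using v w by blast
    next
      case False
      then have wv: "w \<in> below v" using not_le_below[OF tT] v(1) w(1) below_imp_down by blast
      have "w \<in> below u" if "u \<in> down t" "v \<in> below u" for u
        using below_down_trans[OF _ wv below_imp_down[OF that(2)]] that by (auto simp: mem_down)
      then show ?thesis using v w by blast
    qed
  next
    case (UN K)
    then obtain k where "k \<in> K" "t \<in> k" by blast
    then show ?case using UN by (meson UnionI)
  next
    case (Basis B)
    obtain v where v: "v \<in> below t" using assms(3) by blast
    consider "B = T" | s where "s \<in> T" "B = down s" | s where "s \<in> T" "B = T - down s"
      using Basis by auto
    then show ?case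
    proof cases
      case 1
      then show ?thesis using v by (auto simp: mem_down)
    next
      case 2
      then have "down t \<subseteq> B" using Basis(2) down_trans by blast
      then show ?thesis using v by blast
    next
      case 3
      then have "\<not> le t s" using Basis(2) by (auto simp: mem_down)
      then show ?thesis using not_down_neighbourhood[OF tT 3(1) _ assms(3)] 3 by (auto simp: mem_down)
    qed
  qed simp
qed

text \<open>As for closed ordinal intervals: one member of the cover takes care of some
  \<open>(v, t]\<close>, and the rest is \<open>down v\<close>, compact by induction.\<close>

lemma compactin_down: "t \<in> T \<Longrightarrow> compactin X (down t)"
proof (induction rule: tree_induct)
  case (less t)
  show ?case
    unfolding compactin_def
  proof (intro conjI allI impI)
    show "down t \<subseteq> topspace X" by (auto simp: topspace_tree mem_down)
    fix \<C> assume \<C>: "Ball \<C> (openin X) \<and> down t \<subseteq> \<Union>\<C>"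
    have "t \<in> down t" using less(1) le_refl by (simp add: mem_down)
    then obtain U where U: "U \<in> \<C>" "t \<in> U" using \<C> by blast
    show "\<exists>\<F>. finite \<F> \<and> \<F> \<subseteq> \<C> \<and> down t \<subseteq> \<Union>\<F>"
    proof (cases "below t = {}")
      case True
      then have "down t \<subseteq> \<Union>{U}" using U by (auto simp: mem_down mem_below)
      then show ?thesis using U by (intro exI[of _ "{U}"]) auto
    next
      case False
      then obtain v where v: "v \<in> below t" "\<forall>u\<in>down t. v \<in> below u \<longrightarrow> u \<in> U"
        using open_neighbourhood U \<C> by blast
      have "down v \<subseteq> down t" using down_trans[OF less(1) _ below_imp_down[OF v(1)]] by blast
      then have "down v \<subseteq> \<Union>\<C>" using \<C> by blast
      then obtain \<F> where \<F>: "finite \<F>" "\<F> \<subseteq> \<C>" "down v \<subseteq> \<Union>\<F>"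
        using less(2)[OF v(1)] \<C> unfolding compactin_def by meson
      have "u \<in> down v \<union> U" if u: "u \<in> down t" for u
      proof (cases "le u v")
        case True
        then show ?thesis using u by (simp add: mem_down)
      next
        case False
        then show ?thesis using v u not_le_below[OF less(1) u below_imp_down[OF v(1)]] by blast
      qed
      then show ?thesis using \<F> U by (intro exI[of _ "insert U \<F>"]) blast
    qed
  qed
qed

abbreviation "V \<equiv> C0 T le"

section \<open>Large values and jumps of functions in \<open>C0\<close>\<close>

lemma C0_left_continuous:
  assumes "f \<in> V" "t \<in> T" "e > 0" "below t \<noteq> {}"
  shows "\<exists>v\<in>below t. \<forall>u\<in>down t. v \<in> below u \<longrightarrow> \<bar>f u - f t\<bar> < e"
proof -
  have "continuous_map X euclideanreal f" using assms(1) by (simp add: C0_def)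
  then have "openin X {u \<in> topspace X. f u \<in> ball (f t) e}"
    by (rule openin_continuous_map_preimage) simp
  then have "\<exists>v\<in>below t. \<forall>u\<in>down t. v \<in> below u \<longrightarrow> u \<in> {u \<in> topspace X. f u \<in> ball (f t) e}"
    using assms by (intro open_neighbourhood) (auto simp: topspace_tree)
  then show ?thesis by (auto simp: dist_real_def abs_minus_commute)
qed

text \<open>The open sets \<open>down t\<close>, for \<open>t\<close> in the compact set of large
  values, cover that set, so finitely many suffice. In a selection of least cardinality every node
  is maximal, since one with a large node strictly above it would be redundant.\<close>

lemma C0_large_maximal:
  assumes "f \<in> V" "e > 0"
  obtains M where "finite M" "M \<subseteq> {t \<in> T. e \<le> \<bar>f t\<bar>}"
    "\<And>t. t \<in> T \<Longrightarrow> e \<le> \<bar>f t\<bar> \<Longrightarrow> \<exists>m\<in>M. le t m"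
    "\<And>m u. m \<in> M \<Longrightarrow> u \<in> T \<Longrightarrow> m \<in> below u \<Longrightarrow> \<bar>f u\<bar> < e"
proof -
  let ?K = "{t \<in> T. e \<le> \<bar>f t\<bar>}"
  define P where "P M \<longleftrightarrow> finite M \<and> M \<subseteq> ?K \<and> (\<forall>t\<in>?K. \<exists>m\<in>M. le t m)" for M
  have "compactin X ?K" using assms by (simp add: C0_def)
  moreover have "Ball (down ` ?K) (openin X)" using openin_down by auto
  moreover have "?K \<subseteq> \<Union>(down ` ?K)" using le_refl by (auto simp: mem_down)
  ultimately obtain \<F> where "finite \<F>" "\<F> \<subseteq> down ` ?K" "?K \<subseteq> \<Union>\<F>" unfolding compactin_def by meson
  then obtain M0 where "M0 \<subseteq> ?K" "finite M0" "\<F> = down ` M0" by (meson finite_subset_image)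
  have "\<exists>m\<in>M0. le t m" if t: "t \<in> ?K" for t
  proof -
    obtain m where "m \<in> M0" "t \<in> down m"
      using t \<open>?K \<subseteq> \<Union>\<F>\<close> unfolding \<open>\<F> = down ` M0\<close> by blast
    then show ?thesis by (auto simp: mem_down)
  qed
  then have "P M0" using \<open>M0 \<subseteq> ?K\<close> \<open>finite M0\<close> unfolding P_def by blast
  then obtain M where M: "P M" "\<And>M'. P M' \<Longrightarrow> card M \<le> card M'"
    using ex_has_least_nat[of P M0 card] by blast
  show ?thesis
  proof (rule that)
    show "finite M" "M \<subseteq> ?K" using M(1) by (auto simp: P_def)
    show "\<exists>m\<in>M. le t m" if "t \<in> T" "e \<le> \<bar>f t\<bar>" for t using that M(1) by (auto simp: P_def)
    fix m u assume m: "m \<in> M" and u: "u \<in> T" "m \<in> below u"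
    show "\<bar>f u\<bar> < e"
    proof (rule ccontr)
      assume "\<not> \<bar>f u\<bar> < e"
      then obtain m' where m': "m' \<in> M" "le u m'" using u M(1) unfolding P_def by force
      have T: "m \<in> T" "m' \<in> T" using M(1) m m' by (auto simp: P_def)
      have "m' \<noteq> m" using below_irrefl[OF _ u(2) u(1)] T m' by blast
      have "le m m'" using u m' T le_trans[of m u m'] by (auto simp: mem_below)
      have "\<exists>m\<in>M - {m}. le t m" if t: "t \<in> ?K" for t
      proof -
        obtain n where "n \<in> M" "le t n" using t M(1) by (auto simp: P_def)
        then show ?thesis using \<open>m' \<noteq> m\<close> \<open>le m m'\<close> m' T t le_trans[of t m m'] by (cases "n = m") auto
      qed
      then have "P (M - {m})" using M(1) by (auto simp: P_def)
      then have "card M \<le> card (M - {m})" by (rule M(2))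
      moreover have "card (M - {m}) < card M"
        using M(1) m unfolding P_def by (intro card_Diff1_less) blast+
      ultimately show False by simp
    qed
  qed
qed

text \<open>A large successor of \<open>t\<close> lies below one of the finitely many maximal nodes
  \<open>m\<close>, and is then the unique node \<open>next_node t m\<close>.\<close>

lemma finite_large_successors:
  assumes "f \<in> V" "e > 0"
  shows "finite {s \<in> successors t. e \<le> \<bar>f s\<bar>}"
proof -
  obtain M where M: "finite M" "M \<subseteq> {t \<in> T. e \<le> \<bar>f t\<bar>}" "\<And>t. t \<in> T \<Longrightarrow> e \<le> \<bar>f t\<bar> \<Longrightarrow> \<exists>m\<in>M. le t m"
    using C0_large_maximal[OF assms] by metis
  have "{s \<in> successors t. e \<le> \<bar>f s\<bar>} \<subseteq> next_node t ` M"
  proof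
    fix s assume s: "s \<in> {s \<in> successors t. e \<le> \<bar>f s\<bar>}"
    then have "s \<in> T" by (simp add: successors_def)
    then obtain m where "m \<in> M" "le s m" using M(3) s by blast
    then show "s \<in> next_node t ` M"
      using successor_eq_next_node[of m s t] M(2) s \<open>s \<in> T\<close> by (force simp: mem_down)
  qed
  then show ?thesis using M(1) finite_surj by blast
qed

text \<open>By left continuity at \<open>t\<close>, all values after some \<open>v\<close> are
  within \<open>d / 2\<close> of \<open>f t\<close>, so no jump of size \<open>d\<close> starts
  after \<open>v\<close>. The jumps before \<open>v\<close> are finite in number by
  induction.\<close>

lemma finite_jumps:
  assumes "f \<in> V" "d > 0" "t \<in> T"
  shows "finite {s \<in> below t. d \<le> \<bar>f (next_node s t) - f s\<bar>}"
  using assms(3)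
proof (induction rule: tree_induct)
  case (less t)
  show ?case
  proof (cases "below t = {}")
    case False
    have "d / 2 > 0" using assms(2) by simp
    then obtain v where v: "v \<in> below t" "\<And>u. u \<in> down t \<Longrightarrow> v \<in> below u \<Longrightarrow> \<bar>f u - f t\<bar> < d / 2"
      using C0_left_continuous[OF assms(1) less(1) _ False] by blast
    \<comment> \<open>A jump may start at \<open>v\<close> itself, as only the values strictly after
      \<open>v\<close> are controlled.\<close>
    have "{s \<in> below t. d \<le> \<bar>f (next_node s t) - f s\<bar>} \<subseteq>
      insert v {s \<in> below v. d \<le> \<bar>f (next_node s v) - f s\<bar>}"
    proof
      fix s assume "s \<in> {s \<in> below t. d \<le> \<bar>f (next_node s t) - f s\<bar>}"
      then have s: "s \<in> below t" "d \<le> \<bar>f (next_node s t) - f s\<bar>" by auto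
      note n = next_node[OF less(1) s(1)]
      show "s \<in> insert v {s \<in> below v. d \<le> \<bar>f (next_node s v) - f s\<bar>}"
      proof (cases "le s v")
        case True
        then have "s = v \<or> s \<in> below v" using s by (auto simp: mem_below)
        then show ?thesis using s next_node_down[OF less(1) below_imp_down[OF v(1)]] by auto
      next
        case False
        then have vs: "v \<in> below s" using not_le_below[OF less(1)] s(1) v(1) below_imp_down by blast
        have "v \<in> below (next_node s t)"
          using below_down_trans[OF _ vs below_imp_down[OF n(2)]] n(1) by (simp add: mem_down)
        then show ?thesis using v(2)[OF n(1)] v(2)[OF below_imp_down[OF s(1)] vs] s(2)
          by (simp add: abs_if split: if_splits)
      qed
    qed
    then show ?thesis using less(2)[OF v(1)] finite_subset by blast
  qed simp
qed

text \<open>By induction \<open>f\<close> equals \<open>f v\<close> on the whole stretch before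
  \<open>w\<close>. If \<open>w\<close> is an immediate successor, the absence of jumps extends this
  to \<open>w\<close>; if it is a limit, left continuity does.\<close>

lemma constant_of_no_jumps:
  assumes "f \<in> V" "w \<in> T"
  shows "v \<in> down w \<Longrightarrow> (\<forall>s\<in>below w. le v s \<longrightarrow> f (next_node s w) = f s) \<Longrightarrow> f v = f w"
  using assms(2)
proof (induction arbitrary: v rule: tree_induct)
  case (less w)
  show ?case
  proof (cases "v = w")
    case False
    then have v: "v \<in> below w" using less(3) by (simp add: mem_below mem_down)
    have IH: "f v = f x" if x: "x \<in> below w" "le v x" for x
    proof (rule less(2)[OF x(1)])
      show "v \<in> down x" using x v by (simp add: mem_down mem_below)
      show "\<forall>s\<in>below x. le v s \<longrightarrow> f (next_node s x) = f s"
        using less(4) next_node_down[OF less(1) below_imp_down[OF x(1)]]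
          below_down_trans[OF less(1) _ below_imp_down[OF x(1)]] by metis
    qed
    show ?thesis
    proof (rule ccontr)
      assume "f v \<noteq> f w"
      then have "\<bar>f v - f w\<bar> > 0" by simp
      then obtain v1 where v1: "v1 \<in> below w" "\<And>u. u \<in> down w \<Longrightarrow> v1 \<in> below u \<Longrightarrow> \<bar>f u - f w\<bar> < \<bar>f v - f w\<bar>"
        using C0_left_continuous[OF assms(1) less(1)] v by blast
      have "le v v1 \<or> le v1 v" using down_linear[OF less(1)] v v1(1) below_imp_down by blast
      \<comment> \<open>\<open>p\<close> is the later of \<open>v\<close> and \<open>v1\<close>. If
        its next node came before \<open>w\<close>, the value there would be \<open>f v\<close> by
        induction, yet closer to \<open>f w\<close> than \<open>f v\<close> is.\<close>
      then obtain p where p: "p \<in> below w" "le v p" "le v1 p"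
        using v v1(1) le_refl by (metis mem_below)
      note n = next_node[OF less(1) p(1)]
      have nT: "next_node p w \<in> T" using n(1) by (simp add: mem_down)
      have "next_node p w = w"
      proof (rule ccontr)
        assume "next_node p w \<noteq> w"
        then have "next_node p w \<in> below w" using n(1) by (simp add: mem_down mem_below)
        moreover have "le v (next_node p w)"
          using n(2) p v nT le_trans[of v p "next_node p w"] by (auto simp: mem_below)
        ultimately have "f v = f (next_node p w)" by (rule IH)
        moreover have "v1 \<in> below (next_node p w)"
          using down_below_trans[OF nT _ n(2), of v1] p v1(1) by (simp add: mem_down mem_below)
        ultimately show False using v1(2)[OF n(1)] by simp
      qed
      then have "f w = f p" using less(4) p by metis
      then show False using IH[OF p(1,2)] \<open>f v \<noteq> f w\<close> by simp
    qed
  qed simp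
qed

text \<open>Finitely many nodes cut the branch into stretches on which \<open>f\<close> varies by
  less than \<open>e\<close>. They must be genuine jumps, since only a nonzero jump can be marked.
  So the node \<open>v0\<close> supplied by left continuity may not serve as a cut. If some jump
  \<open>b\<close> occurs at or after \<open>v0\<close>, the cut is made at \<open>b\<close>:
  stretches after \<open>b\<close> are controlled by \<open>v0\<close>, those up to \<open>b\<close>
  by induction.\<close>

lemma chain_separators:
  assumes "f \<in> V" "e > 0" "u \<in> T"
  shows "\<exists>B. finite B \<and> B \<subseteq> below u \<and> (\<forall>s\<in>B. f (next_node s u) \<noteq> f s) \<and>
    (\<forall>w\<in>down u. \<forall>v\<in>down w. (\<forall>s\<in>B. \<not> (le v s \<and> s \<in> below w)) \<longrightarrow> \<bar>f v - f w\<bar> < e)"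
  using assms(3)
proof (induction rule: tree_induct)
  case (less u)
  show ?case
  proof (cases "below u = {}")
    case True
    then have eq: "x = u" if "x \<in> down u" for x
      using that mem_below[of x u] by (auto simp: mem_down)
    have "v = w" if "w \<in> down u" "v \<in> down w" for v w
      using eq[OF that(1)] eq[OF down_trans[OF less(1) that(2,1)]] by simp
    then show ?thesis using assms(2) by (intro exI[of _ "{}"]) fastforce
  next
    case False
    have "e / 2 > 0" using assms(2) by simp
    then obtain v0 where v0: "v0 \<in> below u" "\<And>x. x \<in> down u \<Longrightarrow> v0 \<in> below x \<Longrightarrow> \<bar>f x - f u\<bar> < e / 2"
      using C0_left_continuous[OF assms(1) less(1) _ False] by blast
    show ?thesis
    proof (cases "\<exists>b\<in>below u. le v0 b \<and> f (next_node b u) \<noteq> f b")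
      case True
      then obtain b where b: "b \<in> below u" "le v0 b" "f (next_node b u) \<noteq> f b" by blast
      have bu: "b \<in> down u" and bT: "b \<in> T" using b(1) by (auto simp: mem_down mem_below)
      obtain B where B: "finite B" "B \<subseteq> below b" "\<forall>s\<in>B. f (next_node s b) \<noteq> f s"
        and B_sep: "\<forall>w\<in>down b. \<forall>v\<in>down w. (\<forall>s\<in>B. \<not> (le v s \<and> s \<in> below w)) \<longrightarrow> \<bar>f v - f w\<bar> < e"
        using less(2)[OF b(1)] by (elim exE conjE) (rule that)
      show ?thesis
      proof (intro exI[of _ "insert b B"] conjI ballI impI)
        show "finite (insert b B)" using B by simp
        show "insert b B \<subseteq> below u" using B(2) b(1) below_down_trans[OF less(1) _ bu] by blast
        show "f (next_node s u) \<noteq> f s" if "s \<in> insert b B" for s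
          using that b(3) B(2) B(3)[rule_format, of s] next_node_down[OF less(1) bu, of s] by (cases "s = b") auto
        fix w v assume w: "w \<in> down u" and v: "v \<in> down w"
          and sep: "\<forall>s\<in>insert b B. \<not> (le v s \<and> s \<in> below w)"
        have wT: "w \<in> T" using w by (simp add: mem_down)
        show "\<bar>f v - f w\<bar> < e"
        proof (cases "le w b")
          case True
          then show ?thesis using B_sep[rule_format, of w v] w v sep by (simp add: mem_down)
        next
          case False
          then have bw: "b \<in> below w" using not_le_below[OF less(1) w bu] by blast
          then have "\<not> le v b" using sep by blast
          then have bv: "b \<in> below v" using not_le_below[OF wT v below_imp_down[OF bw]] by blast
          have *: "v0 \<in> below x" if "b \<in> below x" "x \<in> T" for x
            using down_below_trans[OF that(2) _ that(1), of v0] b(2) v0(1) by (simp add: mem_down mem_below)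
          have "v0 \<in> below v" "v0 \<in> below w" using * bw bv v wT by (auto simp: mem_down)
          then show ?thesis using v0(2)[OF w] v0(2)[OF down_trans[OF less(1) v w]]
            by (simp add: abs_if split: if_splits)
        qed
      qed
    next
      \<comment> \<open>Without a jump from \<open>v0\<close> on, \<open>f\<close> is constant
        there, and the separators for \<open>v0\<close> also serve \<open>u\<close>.\<close>
      case no_jump: False
      obtain B where B: "finite B" "B \<subseteq> below v0" "\<forall>s\<in>B. f (next_node s v0) \<noteq> f s"
        and B_sep: "\<forall>w\<in>down v0. \<forall>v\<in>down w. (\<forall>s\<in>B. \<not> (le v s \<and> s \<in> below w)) \<longrightarrow> \<bar>f v - f w\<bar> < e"
        using less(2)[OF v0(1)] by (elim exE conjE) (rule that)
      have v0u: "v0 \<in> down u" and v0T: "v0 \<in> T" using v0(1) by (auto simp: mem_down mem_below)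
      have const: "f v0 = f x" if x: "x \<in> down u" "v0 \<in> below x" for x
      proof (rule constant_of_no_jumps[OF assms(1)])
        show "x \<in> T" using x(1) by (simp add: mem_down)
        show "v0 \<in> down x" using x(2) by (rule below_imp_down)
        show "\<forall>s\<in>below x. le v0 s \<longrightarrow> f (next_node s x) = f s"
          using no_jump next_node_down[OF less(1) x(1)] below_down_trans[OF less(1) _ x(1)] by metis
      qed
      show ?thesis
      proof (intro exI[of _ B] conjI ballI impI)
        show "finite B" by (rule B(1))
        show "B \<subseteq> below u" using B(2) below_down_trans[OF less(1) _ v0u] by blast
        show "f (next_node s u) \<noteq> f s" if "s \<in> B" for s
          using that B(2) B(3)[rule_format, of s] next_node_down[OF less(1) v0u, of s] by auto
        fix w v assume w: "w \<in> down u" and v: "v \<in> down w"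
          and sep: "\<forall>s\<in>B. \<not> (le v s \<and> s \<in> below w)"
        have wT: "w \<in> T" using w by (simp add: mem_down)
        have vu: "v \<in> down u" using down_trans[OF less(1) v w] .
        show "\<bar>f v - f w\<bar> < e"
        proof (cases "le w v0")
          case True
          then show ?thesis using B_sep[rule_format, of w v] w v sep by (simp add: mem_down)
        next
          case False
          then have v0w: "v0 \<in> below w" using not_le_below[OF less(1) w v0u] by blast
          have fw: "f v0 = f w" using const[OF w v0w] .
          show ?thesis
          proof (cases "le v v0")
            case True
            then have "\<bar>f v - f v0\<bar> < e"
              using sep below_down_trans[OF wT _ below_imp_down[OF v0w]] v0T vu le_refl
              by (intro B_sep[rule_format]) (auto simp: mem_down)
            then show ?thesis using fw by simp
          next
            case False
            then have "v0 \<in> below v" using not_le_below[OF less(1) vu v0u] by blast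
            then show ?thesis using const[OF vu] fw assms(2) by simp
          qed
        qed
      qed
    qed
  qed
qed

section \<open>The bump function and the partition of unity on a tree\<close>

lemma C0_continuous: "f \<in> V \<Longrightarrow> continuous_map X euclideanreal f"
  by (simp add: C0_def)

lemma C0_compact: "f \<in> V \<Longrightarrow> e > 0 \<Longrightarrow> compactin X {t \<in> T. e \<le> \<bar>f t\<bar>}"
  by (simp add: C0_def)

lemma mem_C0I:
  assumes cont: "continuous_map X euclideanreal f"
    and cover: "\<And>e. e > 0 \<Longrightarrow> \<exists>K. compactin X K \<and> {t \<in> T. e \<le> \<bar>f t\<bar>} \<subseteq> K"
    and "\<And>t. t \<notin> T \<Longrightarrow> f t = 0"
  shows "f \<in> V"
proof -
  have "compactin X {t \<in> T. e \<le> \<bar>f t\<bar>}" if e: "e > 0" for e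
  proof -
    have "closed {u::real. e \<le> \<bar>u\<bar>}" by (intro closed_Collect_le continuous_intros)
    then have "closedin X {t \<in> topspace X. f t \<in> {u. e \<le> \<bar>u\<bar>}}"
      by (intro closedin_continuous_map_preimage[OF cont]) simp
    then show ?thesis using cover[OF e] closed_compactin by (auto simp: topspace_tree)
  qed
  then show ?thesis using assms(1,3) by (simp add: C0_def)
qed

lemma C0_attains_sup:
  assumes "f \<in> V" "t \<in> T" "f t \<noteq> 0"
  shows "\<exists>m\<in>T. \<forall>s\<in>T. \<bar>f s\<bar> \<le> \<bar>f m\<bar>"
proof -
  let ?K = "{s \<in> T. \<bar>f t\<bar> \<le> \<bar>f s\<bar>}"
  have "continuous_map X euclideanreal (\<lambda>s. \<bar>f s\<bar>)"
    using C0_continuous[OF assms(1)] by (rule continuous_map_real_abs)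
  from image_compactin[OF C0_compact[OF assms(1), of "\<bar>f t\<bar>"] this] assms(3)
  have "compact ((\<lambda>s. \<bar>f s\<bar>) ` ?K)" by simp
  moreover have "(\<lambda>s. \<bar>f s\<bar>) ` ?K \<noteq> {}" using assms(2) by auto
  ultimately obtain y where y: "y \<in> (\<lambda>s. \<bar>f s\<bar>) ` ?K" "\<forall>z\<in>(\<lambda>s. \<bar>f s\<bar>) ` ?K. z \<le> y"
    using compact_attains_sup by blast
  then obtain m where m: "m \<in> ?K" "y = \<bar>f m\<bar>" by blast
  have "\<bar>f s\<bar> \<le> \<bar>f m\<bar>" if "s \<in> T" for s
    using that y(2) m by (cases "\<bar>f t\<bar> \<le> \<bar>f s\<bar>") auto
  then show ?thesis using m(1) by blast
qed

abbreviation "N \<equiv> sup_norm T"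

lemma sup_norm_le: "0 \<le> c \<Longrightarrow> (\<And>t. t \<in> T \<Longrightarrow> \<bar>f t\<bar> \<le> c) \<Longrightarrow> N f \<le> c"
  unfolding sup_norm_def by (rule cSup_least) auto

lemma C0_bdd_above:
  assumes "f \<in> V"
  shows "bdd_above (insert 0 ((\<lambda>t. \<bar>f t\<bar>) ` T))"
proof (cases "\<exists>t\<in>T. f t \<noteq> 0")
  case True
  then obtain m where "m \<in> T" "\<forall>s\<in>T. \<bar>f s\<bar> \<le> \<bar>f m\<bar>" using C0_attains_sup[OF assms] by blast
  then show ?thesis by (intro bdd_aboveI[of _ "\<bar>f m\<bar>"]) auto
next
  case False
  then show ?thesis by (intro bdd_aboveI[of _ 0]) auto
qed

lemma abs_le_sup_norm: "f \<in> V \<Longrightarrow> t \<in> T \<Longrightarrow> \<bar>f t\<bar> \<le> N f"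
  unfolding sup_norm_def using C0_bdd_above by (intro cSup_upper) auto

lemma sup_norm_nonneg: "f \<in> V \<Longrightarrow> 0 \<le> N f"
  unfolding sup_norm_def using C0_bdd_above by (intro cSup_upper) auto

lemma sup_norm_attained:
  assumes "f \<in> V" "0 < e" "e \<le> N f"
  shows "\<exists>t\<in>T. e \<le> \<bar>f t\<bar>"
proof (cases "\<exists>t\<in>T. f t \<noteq> 0")
  case True
  then obtain m where "m \<in> T" "\<forall>s\<in>T. \<bar>f s\<bar> \<le> \<bar>f m\<bar>" using C0_attains_sup[OF assms(1)] by blast
  then have "N f \<le> \<bar>f m\<bar>" by (intro sup_norm_le) auto
  then show ?thesis using \<open>m \<in> T\<close> assms(3) by force
next
  case False
  then have "N f \<le> 0" by (intro sup_norm_le) auto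
  then show ?thesis using assms by simp
qed

lemma C0_zero: "(\<lambda>t. 0) \<in> V"
  by (rule mem_C0I) (auto intro!: exI[of _ "{}"])

lemma C0_lin:
  assumes "u \<in> V" "v \<in> V"
  shows "(\<lambda>t. a * u t + b * v t) \<in> V"
proof (rule mem_C0I)
  show "continuous_map X euclideanreal (\<lambda>t. a * u t + b * v t)"
    using assms by (intro continuous_map_add continuous_map_real_mult_left C0_continuous)
  show "a * u t + b * v t = 0" if "t \<notin> T" for t
    using assms that by (simp add: C0_def)
  fix e :: real assume "e > 0"
  define d where "d = e / (\<bar>a\<bar> + \<bar>b\<bar> + 1)"
  have d: "d > 0" using \<open>e > 0\<close> by (auto simp: d_def)
  have "{t \<in> T. e \<le> \<bar>a * u t + b * v t\<bar>} \<subseteq> {t \<in> T. d \<le> \<bar>u t\<bar>} \<union> {t \<in> T. d \<le> \<bar>v t\<bar>}"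
  proof
    fix t assume t: "t \<in> {t \<in> T. e \<le> \<bar>a * u t + b * v t\<bar>}"
    show "t \<in> {t \<in> T. d \<le> \<bar>u t\<bar>} \<union> {t \<in> T. d \<le> \<bar>v t\<bar>}"
    proof (rule ccontr)
      assume "t \<notin> {t \<in> T. d \<le> \<bar>u t\<bar>} \<union> {t \<in> T. d \<le> \<bar>v t\<bar>}"
      then have *: "\<bar>u t\<bar> \<le> d" "\<bar>v t\<bar> \<le> d" using t by auto
      have "\<bar>a * u t + b * v t\<bar> \<le> \<bar>a\<bar> * \<bar>u t\<bar> + \<bar>b\<bar> * \<bar>v t\<bar>"
        using abs_triangle_ineq[of "a * u t" "b * v t"] by (simp add: abs_mult)
      also have "\<dots> \<le> \<bar>a\<bar> * d + \<bar>b\<bar> * d" using * by (intro add_mono mult_left_mono) auto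
      also have "\<dots> < (\<bar>a\<bar> + \<bar>b\<bar> + 1) * d" using d by (simp add: algebra_simps)
      also have "\<dots> = e" by (simp add: d_def)
      finally show False using t by simp
    qed
  qed
  then show "\<exists>K. compactin X K \<and> {t \<in> T. e \<le> \<bar>a * u t + b * v t\<bar>} \<subseteq> K"
    using compactin_Un[OF C0_compact[OF assms(1) d] C0_compact[OF assms(2) d]] by blast
qed

lemma sup_norm_scale_le:
  assumes "u \<in> V"
  shows "N (\<lambda>t. a * u t) \<le> \<bar>a\<bar> * N u"
  using sup_norm_nonneg[OF assms] abs_le_sup_norm[OF assms]
  by (intro sup_norm_le) (auto simp: abs_mult intro: mult_left_mono)

sublocale function_norm V N
proof
  show "(\<lambda>t. 0) \<in> V" by (rule C0_zero)
  show "(\<lambda>t. a * u t + b * v t) \<in> V" if "u \<in> V" "v \<in> V" for a b u v using that by (rule C0_lin)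
  show "0 \<le> N u" if "u \<in> V" for u using that by (rule sup_norm_nonneg)
  show "N (\<lambda>t. u t + v t) \<le> N u + N v" if "u \<in> V" "v \<in> V" for u v
  proof (rule sup_norm_le)
    fix t assume "t \<in> T"
    then show "\<bar>u t + v t\<bar> \<le> N u + N v"
      using abs_le_sup_norm[OF that(1), of t] abs_le_sup_norm[OF that(2), of t] by linarith
  qed (use that sup_norm_nonneg in auto)
  fix a u assume u: "u \<in> V"
  show "N (\<lambda>t. a * u t) = \<bar>a\<bar> * N u"
  proof (cases "a = 0")
    case True
    have "N (\<lambda>t. 0) = 0" using sup_norm_le[of 0 "\<lambda>t. 0"] sup_norm_nonneg[OF C0_zero] by simp
    with True show ?thesis by simp
  next
    case False
    have "(\<lambda>t. a * u t) \<in> V" using C0_lin[OF u u, of a 0] by simp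
    from sup_norm_scale_le[OF this, of "inverse a"]
    have "N (\<lambda>t. inverse a * (a * u t)) \<le> \<bar>inverse a\<bar> * N (\<lambda>t. a * u t)" .
    moreover have "(\<lambda>t. inverse a * (a * u t)) = u" using False by (auto simp: field_simps)
    ultimately have "N u \<le> \<bar>inverse a\<bar> * N (\<lambda>t. a * u t)" by simp
    then have "\<bar>a\<bar> * N u \<le> N (\<lambda>t. a * u t)" using False by (simp add: field_simps)
    then show ?thesis using sup_norm_scale_le[OF u, of a] by simp
  qed
qed

lemma nballD:
  assumes "y \<in> nball x r" "x \<in> V" "t \<in> T"
  shows "\<bar>y t - x t\<bar> < r"
proof -
  have "\<bar>y t - x t\<bar> \<le> N (\<lambda>t. y t - x t)"
    using assms by (intro abs_le_sup_norm[of "\<lambda>t. y t - x t"] diff_mem) (auto simp: nball_def)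
  then show ?thesis using assms(1) by (simp add: nball_def)
qed

section \<open>Detection of nodes and marking of jumps\<close>

lemma functional_eval: "t \<in> T \<Longrightarrow> functional (\<lambda>f. f t)"
  unfolding functional_def using abs_le_sup_norm by (auto intro!: exI[of _ 1])

lemma locally_smooth_eval: "t \<in> T \<Longrightarrow> locally_smooth (\<lambda>f. f t)"
  by (intro locally_smooth_functional functional_eval)

text \<open>The successors are tested on the lower third and the node on the upper third of
  \<open>[q, q + 3 d]\<close>. Restricting the product to factors other than 1 makes its index set
  finite for \<open>f\<close> in \<open>C0\<close>; over an infinite set \<open>prod\<close> would
  be 1.\<close>

definition detect :: "real \<Rightarrow> real \<Rightarrow> 'a \<Rightarrow> ('a \<Rightarrow> real) \<Rightarrow> real" where
  "detect q d t f = threshold (q + 2 * d) (q + 3 * d) (f t) *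
     (\<Prod>s\<in>{s \<in> successors t. threshold q (q + d) (f s) \<noteq> 0}. 1 - threshold q (q + d) (f s))"

lemma detect_nonneg: "0 \<le> detect q d t f"
  and detect_le_1: "detect q d t f \<le> 1"
  unfolding detect_def using threshold_nonneg threshold_le_1
  by (auto intro!: mult_nonneg_nonneg mult_le_one prod_nonneg prod_le_1)

lemma successors_subset: "successors t \<subseteq> T"
  by (auto simp: successors_def)

lemma locally_smooth_detect:
  assumes "q > 0" "d > 0" "t \<in> T"
  shows "locally_smooth (detect q d t)"
proof (rule locally_smooth_local)
  fix x assume x: "x \<in> V"
  \<comment> \<open>A change of \<open>x\<close> by less than \<open>q / 2\<close> can lift a value
    above \<open>q\<close> only where |x s| >= \<open>q / 2\<close>, so nearby the product runs over
    this fixed finite set.\<close>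
  define A where "A = {s \<in> successors t. q / 2 \<le> \<bar>x s\<bar>}"
  have A: "finite A" unfolding A_def using assms(1) by (intro finite_large_successors[OF x]) simp
  show "\<exists>r>0. \<exists>G. locally_smooth G \<and> (\<forall>y\<in>nball x r. detect q d t y = G y)"
  proof (intro exI[of _ "q / 2"] conjI exI[of _ "\<lambda>f. threshold (q + 2 * d) (q + 3 * d) (f t) *
      (\<Prod>s\<in>A. 1 - threshold q (q + d) (f s))"] ballI)
    show "q / 2 > 0" using assms(1) by simp
    show "locally_smooth (\<lambda>f. threshold (q + 2 * d) (q + 3 * d) (f t) *
      (\<Prod>s\<in>A. 1 - threshold q (q + d) (f s)))"
      using assms(3) successors_subset unfolding A_def
      by (intro locally_smooth_mult locally_smooth_prod locally_smooth_diff locally_smooth_const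
        locally_smooth_threshold locally_smooth_eval) auto
    fix y assume y: "y \<in> nball x (q / 2)"
    have "{s \<in> successors t. threshold q (q + d) (y s) \<noteq> 0} \<subseteq> A"
    proof
      fix s assume s: "s \<in> {s \<in> successors t. threshold q (q + d) (y s) \<noteq> 0}"
      then have "\<bar>y s\<bar> > q" using assms threshold_eq_0_iff[of q "q + d"] by force
      moreover have "\<bar>y s - x s\<bar> < q / 2" using nballD[OF y x, of s] s successors_subset by blast
      ultimately have "q / 2 \<le> \<bar>x s\<bar>" by linarith
      then show "s \<in> A" using s by (simp add: A_def)
    qed
    then have "(\<Prod>s\<in>{s \<in> successors t. threshold q (q + d) (y s) \<noteq> 0}. 1 - threshold q (q + d) (y s))
      = (\<Prod>s\<in>A. 1 - threshold q (q + d) (y s))"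
      using A by (intro prod.mono_neutral_left) (auto simp: A_def)
    then show "detect q d t y = threshold (q + 2 * d) (q + 3 * d) (y t) *
      (\<Prod>s\<in>A. 1 - threshold q (q + d) (y s))"
      by (simp add: detect_def)
  qed
qed

lemma detect_nonzeroD:
  assumes "detect q d t f \<noteq> 0" "q > 0" "d > 0" "f \<in> V"
  shows "q + 2 * d < \<bar>f t\<bar>" "\<And>s. s \<in> successors t \<Longrightarrow> \<bar>f s\<bar> < q + d"
proof -
  show "q + 2 * d < \<bar>f t\<bar>"
    using assms threshold_eq_0_iff[of "q + 2 * d" "q + 3 * d"] by (force simp: detect_def)
  fix s assume s: "s \<in> successors t"
  let ?S = "{s \<in> successors t. threshold q (q + d) (f s) \<noteq> 0}"
  have "?S \<subseteq> {s \<in> successors t. q \<le> \<bar>f s\<bar>}"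
    using assms threshold_eq_0_iff[of q "q + d"] by force
  then have fin: "finite ?S" using finite_large_successors[OF assms(4,2)] finite_subset by blast
  show "\<bar>f s\<bar> < q + d"
  proof (rule ccontr)
    assume "\<not> \<bar>f s\<bar> < q + d"
    then have "threshold q (q + d) (f s) = 1" using assms threshold_eq_1_iff[of q "q + d"] by simp
    then have "(\<Prod>s\<in>?S. 1 - threshold q (q + d) (f s)) = 0" using fin s by (intro prod_zero) auto
    then show False using assms(1) by (simp add: detect_def)
  qed
qed

lemma detect_eq_1:
  assumes "q > 0" "d > 0" "q + 3 * d \<le> \<bar>f t\<bar>" "\<And>s. s \<in> successors t \<Longrightarrow> \<bar>f s\<bar> \<le> q"
  shows "detect q d t f = 1"
proof -
  have "{s \<in> successors t. threshold q (q + d) (f s) \<noteq> 0} = {}"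
    using assms threshold_eq_0_iff[of q "q + d"] by auto
  moreover have "threshold (q + 2 * d) (q + 3 * d) (f t) = 1"
    using assms threshold_eq_1_iff[of "q + 2 * d" "q + 3 * d"] by simp
  ultimately show ?thesis unfolding detect_def by simp
qed

text \<open>If \<open>t\<close> is detected for some \<open>g\<close> within \<open>d / 4\<close> of
  \<open>f\<close>, then |f t| exceeds \<open>q + 7d/4\<close>, so \<open>t\<close> lies at or below
  a maximal node \<open>m\<close> of level \<open>q + d\<close>. For \<open>t\<close> other than
  \<open>m\<close>, the next node towards \<open>m\<close> has |f| below \<open>q + 5d/4\<close>, so
  \<open>f\<close> has a jump of size \<open>d / 2\<close> at \<open>t\<close>; such jumps are
  finite in number.\<close>

lemma detect_locally_finite:
  assumes "q > 0" "d > 0" "f \<in> V"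
  shows "finite {t \<in> T. \<exists>g\<in>nball f (d / 4). detect q d t g \<noteq> 0}"
proof -
  have qd: "q + d > 0" "d / 2 > 0" using assms by auto
  obtain M where M: "finite M" "M \<subseteq> {t \<in> T. q + d \<le> \<bar>f t\<bar>}"
    "\<And>t. t \<in> T \<Longrightarrow> q + d \<le> \<bar>f t\<bar> \<Longrightarrow> \<exists>m\<in>M. le t m"
    "\<And>m u. m \<in> M \<Longrightarrow> u \<in> T \<Longrightarrow> m \<in> below u \<Longrightarrow> \<bar>f u\<bar> < q + d"
    by (rule C0_large_maximal[OF assms(3) qd(1)]) auto
  have "{t \<in> T. \<exists>g\<in>nball f (d / 4). detect q d t g \<noteq> 0} \<subseteq>
    M \<union> (\<Union>m\<in>M. {s \<in> below m. d / 2 \<le> \<bar>f (next_node s m) - f s\<bar>})"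
  proof
    fix t assume "t \<in> {t \<in> T. \<exists>g\<in>nball f (d / 4). detect q d t g \<noteq> 0}"
    then obtain g where t: "t \<in> T" and g: "g \<in> nball f (d / 4)" "detect q d t g \<noteq> 0" by blast
    have gV: "g \<in> V" using g(1) nball_subset by blast
    note det = detect_nonzeroD[OF g(2) assms(1,2) gV]
    note near = nballD[OF g(1) assms(3)]
    have ft: "q + 2 * d - d / 4 < \<bar>f t\<bar>" using det(1) near[OF t] by (simp add: abs_if split: if_splits)
    then obtain m where m: "m \<in> M" "le t m" using M(3)[OF t] assms(2) by force
    show "t \<in> M \<union> (\<Union>m\<in>M. {s \<in> below m. d / 2 \<le> \<bar>f (next_node s m) - f s\<bar>})"
    proof (cases "t = m")
      case False
      then have tm: "t \<in> below m" using t m by (simp add: mem_below)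
      have mT: "m \<in> T" using m M(2) by blast
      define s where "s = next_node t m"
      have s: "s \<in> successors t" "s \<in> T"
        using next_node_successor[OF mT tm] successors_subset by (auto simp: s_def)
      have "\<bar>f s\<bar> < q + d + d / 4" using det(2)[OF s(1)] near[OF s(2)] by (simp add: abs_if split: if_splits)
      then have "d / 2 \<le> \<bar>f s - f t\<bar>" using ft by (simp add: abs_if split: if_splits)
      then show ?thesis using m(1) tm by (auto simp: s_def)
    qed (use m in simp)
  qed
  moreover have "finite (M \<union> (\<Union>m\<in>M. {s \<in> below m. d / 2 \<le> \<bar>f (next_node s m) - f s\<bar>}))"
    using M(1,2) finite_jumps[OF assms(3) qd(2)] by auto
  ultimately show ?thesis by (rule finite_subset)
qed

text \<open>A pair \<open>(s, t)\<close> with \<open>s\<close> below \<open>t\<close> marks a jump at \<open>s\<close> in the direction of the detected node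
  \<open>t\<close>. Jumps alone would not be locally finite, as \<open>s\<close> may have infinitely many successors.\<close>
definition mark :: "real \<Rightarrow> real \<Rightarrow> 'a \<times> 'a \<Rightarrow> ('a \<Rightarrow> real) \<Rightarrow> real" where
  "mark q d p f = detect q d (snd p) f *
     (if fst p = snd p then 1 else threshold d (2 * d) (f (next_node (fst p) (snd p)) - f (fst p)))"

text \<open>The diagonal pairs stand for the detected nodes themselves.\<close>

definition node_pairs :: "('a \<times> 'a) set" where
  "node_pairs = {(s, t). t \<in> T \<and> s \<in> down t}"

lemma mark_nonneg: "0 \<le> mark q d p f"
  unfolding mark_def using detect_nonneg threshold_nonneg by (auto intro!: mult_nonneg_nonneg)

lemma node_pairs_cases:
  assumes "p \<in> node_pairs"
  shows "snd p \<in> T" "fst p \<in> T" "fst p \<noteq> snd p \<Longrightarrow> fst p \<in> below (snd p)"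
    "fst p \<noteq> snd p \<Longrightarrow> next_node (fst p) (snd p) \<in> T"
proof -
  show a: "snd p \<in> T" "fst p \<in> T" "fst p \<noteq> snd p \<Longrightarrow> fst p \<in> below (snd p)"
    using assms by (auto simp: node_pairs_def mem_down mem_below)
  show "next_node (fst p) (snd p) \<in> T" if "fst p \<noteq> snd p"
    using next_node(1)[OF a(1) a(3)[OF that]] by (simp add: mem_down)
qed

lemma locally_smooth_mark:
  assumes "q > 0" "d > 0" "p \<in> node_pairs"
  shows "locally_smooth (mark q d p)"
proof -
  note p = node_pairs_cases[OF assms(3)]
  show ?thesis
  proof (cases "fst p = snd p")
    case True
    then have "mark q d p = detect q d (snd p)" by (auto simp: mark_def)
    then show ?thesis using locally_smooth_detect[OF assms(1,2) p(1)] by simp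
  next
    case False
    then have "mark q d p = (\<lambda>f. detect q d (snd p) f *
        threshold d (2 * d) (f (next_node (fst p) (snd p)) - f (fst p)))"
      by (auto simp: mark_def)
    then show ?thesis
      using locally_smooth_mult[OF locally_smooth_detect[OF assms(1,2) p(1)]
        locally_smooth_threshold[OF locally_smooth_diff[OF locally_smooth_eval[OF p(4)[OF False]]
          locally_smooth_eval[OF p(2)]]]] by simp
  qed
qed

text \<open>For each of the finitely many detectable \<open>t\<close>, a mark needs a jump of
  \<open>g\<close> above \<open>d\<close>. Both endpoint values differ by less than
  \<open>d / 4\<close> from those of \<open>f\<close>, so \<open>f\<close> itself has a jump of at
  least \<open>d / 2\<close> there.\<close>

lemma mark_locally_finite:
  assumes "q > 0" "d > 0" "f \<in> V"
  shows "finite {p \<in> node_pairs. \<exists>g\<in>nball f (d / 4). mark q d p g \<noteq> 0}"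
proof -
  define A where "A = {t \<in> T. \<exists>g\<in>nball f (d / 4). detect q d t g \<noteq> 0}"
  have A: "finite A" "A \<subseteq> T" unfolding A_def using detect_locally_finite[OF assms] by auto
  have "{p \<in> node_pairs. \<exists>g\<in>nball f (d / 4). mark q d p g \<noteq> 0} \<subseteq>
    (\<Union>t\<in>A. (\<lambda>s. (s, t)) ` insert t {s \<in> below t. d / 2 \<le> \<bar>f (next_node s t) - f s\<bar>})"
  proof
    fix p assume "p \<in> {p \<in> node_pairs. \<exists>g\<in>nball f (d / 4). mark q d p g \<noteq> 0}"
    then obtain g where p: "p \<in> node_pairs" and g: "g \<in> nball f (d / 4)" "mark q d p g \<noteq> 0" by blast
    note pc = node_pairs_cases[OF p]
    note near = nballD[OF g(1) assms(3)]
    have t: "snd p \<in> A" using g pc(1) unfolding A_def by (auto simp: mark_def)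
    have "fst p \<in> insert (snd p) {s \<in> below (snd p). d / 2 \<le> \<bar>f (next_node s (snd p)) - f s\<bar>}"
    proof (cases "fst p = snd p")
      case False
      then have "threshold d (2 * d) (g (next_node (fst p) (snd p)) - g (fst p)) \<noteq> 0"
        using g(2) by (simp add: mark_def)
      then have "d < \<bar>g (next_node (fst p) (snd p)) - g (fst p)\<bar>"
        using threshold_eq_0_iff[of d "2 * d"] assms(2) by simp
      then have "d / 2 \<le> \<bar>f (next_node (fst p) (snd p)) - f (fst p)\<bar>"
        using near[OF pc(2)] near[OF pc(4)[OF False]] by (simp add: abs_if split: if_splits)
      then show ?thesis using pc(3)[OF False] by simp
    qed simp
    then show "p \<in> (\<Union>t\<in>A. (\<lambda>s. (s, t)) ` insert t {s \<in> below t. d / 2 \<le> \<bar>f (next_node s t) - f s\<bar>})"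
      using t by (intro UN_I[of "snd p"] image_eqI[of _ _ "fst p"]) auto
  qed
  moreover have "finite (\<Union>t\<in>A. (\<lambda>s. (s, t)) ` insert t {s \<in> below t. d / 2 \<le> \<bar>f (next_node s t) - f s\<bar>})"
    using A finite_jumps[OF assms(3), of "d / 2"] assms(2) by (intro finite_UN_I finite_imageI finite.insertI) auto
  ultimately show ?thesis by (rule finite_subset)
qed

section \<open>Gaps of values and the bump function\<close>

lemma successor_gap:
  assumes "f \<in> V" "e > 0" "finite M"
    and "\<And>m u. m \<in> M \<Longrightarrow> u \<in> T \<Longrightarrow> m \<in> below u \<Longrightarrow> \<bar>f u\<bar> < e"
  obtains c where "0 < c" "c < e" "\<And>m s. m \<in> M \<Longrightarrow> s \<in> successors m \<Longrightarrow> \<bar>f s\<bar> \<le> c"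
proof -
  \<comment> \<open>Only finitely many successors reach \<open>e / 2\<close>, so the supremum over
    all successors stays strictly below \<open>e\<close>. The inserted value \<open>e / 2\<close>
    covers the remaining ones and keeps \<open>c\<close> positive.\<close>
  define Z where "Z = (\<Union>m\<in>M. {s \<in> successors m. e / 2 \<le> \<bar>f s\<bar>})"
  define c where "c = Max (insert (e / 2) ((\<lambda>s. \<bar>f s\<bar>) ` Z))"
  have fin: "finite (insert (e / 2) ((\<lambda>s. \<bar>f s\<bar>) ` Z))"
    unfolding Z_def using assms(2,3) finite_large_successors[OF assms(1), of "e / 2"] by auto
  show ?thesis
  proof (rule that)
    have "e / 2 \<le> c" unfolding c_def using fin by (intro Max_ge) auto
    then show "0 < c" using assms(2) by simp
    have "\<forall>y\<in>insert (e / 2) ((\<lambda>s. \<bar>f s\<bar>) ` Z). y < e"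
      using assms(2,4) by (auto simp: Z_def successors_def)
    then show "c < e" unfolding c_def using fin by (subst Max_less_iff) auto
    fix m s assume *: "m \<in> M" "s \<in> successors m"
    show "\<bar>f s\<bar> \<le> c"
    proof (cases "e / 2 \<le> \<bar>f s\<bar>")
      case True
      then have "s \<in> Z" using * by (auto simp: Z_def)
      then show ?thesis unfolding c_def using fin by (intro Max_ge) auto
    next
      case False
      then show ?thesis using \<open>e / 2 \<le> c\<close> by simp
    qed
  qed
qed

text \<open>The \<open>j\<close>-th gap is \<open>[1/2 - 4\<delta>, 1/2 - \<delta>]\<close> with \<open>\<delta> = 1/(j + 16)\<close>, hence contained in
  \<open>[1/4, 1/2)\<close>. In the definition of \<open>bump\<close> the case distinction is needed only because an
  infinite product is \<open>1\<close> by convention.\<close>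
definition bump_step :: "nat \<Rightarrow> real" where
  "bump_step j = 1 / (real j + 16)"

definition bump_detect :: "nat \<times> 'a \<Rightarrow> ('a \<Rightarrow> real) \<Rightarrow> real" where
  "bump_detect p = detect (1 / 2 - 4 * bump_step (fst p)) (bump_step (fst p)) (snd p)"

definition bump :: "('a \<Rightarrow> real) \<Rightarrow> real" where
  "bump f = (if 1 / 2 \<le> N f then 0 else
     (\<Prod>p\<in>{p \<in> UNIV \<times> T. bump_detect p f \<noteq> 0}. 1 - bump_detect p f))"

lemma bump_step: "0 < bump_step j" "1 / 4 \<le> 1 / 2 - 4 * bump_step j"
  by (auto simp: bump_step_def field_simps)

lemma bump_step_antimono: "i \<le> j \<Longrightarrow> bump_step j \<le> bump_step i"
  by (auto simp: bump_step_def field_simps)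

lemma bump_step_small: "e > 0 \<Longrightarrow> \<exists>j. bump_step j < e"
proof -
  assume "e > 0"
  obtain j where "1 / e < real j" using reals_Archimedean2 by blast
  then have "bump_step j < e" using \<open>e > 0\<close> by (auto simp: bump_step_def field_simps add_pos_pos)
  then show ?thesis by blast
qed

lemma bump_detect_nonzeroD:
  assumes "bump_detect p f \<noteq> 0" "f \<in> V"
  shows "1 / 2 - 2 * bump_step (fst p) < \<bar>f (snd p)\<bar>"
proof -
  have "0 < 1 / 2 - 4 * bump_step (fst p)" using bump_step(2)[of "fst p"] by linarith
  from detect_nonzeroD(1)[OF assms(1)[unfolded bump_detect_def] this bump_step(1) assms(2)]
  show ?thesis by simp
qed

lemma bump_locally_finite:
  assumes "x \<in> V" "N x < 1 / 2"
  obtains r A where "r > 0" "finite A" "A \<subseteq> UNIV \<times> T"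
    "\<And>y. y \<in> nball x r \<Longrightarrow> N y < 1 / 2"
    "\<And>y. y \<in> nball x r \<Longrightarrow> {p \<in> UNIV \<times> T. bump_detect p y \<noteq> 0} \<subseteq> A"
proof -
  define e where "e = (1 / 2 - N x) / 2"
  have e: "e > 0" using assms(2) by (simp add: e_def)
  \<comment> \<open>Near \<open>x\<close> the norm stays below \<open>1/2 - e\<close>, while a
    detection in gap \<open>j\<close> needs a value above \<open>1/2 - 2 bump_step j\<close>. Hence
    \<open>bump_step j > e / 2\<close>, which forces \<open>j < J\<close>.\<close>
  then obtain J where J: "bump_step J < e / 2" using bump_step_small[of "e / 2"] by auto
  define A where "A = (SIGMA j:{..<J}. {t \<in> T. \<exists>g\<in>nball x (bump_step j / 4). bump_detect (j, t) g \<noteq> 0})"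
  show ?thesis
  proof (rule that)
    show "min e (bump_step J / 4) > 0" using e bump_step by simp
    have "finite {t \<in> T. \<exists>g\<in>nball x (bump_step j / 4). bump_detect (j, t) g \<noteq> 0}" for j
      unfolding bump_detect_def fst_conv snd_conv
      by (rule detect_locally_finite[OF _ bump_step(1) assms(1)]) (use bump_step(2)[of j] in linarith)
    then show "finite A" by (auto simp: A_def)
    show "A \<subseteq> UNIV \<times> T" by (auto simp: A_def)
    fix y assume y: "y \<in> nball x (min e (bump_step J / 4))"
    have yV: "y \<in> V" using y nball_subset by blast
    have "N (\<lambda>t. x t + (y t - x t)) \<le> N x + N (\<lambda>t. y t - x t)"
      by (rule norm_triangle[OF assms(1) diff_mem[OF yV assms(1)]])
    then have Ny: "N y < 1 / 2 - e" using y by (simp add: nball_def e_def field_simps)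
    then show "N y < 1 / 2" using e by simp
    show "{p \<in> UNIV \<times> T. bump_detect p y \<noteq> 0} \<subseteq> A"
    proof
      fix p assume "p \<in> {p \<in> UNIV \<times> T. bump_detect p y \<noteq> 0}"
      then obtain j t where p: "p = (j, t)" "t \<in> T" "bump_detect (j, t) y \<noteq> 0" by auto
      have "1 / 2 - 2 * bump_step j < N y"
        using bump_detect_nonzeroD[OF p(3) yV] abs_le_sup_norm[OF yV p(2)] by simp
      then have "bump_step J < bump_step j" using Ny J by simp
      then have "j < J" using bump_step_antimono[of J j] by force
      then have "min e (bump_step J / 4) \<le> bump_step j / 4" using bump_step_antimono[of j J] by simp
      then have "y \<in> nball x (bump_step j / 4)" using y nball_mono by blast
      then show "p \<in> A" using p \<open>j < J\<close> by (auto simp: A_def)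
    qed
  qed
qed

lemma locally_smooth_bump_detect: "p \<in> UNIV \<times> T \<Longrightarrow> locally_smooth (bump_detect p)"
proof -
  assume "p \<in> UNIV \<times> T"
  moreover have "0 < 1 / 2 - 4 * bump_step (fst p)" using bump_step(2)[of "fst p"] by linarith
  ultimately show ?thesis unfolding bump_detect_def
    by (intro locally_smooth_detect bump_step) auto
qed

lemma bump_locally_zero:
  assumes "x \<in> V" "1 / 2 \<le> N x"
  shows "\<exists>r>0. \<forall>y\<in>nball x r. bump y = 0"
proof -
  obtain t where t: "t \<in> T" "1 / 2 \<le> \<bar>x t\<bar>" using sup_norm_attained[OF assms(1) _ assms(2)] by auto
  obtain M where M: "finite M" "M \<subseteq> {t \<in> T. 1 / 2 \<le> \<bar>x t\<bar>}"
    "\<And>t. t \<in> T \<Longrightarrow> 1 / 2 \<le> \<bar>x t\<bar> \<Longrightarrow> \<exists>m\<in>M. le t m"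
    "\<And>m u. m \<in> M \<Longrightarrow> u \<in> T \<Longrightarrow> m \<in> below u \<Longrightarrow> \<bar>x u\<bar> < 1 / 2"
    by (rule C0_large_maximal[OF assms(1), of "1 / 2"]) auto
  obtain m where m: "m \<in> M" using M(3) t by blast
  then have mT: "m \<in> T" "1 / 2 \<le> \<bar>x m\<bar>" using M(2) by auto
  obtain c where c: "0 < c" "c < 1 / 2" "\<And>m s. m \<in> M \<Longrightarrow> s \<in> successors m \<Longrightarrow> \<bar>x s\<bar> \<le> c"
    by (rule successor_gap[OF assms(1) _ M(1,4)]) auto
  \<comment> \<open>Five steps must fit between \<open>c\<close> and 1/2: four down to the lower end
    of the gap and one for the perturbation of the successors. At \<open>m\<close> a single step is
    lost, which still reaches the upper end \<open>1/2 - bump_step j\<close>.\<close>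
  obtain j where j: "bump_step j < (1 / 2 - c) / 5" using bump_step_small[of "(1 / 2 - c) / 5"] c(2) by auto
  have "bump y = 0" if y: "y \<in> nball x (bump_step j)" for y
  proof (cases "1 / 2 \<le> N y")
    case False
    have yV: "y \<in> V" using y nball_subset by blast
    note near = nballD[OF y assms(1)]
    have "bump_detect (j, m) y = 1"
      unfolding bump_detect_def fst_conv snd_conv
    proof (rule detect_eq_1[OF _ bump_step(1)])
      show "0 < 1 / 2 - 4 * bump_step j" using bump_step(2)[of j] by linarith
      show "1 / 2 - 4 * bump_step j + 3 * bump_step j \<le> \<bar>y m\<bar>"
        using near[OF mT(1)] mT(2) by (simp add: abs_if split: if_splits)
      fix s assume s: "s \<in> successors m"
      then have "s \<in> T" using successors_subset by blast
      then show "\<bar>y s\<bar> \<le> 1 / 2 - 4 * bump_step j"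
        using near[of s] c(3)[OF m s] j by (simp add: abs_if split: if_splits)
    qed
    \<comment> \<open>Finiteness makes the vanishing factor count, since a product over an infinite
      index set is 1.\<close>
    moreover have "finite {p \<in> UNIV \<times> T. bump_detect p y \<noteq> 0}"
    proof -
      obtain r A where "r > 0" "finite A" "\<And>z. z \<in> nball y r \<Longrightarrow> {p \<in> UNIV \<times> T. bump_detect p z \<noteq> 0} \<subseteq> A"
        by (rule bump_locally_finite[OF yV]) (use False in auto)
      then show ?thesis using centre_mem_nball[OF yV] finite_subset by blast
    qed
    ultimately have "(\<Prod>p\<in>{p \<in> UNIV \<times> T. bump_detect p y \<noteq> 0}. 1 - bump_detect p y) = 0"
      using mT(1) by (intro prod_zero bexI[of _ "(j, m)"]) simp_all
    then show ?thesis by (simp add: bump_def)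
  qed (simp add: bump_def)
  then show ?thesis using bump_step(1) by blast
qed

lemma locally_smooth_bump: "locally_smooth bump"
proof (rule locally_smooth_local)
  fix x assume x: "x \<in> V"
  show "\<exists>r>0. \<exists>G. locally_smooth G \<and> (\<forall>y\<in>nball x r. bump y = G y)"
  proof (cases "1 / 2 \<le> N x")
    case True
    then show ?thesis using bump_locally_zero[OF x] locally_smooth_const[of 0] by blast
  next
    case False
    obtain r A where r: "r > 0" "finite A" "A \<subseteq> UNIV \<times> T" "\<And>y. y \<in> nball x r \<Longrightarrow> N y < 1 / 2"
      "\<And>y. y \<in> nball x r \<Longrightarrow> {p \<in> UNIV \<times> T. bump_detect p y \<noteq> 0} \<subseteq> A"
      by (rule bump_locally_finite[OF x]) (use False in auto)
    have "bump y = (\<Prod>p\<in>A. 1 - bump_detect p y)" if y: "y \<in> nball x r" for y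
      unfolding bump_def using r(2,3) r(4,5)[OF y] by (auto intro!: prod.mono_neutral_left)
    moreover have "locally_smooth (\<lambda>y. \<Prod>p\<in>A. 1 - bump_detect p y)"
      using r(3) by (intro locally_smooth_prod locally_smooth_diff locally_smooth_const locally_smooth_bump_detect) auto
    ultimately show ?thesis using r(1) by blast
  qed
qed

lemma bump_nonneg: "0 \<le> bump f"
  unfolding bump_def bump_detect_def using detect_le_1 by (auto intro!: prod_nonneg)

lemma bump_nonzeroD: "bump f \<noteq> 0 \<Longrightarrow> N f < 1 / 2"
  by (auto simp: bump_def split: if_splits)

text \<open>All gaps lie at or above 1/4, so nothing is detected and the product is empty.\<close>

lemma bump_eq_1:
  assumes "f \<in> V" "N f < 1 / 4"
  shows "bump f = 1"
proof -
  have "bump_detect p f = 0" if "p \<in> UNIV \<times> T" for p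
  proof (rule ccontr)
    assume "bump_detect p f \<noteq> 0"
    then have "1 / 4 < \<bar>f (snd p)\<bar>"
      using bump_detect_nonzeroD[OF _ assms(1), of p] bump_step[of "fst p"] by linarith
    then show False using abs_le_sup_norm[OF assms(1), of "snd p"] that assms(2) by auto
  qed
  then have "(\<Prod>p\<in>{p \<in> UNIV \<times> T. bump_detect p f \<noteq> 0}. 1 - bump_detect p f) = 1"
    by (intro prod.neutral) blast
  then show ?thesis using assms(2) by (simp add: bump_def)
qed

section \<open>Step functions on the tree\<close>

definition step_fun :: "'a set \<Rightarrow> ('a set \<Rightarrow> real) \<Rightarrow> 'a \<Rightarrow> real" where
  "step_fun F c t = (if t \<in> T \<and> {s \<in> F. le t s} \<noteq> {} then c {s \<in> F. le t s} else 0)"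

text \<open>The sets \<open>down s\<close> are open and closed, so the set of members of
  \<open>F\<close> above a node is locally constant. Step functions depend on this set alone; the
  value 0 at the empty set keeps their support inside the compact union of the sets
  \<open>down s\<close>.\<close>

lemma openin_step_pattern:
  assumes "finite F" "F \<subseteq> T"
  shows "openin X {t \<in> T. P {s \<in> F. le t s}}"
proof (subst openin_subopen, intro ballI)
  fix t assume t: "t \<in> {t \<in> T. P {s \<in> F. le t s}}"
  define W where "W = (\<Inter>s\<in>F. if le t s then down s else T - down s) \<inter> topspace X"
  have "openin X W"
    unfolding W_def using assms openin_down openin_not_down by (intro openin_INT) auto
  moreover have "t \<in> W" using t by (auto simp: W_def topspace_tree mem_down)
  moreover have "W \<subseteq> {t \<in> T. P {s \<in> F. le t s}}"
  proof
    fix u assume u: "u \<in> W"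
    then have uT: "u \<in> T" by (auto simp: W_def topspace_tree)
    have "le u s \<longleftrightarrow> le t s" if "s \<in> F" for s
    proof -
      have "u \<in> (if le t s then down s else T - down s)" using u that unfolding W_def by blast
      then show ?thesis using uT by (auto simp: mem_down split: if_splits)
    qed
    then have "{s \<in> F. le u s} = {s \<in> F. le t s}" by blast
    then show "u \<in> {t \<in> T. P {s \<in> F. le t s}}" using t uT by simp
  qed
  ultimately show "\<exists>W. openin X W \<and> t \<in> W \<and> W \<subseteq> {t \<in> T. P {s \<in> F. le t s}}" by blast
qed

lemma step_fun_mem:
  assumes "finite F" "F \<subseteq> T"
  shows "step_fun F c \<in> V"
proof (rule mem_C0I)
  show "continuous_map X euclideanreal (step_fun F c)"
    unfolding continuous_map_def
  proof (intro conjI allI impI)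
    fix U :: "real set"
    have "{t \<in> topspace X. step_fun F c t \<in> U} = {t \<in> T. (if {s \<in> F. le t s} \<noteq> {} then c {s \<in> F. le t s} else 0) \<in> U}"
      by (auto simp: step_fun_def topspace_tree)
    then show "openin X {t \<in> topspace X. step_fun F c t \<in> U}"
      using openin_step_pattern[OF assms, of "\<lambda>S. (if S \<noteq> {} then c S else 0) \<in> U"] by simp
  qed simp
  show "step_fun F c t = 0" if "t \<notin> T" for t using that by (simp add: step_fun_def)
  fix e :: real assume "e > 0"
  then have "{t \<in> T. e \<le> \<bar>step_fun F c t\<bar>} \<subseteq> \<Union>(down ` F)"
    by (auto simp: step_fun_def mem_down split: if_splits)
  moreover have "compactin X (\<Union>(down ` F))"
    using assms compactin_down by (intro compactin_Union) auto
  ultimately show "\<exists>K. compactin X K \<and> {t \<in> T. e \<le> \<bar>step_fun F c t\<bar>} \<subseteq> K" by blast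
qed

text \<open>Enumerating the countably many rational assignments moves the choice of values into the
  index \<open>n\<close>. For fixed \<open>n\<close> each \<open>F\<close> carries one step
  function, so finitely many sets \<open>F\<close> mean finitely many functions.\<close>

definition rational_step_fun :: "'a set \<Rightarrow> nat \<Rightarrow> 'a \<Rightarrow> real" where
  "rational_step_fun F n = step_fun F (from_nat_into (PiE (Pow F) (\<lambda>_. \<rat>)) n)"

lemma step_fun_cong:
  assumes "\<And>S. S \<subseteq> F \<Longrightarrow> c S = c' S"
  shows "step_fun F c = step_fun F c'"
  using assms by (auto simp: step_fun_def fun_eq_iff)

lemma rational_step_fun_surj:
  assumes "finite F" "\<And>S. c S \<in> \<rat>"
  shows "\<exists>n. rational_step_fun F n = step_fun F c"
proof -
  have countable: "countable (PiE (Pow F) (\<lambda>_. \<rat> :: real set))"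
    using assms(1) countable_rat by (intro countable_PiE) auto
  have "restrict c (Pow F) \<in> PiE (Pow F) (\<lambda>_. \<rat>)" using assms(2) by auto
  from from_nat_into_surj[OF countable this] obtain n
    where "from_nat_into (PiE (Pow F) (\<lambda>_. \<rat>)) n = restrict c (Pow F)" by blast
  then have "rational_step_fun F n = step_fun F c"
    unfolding rational_step_fun_def by (intro step_fun_cong) auto
  then show ?thesis by blast
qed

lemma step_approximation:
  assumes "f \<in> V" "e > 0" "finite F"
    and osc: "\<And>t t'. t \<in> T \<Longrightarrow> t' \<in> T \<Longrightarrow> {s \<in> F. le t s} = {s \<in> F. le t' s} \<Longrightarrow>
      {s \<in> F. le t s} \<noteq> {} \<Longrightarrow> \<bar>f t - f t'\<bar> < e"
    and small: "\<And>t. t \<in> T \<Longrightarrow> {s \<in> F. le t s} = {} \<Longrightarrow> \<bar>f t\<bar> < e"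
  shows "\<exists>n. N (\<lambda>t. f t - rational_step_fun F n t) < 3 * e"
proof -
  \<comment> \<open>A representative of the class of nodes with pattern \<open>S\<close>. For a
    pattern that no node has it is arbitrary, but the value assigned there is never taken.
    Oscillation and rational approximation each cost \<open>e\<close>.\<close>
  define pick where "pick S = (SOME t. t \<in> T \<and> {s \<in> F. le t s} = S)" for S
  have "\<forall>S. \<exists>q\<in>\<rat>. \<bar>f (pick S) - q\<bar> < e"
  proof
    fix S
    obtain q where "q \<in> \<rat>" "f (pick S) - e < q" "q < f (pick S) + e"
      using Rats_dense_in_real[of "f (pick S) - e" "f (pick S) + e"] assms(2) by auto
    then show "\<exists>q\<in>\<rat>. \<bar>f (pick S) - q\<bar> < e" by (intro bexI[of _ q]) auto
  qed
  then obtain c where c: "\<And>S. c S \<in> \<rat>" "\<And>S. \<bar>f (pick S) - c S\<bar> < e" by metis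
  obtain n where n: "rational_step_fun F n = step_fun F c"
    using rational_step_fun_surj[OF assms(3), of c] c(1) by blast
  have "\<bar>f t - step_fun F c t\<bar> \<le> 2 * e" if t: "t \<in> T" for t
  proof (cases "{s \<in> F. le t s} = {}")
    case True
    then show ?thesis using small[OF t True] assms(2) by (simp add: step_fun_def)
  next
    case False
    let ?t = "pick {s \<in> F. le t s}"
    have "?t \<in> T \<and> {s \<in> F. le ?t s} = {s \<in> F. le t s}"
      unfolding pick_def by (rule someI[of _ t]) (use t in auto)
    then have "\<bar>f t - f ?t\<bar> < e" using osc[OF t, of ?t] False by simp
    then have "\<bar>f t - c {s \<in> F. le t s}\<bar> \<le> 2 * e"
      using c(2)[of "{s \<in> F. le t s}"] by linarith
    then show ?thesis using t False by (simp add: step_fun_def)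
  qed
  then have "N (\<lambda>t. f t - rational_step_fun F n t) \<le> 2 * e"
    unfolding n using assms(2) by (intro sup_norm_le) auto
  then show ?thesis using assms(2) by (intro exI[of _ n]) linarith
qed

lemma positive_lower_bound:
  fixes g :: "'b \<Rightarrow> real"
  assumes "finite A" "\<And>x. x \<in> A \<Longrightarrow> 0 < g x"
  obtains c where "0 < c" "\<And>x. x \<in> A \<Longrightarrow> c < g x"
proof -
  have "0 < Min (insert 1 (g ` A))" using assms by (subst Min_gr_iff) auto
  moreover have "Min (insert 1 (g ` A)) \<le> g x" if "x \<in> A" for x
    using assms(1) that by (intro Min_le) auto
  ultimately show ?thesis
    by (intro that[of "Min (insert 1 (g ` A)) / 2"]) force+
qed

lemma approximation_by_marked_nodes:
  assumes f: "f \<in> V" and "\<epsilon> > 0"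
  obtains q d :: rat and F n where "q > 0" "d > 0" "finite F" "F \<subseteq> node_pairs"
    "\<And>p. p \<in> F \<Longrightarrow> mark (of_rat q) (of_rat d) p f \<noteq> 0"
    "N (\<lambda>t. f t - rational_step_fun (fst ` F) n t) < \<epsilon>"
proof -
  define e where "e = \<epsilon> / 3"
  have e: "e > 0" using assms(2) by (simp add: e_def)
  obtain M where M: "finite M" "M \<subseteq> {t \<in> T. e \<le> \<bar>f t\<bar>}"
    "\<And>t. t \<in> T \<Longrightarrow> e \<le> \<bar>f t\<bar> \<Longrightarrow> \<exists>m\<in>M. le t m"
    "\<And>m u. m \<in> M \<Longrightarrow> u \<in> T \<Longrightarrow> m \<in> below u \<Longrightarrow> \<bar>f u\<bar> < e"
    by (rule C0_large_maximal[OF f e]) auto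
  have "\<forall>m\<in>M. \<exists>B. finite B \<and> B \<subseteq> below m \<and> (\<forall>s\<in>B. f (next_node s m) \<noteq> f s) \<and>
    (\<forall>w\<in>down m. \<forall>v\<in>down w. (\<forall>s\<in>B. \<not> (le v s \<and> s \<in> below w)) \<longrightarrow> \<bar>f v - f w\<bar> < e)"
    using chain_separators[OF f e] M(2) by blast
  from bchoice[OF this] obtain B where B: "\<forall>m\<in>M. finite (B m) \<and> B m \<subseteq> below m \<and> (\<forall>s\<in>B m. f (next_node s m) \<noteq> f s) \<and>
    (\<forall>w\<in>down m. \<forall>v\<in>down w. (\<forall>s\<in>B m. \<not> (le v s \<and> s \<in> below w)) \<longrightarrow> \<bar>f v - f w\<bar> < e)" ..
  have B_fin: "finite (B m)" and B_below: "B m \<subseteq> below m" and B_jump: "\<forall>s\<in>B m. f (next_node s m) \<noteq> f s"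
    and B_sep: "\<forall>w\<in>down m. \<forall>v\<in>down w. (\<forall>s\<in>B m. \<not> (le v s \<and> s \<in> below w)) \<longrightarrow> \<bar>f v - f w\<bar> < e"
    if "m \<in> M" for m
    using bspec[OF B that] by simp_all
  define F where "F = (\<Union>m\<in>M. (\<lambda>s. (s, m)) ` insert m (B m))"
  have fst_F: "fst ` F = (\<Union>m\<in>M. insert m (B m))" by (force simp: F_def)
  have fin: "finite F" unfolding F_def using M(1) B_fin by auto
  have pairs: "F \<subseteq> node_pairs"
  proof
    fix p assume "p \<in> F"
    then obtain m s where p: "p = (s, m)" "m \<in> M" "s = m \<or> s \<in> B m" by (auto simp: F_def)
    have mT: "m \<in> T" using p(2) M(2) by blast
    have "s \<in> down m" using p(3) B_below[OF p(2)] le_refl[OF mT] mT below_imp_down by (auto simp: mem_down)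
    with mT
    show "p \<in> node_pairs" by (simp add: node_pairs_def p)
  qed
  obtain c where c: "0 < c" "c < e" "\<And>m s. m \<in> M \<Longrightarrow> s \<in> successors m \<Longrightarrow> \<bar>f s\<bar> \<le> c"
    by (rule successor_gap[OF f e M(1,4)]) auto
  have "0 < \<bar>f (next_node (fst p) (snd p)) - f (fst p)\<bar>" if "p \<in> {p \<in> F. fst p \<noteq> snd p}" for p
    using that B_jump by (auto simp: F_def)
  then obtain \<mu> where \<mu>: "0 < \<mu>" "\<And>p. p \<in> {p \<in> F. fst p \<noteq> snd p} \<Longrightarrow> \<mu> < \<bar>f (next_node (fst p) (snd p)) - f (fst p)\<bar>"
    using positive_lower_bound[of "{p \<in> F. fst p \<noteq> snd p}" "\<lambda>p. \<bar>f (next_node (fst p) (snd p)) - f (fst p)\<bar>"] fin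
    by auto
  \<comment> \<open>The quarters give \<open>q + 3 d < e\<close>, so the whole gap fits between the
    successor values and the value at the maximal node; \<open>d\<close> below \<open>\<mu>\<close>
    makes every jump in \<open>F\<close> exceed the threshold.\<close>
  obtain d :: rat where d: "0 < real_of_rat d" "real_of_rat d < min \<mu> ((e - c) / 4)"
    using of_rat_dense[of 0 "min \<mu> ((e - c) / 4)"] \<mu>(1) c(2) by auto
  obtain q :: rat where q: "c < real_of_rat q" "real_of_rat q < c + (e - c) / 4"
    using of_rat_dense[of c "c + (e - c) / 4"] c(2) by auto
  have q0: "0 < real_of_rat q" using q(1) c(1) by linarith
  have marks: "mark (of_rat q) (of_rat d) p f \<noteq> 0" if p: "p \<in> F" for p
  proof -
    have m: "snd p \<in> M" using p by (auto simp: F_def)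
    have "detect (of_rat q) (of_rat d) (snd p) f = 1"
    proof (rule detect_eq_1)
      have "e \<le> \<bar>f (snd p)\<bar>" using m M(2) by blast
      moreover have "real_of_rat d < (e - c) / 4" using d(2) by simp
      ultimately show "real_of_rat q + 3 * real_of_rat d \<le> \<bar>f (snd p)\<bar>"
        using q(2) by (simp add: field_simps)
      show "\<bar>f s\<bar> \<le> real_of_rat q" if "s \<in> successors (snd p)" for s
        using c(3)[OF m that] q(1) by simp
    qed (rule q0 d(1))+
    moreover have "threshold (of_rat d) (2 * of_rat d) (f (next_node (fst p) (snd p)) - f (fst p)) \<noteq> 0"
      if "fst p \<noteq> snd p"
      using threshold_eq_0_iff[of "of_rat d" "2 * of_rat d"] \<mu>(2)[of p] p that d by auto
    ultimately show ?thesis by (simp add: mark_def)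
  qed
  have "\<exists>n. N (\<lambda>t. f t - rational_step_fun (fst ` F) n t) < 3 * e"
  proof (rule step_approximation[OF f e])
    show "finite (fst ` F)" using fin by simp
    fix t assume t: "t \<in> T"
    show "\<bar>f t\<bar> < e" if empty: "{s \<in> fst ` F. le t s} = {}"
    proof (rule ccontr)
      assume "\<not> \<bar>f t\<bar> < e"
      then obtain m where "m \<in> M" "le t m" using M(3)[OF t] by force
      then have "m \<in> {s \<in> fst ` F. le t s}" by (auto simp: fst_F)
      then show False using empty by blast
    qed
    \<comment> \<open>A separator \<open>s\<close> in the stretch from \<open>v\<close> to
      \<open>w\<close> would lie above \<open>v\<close> but not above \<open>w\<close>,
      contradicting the equality of the two sets.\<close>
    have key: "\<bar>f v - f w\<bar> < e" if "v \<in> T" "w \<in> T" "m \<in> M" "le w m" "le v w"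
      and same: "{s \<in> fst ` F. le v s} = {s \<in> fst ` F. le w s}" for v w m
    proof -
      have "\<not> (le v s \<and> s \<in> below w)" if s: "s \<in> B m" for s
      proof
        assume *: "le v s \<and> s \<in> below w"
        have "s \<in> fst ` F" using s \<open>m \<in> M\<close> by (auto simp: fst_F)
        then have "le w s" using * same by blast
        then show False using below_irrefl[of s w] * \<open>w \<in> T\<close> by (simp add: mem_below)
      qed
      moreover have "w \<in> down m" "v \<in> down w" using that by (auto simp: mem_down)
      ultimately show ?thesis using B_sep[OF \<open>m \<in> M\<close>] by blast
    qed
    fix t' assume t': "t' \<in> T" and eq: "{s \<in> fst ` F. le t s} = {s \<in> fst ` F. le t' s}"
      and ne: "{s \<in> fst ` F. le t s} \<noteq> {}"
    obtain s m where s: "m \<in> M" "s = m \<or> s \<in> B m" "le t s" using ne by (auto simp: fst_F)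
    have mT: "m \<in> T" using s(1) M(2) by blast
    have "s \<in> down m" using s(2) B_below[OF s(1)] le_refl[OF mT] mT below_imp_down by (auto simp: mem_down)
    then have tm: "le t m" using s(3) t mT le_trans[of t s m] by (auto simp: mem_down)
    have "m \<in> fst ` F" using s(1) by (auto simp: fst_F)
    then have tm': "le t' m" using tm eq by blast
    have "le t t' \<or> le t' t" using down_linear[OF mT, of t t'] t t' tm tm' by (simp add: mem_down)
    then show "\<bar>f t - f t'\<bar> < e"
      using key[OF t t' s(1) tm' _ eq] key[OF t' t s(1) tm _ eq[symmetric]] by (auto simp: abs_minus_commute)
  qed
  then obtain n where "N (\<lambda>t. f t - rational_step_fun (fst ` F) n t) < \<epsilon>" by (auto simp: e_def)
  then show ?thesis using that[of q d F n] q0 d(1) fin pairs marks by auto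
qed

section \<open>Assembling the locally finite levels\<close>

definition base_fun :: "rat \<Rightarrow> rat \<Rightarrow> nat \<Rightarrow> nat \<Rightarrow> ('a \<times> 'a) set \<Rightarrow> ('a \<Rightarrow> real) \<Rightarrow> real" where
  "base_fun q d k n F f = (\<Prod>p\<in>F. mark (of_rat q) (of_rat d) p f) *
     bump (\<lambda>t. real (Suc k) * (f t - rational_step_fun (fst ` F) n t))"

text \<open>Everything countable goes into the level; only the finite set \<open>F\<close> of pairs
  varies within it. The marks control \<open>F\<close> near a point, while the bump, rescaled by
  \<open>Suc k\<close>, makes the support small.\<close>

definition base_family :: "rat \<times> rat \<times> nat \<times> nat \<Rightarrow> (('a \<Rightarrow> real) \<Rightarrow> real) set" where
  "base_family = (\<lambda>(q, d, k, n). if 0 < q \<and> 0 < d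
     then base_fun q d k n ` {F. finite F \<and> F \<subseteq> node_pairs} else {})"

lemma rational_step_fun_mem:
  assumes "finite F" "F \<subseteq> node_pairs"
  shows "rational_step_fun (fst ` F) n \<in> V"
  unfolding rational_step_fun_def using assms node_pairs_cases(2) by (intro step_fun_mem) auto

lemma locally_finite_base_family: "locally_finite_family (base_family i)"
proof -
  obtain q d k n where i: "i = (q, d, k, n)" by (cases i)
  show ?thesis
  proof (cases "0 < q \<and> 0 < d")
    case True
    then have qd: "0 < real_of_rat q" "0 < real_of_rat d" by simp_all
    show ?thesis
      unfolding locally_finite_family_def
    proof
      fix x assume x: "x \<in> V"
      define A where "A = {p \<in> node_pairs. \<exists>g\<in>nball x (of_rat d / 4). mark (of_rat q) (of_rat d) p g \<noteq> 0}"
      have "finite A" unfolding A_def by (rule mark_locally_finite[OF qd x])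
      have "{h \<in> base_family i. \<exists>y\<in>nball x (of_rat d / 4). h y \<noteq> 0} \<subseteq> base_fun q d k n ` Pow A"
      proof
        fix h assume "h \<in> {h \<in> base_family i. \<exists>y\<in>nball x (of_rat d / 4). h y \<noteq> 0}"
        then obtain F y where F: "finite F" "F \<subseteq> node_pairs" "h = base_fun q d k n F"
          and y: "y \<in> nball x (of_rat d / 4)" "h y \<noteq> 0"
          using True by (auto simp: base_family_def i)
        have "mark (of_rat q) (of_rat d) p y \<noteq> 0" if "p \<in> F" for p
          using y(2) F(1) that unfolding F(3) base_fun_def by (auto simp: prod_zero_iff)
        then have "F \<subseteq> A" using F(2) y(1) unfolding A_def by blast
        then show "h \<in> base_fun q d k n ` Pow A" using F(3) by blast
      qed
      then have "finite {h \<in> base_family i. \<exists>y\<in>nball x (of_rat d / 4). h y \<noteq> 0}"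
        using \<open>finite A\<close> finite_subset by blast
      then show "\<exists>r>0. finite {h \<in> base_family i. \<exists>y\<in>nball x r. h y \<noteq> 0}"
        using qd(2) by (intro exI[of _ "of_rat d / 4"]) simp
    qed
  qed (auto simp: base_family_def i locally_finite_family_def intro: zero_less_one)
qed

lemma locally_smooth_base_family:
  assumes "h \<in> base_family i"
  shows "locally_smooth h"
proof -
  obtain q d k n F where F: "finite F" "F \<subseteq> node_pairs" "h = base_fun q d k n F" "0 < q" "0 < d"
    using assms by (auto simp: base_family_def split: prod.splits if_splits)
  have "locally_smooth (\<lambda>f. \<Prod>p\<in>F. mark (of_rat q) (of_rat d) p f)"
    using F by (intro locally_smooth_prod locally_smooth_mark) auto
  moreover have "locally_smooth (\<lambda>f. bump (\<lambda>t. real (Suc k) * (f t - rational_step_fun (fst ` F) n t)))"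
    by (rule locally_smooth_rescale[OF locally_smooth_bump rational_step_fun_mem[OF F(1,2)]])
  ultimately show ?thesis unfolding F(3) base_fun_def by (rule locally_smooth_mult)
qed

text \<open>After scaling by \<open>K\<close>, the distance from \<open>x\<close> to the step
  function is below 1/4, where the bump is 1, and on the support it is below 1/2. The triangle
  inequality gives less than 1, that is, an unscaled distance below
  \<open>inverse K\<close>.\<close>

lemma base_family_small_support:
  assumes x: "x \<in> V" and "\<epsilon> > 0"
  shows "\<exists>i. \<exists>h\<in>base_family i. h x \<noteq> 0 \<and> (\<forall>y\<in>V. h y \<noteq> 0 \<longrightarrow> N (\<lambda>t. y t - x t) < \<epsilon>)"
proof -
  obtain k where "inverse (real (Suc k)) < \<epsilon>" using reals_Archimedean[OF assms(2)] by blast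
  define K where "K = real (Suc k)"
  have K: "K > 0" "inverse K < \<epsilon>" using \<open>inverse (real (Suc k)) < \<epsilon>\<close> by (simp_all add: K_def)
  obtain q d F n where F: "q > 0" "d > 0" "finite F" "F \<subseteq> node_pairs"
    "\<And>p. p \<in> F \<Longrightarrow> mark (of_rat q) (of_rat d) p x \<noteq> 0"
    "N (\<lambda>t. x t - rational_step_fun (fst ` F) n t) < inverse K / 4"
    by (rule approximation_by_marked_nodes[OF x, of "inverse K / 4"]) (use K(1) in auto)
  define g where "g = rational_step_fun (fst ` F) n"
  have g: "g \<in> V" unfolding g_def by (rule rational_step_fun_mem[OF F(3,4)])
  have scaled: "N (\<lambda>t. K * (y t - g t)) = K * N (\<lambda>t. y t - g t)" if "y \<in> V" for y
    using norm_scale[OF diff_mem[OF that g], of K] K(1) by simp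
  have eq: "base_fun q d k n F y = (\<Prod>p\<in>F. mark (of_rat q) (of_rat d) p y) *
      bump (\<lambda>t. K * (y t - g t))" for y
    by (simp add: base_fun_def g_def K_def)
  have "K * N (\<lambda>t. x t - g t) < K * (inverse K / 4)"
    using F(6) by (intro mult_strict_left_mono) (auto simp: g_def K)
  then have Nx: "N (\<lambda>t. K * (x t - g t)) < 1 / 4" using K(1) by (simp add: scaled[OF x])
  have "bump (\<lambda>t. K * (x t - g t)) = 1"
    by (rule bump_eq_1[OF scale_mem[OF diff_mem[OF x g]] Nx])
  then have "base_fun q d k n F x \<noteq> 0" using F(3,5) by (simp add: eq)
  moreover have "N (\<lambda>t. y t - x t) < \<epsilon>" if y: "y \<in> V" "base_fun q d k n F y \<noteq> 0" for y
  proof -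
    have "K * N (\<lambda>t. y t - g t) < 1 / 2"
      using y(2) bump_nonzeroD[of "\<lambda>t. K * (y t - g t)"] by (auto simp: eq scaled[OF y(1)])
    moreover have "K * N (\<lambda>t. x t - g t) < 1 / 4" using Nx K(1) by (simp add: scaled[OF x])
    ultimately have "K * (N (\<lambda>t. y t - g t) + N (\<lambda>t. g t - x t)) < 1"
      by (simp add: norm_diff_commute[OF g x] algebra_simps)
    then have "N (\<lambda>t. y t - g t) + N (\<lambda>t. g t - x t) < inverse K"
      using K(1) by (simp add: field_simps)
    then show ?thesis using norm_diff_triangle[OF y(1) g x] K(2) by linarith
  qed
  moreover have "base_fun q d k n F \<in> base_family (q, d, k, n)" using F by (auto simp: base_family_def)
  ultimately show ?thesis by blast
qed

theorem C0_smooth_partitions_of_unity: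
  assumes "open_cover V N \<U>"
  shows "\<exists>\<Phi>. smooth_lf_pou_subordinate V N \<U> \<Phi>"
proof (rule smooth_pou_of_sigma_locally_finite_base[of "\<lambda>j. base_family (from_nat j)"])
  show "locally_finite_family (base_family (from_nat j))" for j by (rule locally_finite_base_family)
  show "locally_smooth h" if "h \<in> base_family (from_nat j)" for h j
    using that by (rule locally_smooth_base_family)
  show "0 \<le> h x" if "h \<in> base_family (from_nat j)" for h j x
    using that mark_nonneg bump_nonneg
    by (auto simp: base_family_def base_fun_def intro!: mult_nonneg_nonneg prod_nonneg
        split: prod.splits if_splits)
  fix x and \<epsilon> :: real assume "x \<in> V" "\<epsilon> > 0"
  from base_family_small_support[OF this]
  show "\<exists>j. \<exists>h\<in>base_family (from_nat j). h x \<noteq> 0 \<and> (\<forall>y\<in>V. h y \<noteq> 0 \<longrightarrow> N (\<lambda>t. y t - x t) < \<epsilon>)"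
    by (metis from_nat_to_nat)
qed (rule assms)

end

theorem theorem9p4:
  fixes T :: "'a set" and le :: "'a \<Rightarrow> 'a \<Rightarrow> bool"
    and \<U> :: "('a \<Rightarrow> real) set set"
  assumes "is_tree T le"
    and "open_cover (C0 T le) (sup_norm T) \<U>"
  shows "\<exists>\<Phi>. smooth_lf_pou_subordinate (C0 T le) (sup_norm T) \<U> \<Phi>"
proof -
  interpret tree T le by unfold_locales (rule assms(1))
  show ?thesis by (rule C0_smooth_partitions_of_unity[OF assms(2)])
qed

end
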